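(* There exists an absolute constant $C$ such that the following holds. Let $\epsilon>0$ and $c\in[3/7+\epsilon,1/2-\epsilon]$, and let $n>\frac{C}{\epsilon}k$. Suppose $\mathcal F\subset\binom{[n]}{k}$ is intersecting, satisfies $\Delta(\mathcal F)\le c|\mathcal F|$, and has the largest cardinality among all intersecting families in $\binom{[n]}{k}$ satisfying $\Delta(\cdot)\le c|\cdot|$. Then $\mathcal F$ is isomorphic to $\mathcal D_{3/7}$.
   Context: A family is intersecting if any two of its sets intersect; $\Delta(\mathcal F)$ is the maximum over $i$ of the number of sets of $\mathcal F$ containing $i$. Families are isomorphic if they differ by a permutation of $[n]$. A Fano plane $\mathcal P$ is a family of seven $3$-element sets $P_1,\dots,P_7$ with $|P_i\cap P_j|=1$ for all $i\ne j$ (taken inside $[n]$). $\mathcal D_{3/7}=\{F\in\binom{[n]}{k}: P\subset F \text{ for some } P\in\mathcal P\}$.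
   Formalization: The Fano plane is additionally required to span exactly 7 points, excluding only seven triples through one common point (for which the claim fails); a set is also required to meet itself, which matters only for k = 0. *)

theory Defs
  imports Complex_Main "HOL-Library.Ramsey" "HOL-Combinatorics.Permutations"
begin

text \<open>
  The ground set $[n]$ is \<open>{1..n}\<close>, and the family of all its \<open>k\<close>-element subsets is
  \<open>nsets {1..n} k\<close>.
\<close>

definition intersecting :: "nat set set \<Rightarrow> bool" where
  "intersecting \<F> \<longleftrightarrow> (\<forall>A\<in>\<F>. \<forall>B\<in>\<F>. A \<inter> B \<noteq> {})"

definition max_degree :: "nat \<Rightarrow> nat set set \<Rightarrow> nat" where
  "max_degree n \<F> = (MAX i\<in>{1..n}. card {A \<in> \<F>. i \<in> A})"

definition isomorphic_families :: "nat \<Rightarrow> nat set set \<Rightarrow> nat set set \<Rightarrow> bool" where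
  "isomorphic_families n \<F> \<G> \<longleftrightarrow> (\<exists>\<pi>. \<pi> permutes {1..n} \<and> \<G> = (\<lambda>A. \<pi> ` A) ` \<F>)"

text \<open>
  Without the last conjunct, seven triples that share one common point and are otherwise
  disjoint would also qualify.  That sunflower, which spans 15 points, is the only
  configuration excluded: the remaining ones are exactly the projective planes of order 2.
\<close>

definition fano_plane :: "nat set set \<Rightarrow> bool" where
  "fano_plane \<P> \<longleftrightarrow> card \<P> = 7 \<and> (\<forall>P\<in>\<P>. card P = 3) \<and>
     (\<forall>P\<in>\<P>. \<forall>Q\<in>\<P>. P \<noteq> Q \<longrightarrow> card (P \<inter> Q) = 1) \<and> card (\<Union>\<P>) = 7"

definition fano_family :: "nat set set \<Rightarrow> nat \<Rightarrow> nat \<Rightarrow> nat set set" where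
  "fano_family \<P> n k = {F \<in> nsets {1..n} k. \<exists>P\<in>\<P>. P \<subseteq> F}"

lemma fano_plane_exists:
  assumes "7 \<le> n"
  shows "\<exists>\<P>. fano_plane \<P> \<and> \<Union>\<P> \<subseteq> {1..n}"
proof -
  let ?P = "{{1,2,3},{1,4,5},{1,6,7},{2,4,6},{2,5,7},{3,4,7},{3,5,6}} :: nat set set"
  have U: "\<Union>?P = {1,2,3,4,5,6,7}"
    by auto
  have "card ?P = 7"
  proof -
    have "distinct [{1,2,3},{1,4,5},{1,6,7},{2,4,6},{2,5,7},{3,4,7},{3,5,6::nat}]"
      by (simp add: set_eq_subset)
    from distinct_card[OF this] show ?thesis by simp
  qed
  moreover have "card (\<Union>?P) = 7"
    unfolding U by simp
  ultimately have "fano_plane ?P"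
    unfolding fano_plane_def by simp
  moreover have "\<Union>?P \<subseteq> {1..n}"
    unfolding U using assms by auto
  ultimately show ?thesis by blast
qed

end

theory Submission
  imports Defs
begin

text \<open>
  Write $p = k/n$ and let a random set of rate $l$ contain each point independently with
  probability $1 - e^{-l}$, so that rates add under unions.  Call a set $X$ of at most three points
  a core set if adding a random set of rate at most $\ln 2$ to $X$ produces a superset of a member
  of $\mathcal F$ with probability close to 1.  Since a random half of the ground set and its complement have the
  same distribution, the core sets of an intersecting family pairwise intersect.

  All but $O(p^4) \binom nk$ members of $\mathcal F$ contain a core set.  To see this, split a random set
  $V \in \mathcal F$ into $m$ independent parts.  If no union of at most three parts were almost core,
  then comparing with about $1/p$ independent copies of each part, the second moment method would
  make the union of all copies very likely to lie in $\mathcal F$, unless such $V$ have probability $O(p^4)$;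
  pairs of choices agreeing in $i$ parts are controlled by induction on the exponent.  Iterating on a
  union of three parts, whose rate is smaller by a constant factor $M$ and which can be chosen in $O(M^3)$
  ways, gives a convergent series of errors of order $M^{3r} (p / M^r)^4$ and ends with at
  most three points.

  If the core sets had a fractional cover of weight 2, some point would have degree at least
  $(1/2 - \epsilon) |\mathcal F|$.  An intersecting family of triples without such a cover is a Fano
  plane.  Finally, if $x$ members of $\mathcal F$ avoid a line $P$, then
  $\mu_{1/2} \ge \mu_{1/32}^{1/5}$ shows that they exclude far more than $x$ of the sets containing
  $P$, so a largest family has no exceptional members.
\<close>

section \<open>Random subsets of a finite set\<close>

text \<open>The exponents determine each other. The Fano family has order p^3 (n choose k), so an
  error O(p^4) is negligible once p is small against \<epsilon>; this is why core sets may have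
  three points, and why four parts are too many. Size alone does not remove the exceptional sets.
  Write N for n choose k and N3 for (n - 3) choose (k - 3). If x exceptional sets avoid P, comparing
  density 1/2 with density 2^(-r) shows that they exclude at least a constant times N3 (x / N)^(1/r)
  supersets of P. This beats x when x^(r-1) is small against N3^r / N. With x = O(p^4 N) and N3 of
  order p^3 N this requires 4 (r - 1) > 3 r; the least such r is 5, whence the density 1/32. The
  second obstacle is uniformity in n. In the iteration n occurs only in a term that vanishes as the
  number of rounds grows. In passing to k-sets, containing a member of F but no core set is not a
  monotone event, so the local LYM inequality does not apply to it; it becomes monotone after fixing
  the trace on a set of bounded size that contains all minimal core sets.\<close>

definition rsexp :: "'a set \<Rightarrow> real \<Rightarrow> ('a set \<Rightarrow> real) \<Rightarrow> real" where
  "rsexp S p \<phi> = (\<Sum>V\<in>Pow S. p ^ card V * (1 - p) ^ card (S - V) * \<phi> V)"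

definition rsprob :: "'a set \<Rightarrow> real \<Rightarrow> ('a set \<Rightarrow> bool) \<Rightarrow> real" where
  "rsprob S p g = rsexp S p (\<lambda>V. of_bool (g V))"

lemma rsexp_empty [simp]: "rsexp {} p \<phi> = \<phi> {}"
  by (simp add: rsexp_def)

text \<open>Conditioning on a single point. The distribution identities below are inductions over
  \<open>S\<close> through this equation.\<close>

lemma rsexp_insert:
  assumes "finite S" "x \<notin> S"
  shows "rsexp (insert x S) p \<phi>
       = p * rsexp S p (\<lambda>V. \<phi> (insert x V)) + (1 - p) * rsexp S p \<phi>"
proof -
  have inj: "inj_on (insert x) (Pow S)"
    using assms(2) by (auto simp: inj_on_def)
  have disj: "Pow S \<inter> insert x ` Pow S = {}"
    using assms(2) by auto
  have a: "(\<Sum>V\<in>insert x ` Pow S. p ^ card V * (1 - p) ^ card (insert x S - V) * \<phi> V)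
      = p * rsexp S p (\<lambda>V. \<phi> (insert x V))"
    unfolding sum.reindex[OF inj] rsexp_def sum_distrib_left o_def
  proof (rule sum.cong[OF refl])
    fix V assume V: "V \<in> Pow S"
    then have "card (insert x V) = Suc (card V)" "insert x S - insert x V = S - V"
      using assms finite_subset[of V S] by (auto intro!: card_insert_disjoint)
    then show "p ^ card (insert x V) * (1 - p) ^ card (insert x S - insert x V) * \<phi> (insert x V)
      = p * (p ^ card V * (1 - p) ^ card (S - V) * \<phi> (insert x V))" by simp
  qed
  have b: "(\<Sum>V\<in>Pow S. p ^ card V * (1 - p) ^ card (insert x S - V) * \<phi> V) = (1 - p) * rsexp S p \<phi>"
    unfolding rsexp_def sum_distrib_left
  proof (rule sum.cong[OF refl])
    fix V assume V: "V \<in> Pow S"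
    then have "insert x S - V = insert x (S - V)" using assms by auto
    then have "card (insert x S - V) = Suc (card (S - V))"
      using assms by simp
    then show "p ^ card V * (1 - p) ^ card (insert x S - V) * \<phi> V
      = (1 - p) * (p ^ card V * (1 - p) ^ card (S - V) * \<phi> V)" by simp
  qed
  show ?thesis
    unfolding rsexp_def[of "insert x S"] Pow_insert
    by (subst sum.union_disjoint) (use assms disj a b in auto)
qed

lemma rsexp_add: "rsexp S p (\<lambda>V. \<phi> V + \<psi> V) = rsexp S p \<phi> + rsexp S p \<psi>"
  by (simp add: rsexp_def algebra_simps sum.distrib)

lemma rsexp_cmult: "rsexp S p (\<lambda>V. c * \<phi> V) = c * rsexp S p \<phi>"
  by (simp add: rsexp_def algebra_simps sum_distrib_left)

lemma rsexp_const [simp]: "finite S \<Longrightarrow> rsexp S p (\<lambda>_. c) = c"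
  by (induction S rule: finite_induct) (simp_all add: rsexp_insert algebra_simps)

lemma rsexp_cong: "(\<And>V. V \<subseteq> S \<Longrightarrow> \<phi> V = \<psi> V) \<Longrightarrow> rsexp S p \<phi> = rsexp S p \<psi>"
  by (auto simp: rsexp_def intro!: sum.cong)

lemma rsexp_mono:
  assumes "0 \<le> p" "p \<le> 1" "\<And>V. V \<subseteq> S \<Longrightarrow> \<phi> V \<le> \<psi> V"
  shows "rsexp S p \<phi> \<le> rsexp S p \<psi>"
  unfolding rsexp_def using assms by (intro sum_mono mult_left_mono) auto

lemma rsexp_nonneg:
  assumes "0 \<le> p" "p \<le> 1" "\<And>V. V \<subseteq> S \<Longrightarrow> 0 \<le> \<phi> V"
  shows "0 \<le> rsexp S p \<phi>"
  unfolding rsexp_def using assms by (intro sum_nonneg mult_nonneg_nonneg) auto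

lemma rsexp_swap:
  "rsexp S p (\<lambda>V. rsexp T q (\<lambda>W. \<phi> V W)) = rsexp T q (\<lambda>W. rsexp S p (\<lambda>V. \<phi> V W))"
  unfolding rsexp_def sum_distrib_left
  by (subst sum.swap) (intro sum.cong refl, simp add: algebra_simps)

text \<open>A point is missed by two independent sets with probability (1 - p)(1 - q).\<close>

lemma rsexp_union:
  assumes "finite S"
  shows "rsexp S p (\<lambda>V. rsexp S q (\<lambda>W. \<phi> (V \<union> W))) = rsexp S (p + q - p * q) \<phi>"
  using assms
proof (induction S arbitrary: \<phi> rule: finite_induct)
  case (insert x S)
  have a: "rsexp S p (\<lambda>V. rsexp S q (\<lambda>W. \<phi> (insert x (V \<union> W)))) = rsexp S (p + q - p * q) (\<lambda>V. \<phi> (insert x V))"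
    using insert.IH[of "\<lambda>V. \<phi> (insert x V)"] by simp
  show ?case
    using insert.hyps
    by (simp add: rsexp_insert rsexp_add rsexp_cmult insert.IH a, simp add: algebra_simps)
qed simp

lemma rsexp_inter:
  assumes "finite S"
  shows "rsexp S p (\<lambda>V. rsexp S q (\<lambda>W. \<phi> (V \<inter> W))) = rsexp S (p * q) \<phi>"
  using assms
proof (induction S arbitrary: \<phi> rule: finite_induct)
  case (insert x S)
  have a: "rsexp S p (\<lambda>V. rsexp S q (\<lambda>W. \<phi> (insert x (V \<inter> W)))) = rsexp S (p * q) (\<lambda>V. \<phi> (insert x V))"
    using insert.IH[of "\<lambda>V. \<phi> (insert x V)"] by simp
  have b: "rsexp S p (\<lambda>V. rsexp S q (\<lambda>W. \<phi> (insert x V \<inter> W))) = rsexp S (p * q) \<phi>"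
    "rsexp S p (\<lambda>V. rsexp S q (\<lambda>W. \<phi> (V \<inter> insert x W))) = rsexp S (p * q) \<phi>"
    unfolding insert.IH[symmetric] using insert.hyps
    by (auto intro!: rsexp_cong arg_cong[of _ _ \<phi>])
  show ?case
    using insert.hyps
    by (simp add: rsexp_insert rsexp_add rsexp_cmult insert.IH a b, simp add: algebra_simps)
qed simp

lemma rsexp_split:
  assumes "finite S" "finite T" "S \<inter> T = {}"
  shows "rsexp (S \<union> T) p \<phi> = rsexp S p (\<lambda>V. rsexp T p (\<lambda>W. \<phi> (V \<union> W)))"
  using assms
proof (induction S arbitrary: \<phi> rule: finite_induct)
  case (insert x S)
  then show ?case by (simp add: rsexp_insert)
qed simp

lemma rsexp_power_card:
  assumes "finite S"
  shows "rsexp S p (\<lambda>V. x ^ card V) = (1 - p + p * x) ^ card S"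
  using assms
proof (induction S rule: finite_induct)
  case (insert y S)
  have "rsexp S p (\<lambda>V. x ^ card (insert y V)) = rsexp S p (\<lambda>V. x * x ^ card V)"
    using insert.hyps by (intro rsexp_cong) (auto simp: finite_subset card_insert_if subset_iff)
  then show ?case
    using insert by (simp add: rsexp_insert rsexp_cmult algebra_simps)
qed simp

lemma rsexp_compl:
  assumes "finite S"
  shows "rsexp S p (\<lambda>V. \<phi> (S - V)) = rsexp S (1 - p) \<phi>"
  using assms
proof (induction S arbitrary: \<phi> rule: finite_induct)
  case (insert x S)
  have a: "rsexp S p (\<lambda>V. \<phi> (insert x S - insert x V)) = rsexp S p (\<lambda>V. \<phi> (S - V))"
    using insert.hyps by (intro rsexp_cong arg_cong[of _ _ \<phi>]) auto
  have b: "rsexp S p (\<lambda>V. \<phi> (insert x S - V)) = rsexp S p (\<lambda>V. (\<lambda>Z. \<phi> (insert x Z)) (S - V))"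
    using insert.hyps by (intro rsexp_cong) (auto simp: insert_Diff_if subset_iff)
  show ?case
    using insert.hyps by (simp add: rsexp_insert a b insert.IH insert.IH[of "\<lambda>Z. \<phi> (insert x Z)"])
qed simp

lemma rsprob_nonneg: "0 \<le> p \<Longrightarrow> p \<le> 1 \<Longrightarrow> 0 \<le> rsprob S p g"
  by (simp add: rsprob_def rsexp_nonneg)

lemma rsprob_mono:
  assumes "0 \<le> p" "p \<le> 1" "\<And>V. V \<subseteq> S \<Longrightarrow> g V \<Longrightarrow> h V"
  shows "rsprob S p g \<le> rsprob S p h"
  unfolding rsprob_def using assms by (intro rsexp_mono) auto

lemma rsprob_le_1: "finite S \<Longrightarrow> 0 \<le> p \<Longrightarrow> p \<le> 1 \<Longrightarrow> rsprob S p g \<le> 1"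
  using rsexp_mono[of p S "\<lambda>V. of_bool (g V)" "\<lambda>_. 1"] by (simp add: rsprob_def)

lemma rsprob_cong: "(\<And>V. V \<subseteq> S \<Longrightarrow> g V = h V) \<Longrightarrow> rsprob S p g = rsprob S p h"
  by (simp add: rsprob_def cong: rsexp_cong)

lemma rsprob_not: "finite S \<Longrightarrow> rsprob S p (\<lambda>V. \<not> g V) = 1 - rsprob S p g"
proof -
  assume "finite S"
  have "rsexp S p (\<lambda>V. of_bool (\<not> g V) + of_bool (g V)) = rsexp S p (\<lambda>_. 1)"
    by (intro rsexp_cong) simp
  then show ?thesis using \<open>finite S\<close> by (simp add: rsexp_add rsprob_def)
qed

lemma rsprob_disj_le:
  assumes "0 \<le> p" "p \<le> 1"
  shows "rsprob S p (\<lambda>V. g V \<or> h V) \<le> rsprob S p g + rsprob S p h"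
  unfolding rsprob_def rsexp_add[symmetric] using assms by (intro rsexp_mono) auto

lemma rsprob_bex_le:
  assumes "finite A" "0 \<le> p" "p \<le> 1"
  shows "rsprob S p (\<lambda>V. \<exists>a\<in>A. g a V) \<le> (\<Sum>a\<in>A. rsprob S p (g a))"
  using assms(1)
proof (induction A rule: finite_induct)
  case (insert a A)
  have "rsprob S p (\<lambda>V. \<exists>b\<in>insert a A. g b V) \<le> rsprob S p (g a) + rsprob S p (\<lambda>V. \<exists>a\<in>A. g a V)"
    using rsprob_disj_le[OF assms(2,3), of S "g a" "\<lambda>V. \<exists>a\<in>A. g a V"] by simp
  then show ?case using insert by simp
qed (simp add: rsprob_def rsexp_def)

lemma rsprob_superset:
  assumes "finite S" "T \<subseteq> S"
  shows "rsprob S p (\<lambda>V. T \<subseteq> V) = p ^ card T"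
proof -
  have fin: "finite T" "finite (S - T)" using assms finite_subset by auto
  have "rsprob S p (\<lambda>V. T \<subseteq> V) = rsexp T p (\<lambda>V. rsexp (S - T) p (\<lambda>W. of_bool (T \<subseteq> V \<union> W)))"
    unfolding rsprob_def using rsexp_split[OF fin, of p "\<lambda>V. of_bool (T \<subseteq> V)"] assms
    by (simp add: Un_absorb1)
  also have "\<dots> = rsexp T p (\<lambda>V. rsexp (S - T) p (\<lambda>W. of_bool (V = T)))"
    by (intro rsexp_cong arg_cong[of _ _ of_bool]) auto
  also have "\<dots> = (\<Sum>V\<in>Pow T. if V = T then p ^ card T else 0)"
    using fin by (simp only: rsexp_const) (auto simp: rsexp_def intro!: sum.cong)
  also have "\<dots> = p ^ card T"
    using fin by simp
  finally show ?thesis .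
qed

section \<open>Random sets parametrised by rate\<close>

definition dens :: "real \<Rightarrow> real" where "dens l = 1 - exp (- l)"

lemma dens_bounds: "0 \<le> l \<Longrightarrow> 0 \<le> dens l" "dens l \<le> 1" "dens l \<le> l"
  using exp_ge_add_one_self[of "- l"] by (auto simp: dens_def)

lemma dens_add: "dens (a + b) = dens a + dens b - dens a * dens b"
  by (simp add: dens_def exp_add algebra_simps exp_minus exp_diff divide_inverse)

lemma dens_mult: "dens (real m * l) = 1 - (1 - dens l) ^ m"
  by (simp add: dens_def exp_of_nat_mult[symmetric])

lemma rsexp_dens_union:
  "finite S \<Longrightarrow> rsexp S (dens a) (\<lambda>V. rsexp S (dens b) (\<lambda>W. \<phi> (V \<union> W))) = rsexp S (dens (a + b)) \<phi>"
  by (simp add: rsexp_union dens_add)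

text \<open>Coupling: a random set of rate \<open>b\<close> is one of rate \<open>a\<close> together
  with an independent one of rate \<open>b - a\<close>.\<close>

lemma rsprob_dens_mono:
  assumes "finite S" "0 \<le> a" "a \<le> b" "\<And>V W. V \<subseteq> W \<Longrightarrow> g V \<Longrightarrow> g W"
  shows "rsprob S (dens a) g \<le> rsprob S (dens b) g"
proof -
  have "rsprob S (dens a) g = rsexp S (dens a) (\<lambda>V. rsexp S (dens (b - a)) (\<lambda>W. of_bool (g V)))"
    using assms by (simp add: rsprob_def)
  also have "\<dots> \<le> rsexp S (dens a) (\<lambda>V. rsexp S (dens (b - a)) (\<lambda>W. of_bool (g (V \<union> W))))"
    using assms(2,3) assms(4)[OF Un_upper1] by (intro rsexp_mono dens_bounds) auto
  also have "\<dots> = rsprob S (dens b) g"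
    using rsexp_dens_union[OF assms(1), of a "b - a" "\<lambda>V. of_bool (g V)"] by (simp add: rsprob_def)
  finally show ?thesis .
qed

section \<open>Tuples of independent random sets and the second moment method\<close>

locale random_set =
  fixes S :: "'a set" and p :: real
  assumes finite_S: "finite S" and p_nonneg: "0 \<le> p" and p_le_1: "p \<le> 1"
begin

definition resample :: "'i \<Rightarrow> (('i \<Rightarrow> 'a set) \<Rightarrow> real) \<Rightarrow> ('i \<Rightarrow> 'a set) \<Rightarrow> real" where
  "resample a \<phi> v = rsexp S p (\<lambda>V. \<phi> (v(a := V)))"

text \<open>Coordinates in \<open>A\<close> are integrated out and all others keep their value in
  the argument, so one operator serves both as expectation and as conditional expectation given the
  coordinates outside \<open>A\<close>.\<close>

definition tupexp :: "'i set \<Rightarrow> (('i \<Rightarrow> 'a set) \<Rightarrow> real) \<Rightarrow> ('i \<Rightarrow> 'a set) \<Rightarrow> real" where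
  "tupexp A \<phi> = Finite_Set.fold resample \<phi> A"

text \<open>Fubini for two coordinates, which makes the fold independent of the order of
  integration.\<close>

lemma comp_fun_commute_resample: "comp_fun_commute_on UNIV resample"
proof
  fix a b :: 'i
  show "resample b \<circ> resample a = (resample a \<circ> resample b :: (('i \<Rightarrow> 'a set) \<Rightarrow> real) \<Rightarrow> _)"
  proof (cases "a = b")
    case False
    show ?thesis
    proof (rule ext, rule ext)
      fix \<phi> :: "('i \<Rightarrow> 'a set) \<Rightarrow> real" and v
      have "(resample b \<circ> resample a) \<phi> v = rsexp S p (\<lambda>V. rsexp S p (\<lambda>W. \<phi> (v(b := V, a := W))))"
        by (simp add: resample_def)
      also have "\<dots> = rsexp S p (\<lambda>W. rsexp S p (\<lambda>V. \<phi> (v(b := V, a := W))))"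
        by (rule rsexp_swap)
      also have "\<dots> = (resample a \<circ> resample b) \<phi> v"
        using False by (simp add: resample_def fun_upd_twist)
      finally show "(resample b \<circ> resample a) \<phi> v = (resample a \<circ> resample b) \<phi> v" .
    qed
  qed simp
qed

lemma tupexp_empty [simp]: "tupexp {} \<phi> = \<phi>"
  by (simp add: tupexp_def)

lemma tupexp_insert:
  assumes "finite A" "a \<notin> A"
  shows "tupexp (insert a A) \<phi> = resample a (tupexp A \<phi>)"
    and "tupexp (insert a A) \<phi> = tupexp A (resample a \<phi>)"
  using comp_fun_commute_on.fold_insert[OF comp_fun_commute_resample subset_UNIV assms]
    comp_fun_commute_on.fold_insert2[OF comp_fun_commute_resample subset_UNIV assms]
  by (simp_all add: tupexp_def)

lemma tupexp_union:
  assumes "finite A" "finite B" "A \<inter> B = {}"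
  shows "tupexp (A \<union> B) \<phi> = tupexp A (tupexp B \<phi>)"
  using assms by (induction A rule: finite_induct) (simp_all add: tupexp_insert)

lemma tupexp_subset:
  assumes "finite B" "A \<subseteq> B"
  shows "tupexp B \<phi> = tupexp (B - A) (tupexp A \<phi>)"
proof -
  have "finite A" using assms finite_subset by blast
  then show ?thesis
    using tupexp_union[of "B - A" A \<phi>] assms by (simp add: Un_absorb2 Diff_disjoint Int_commute)
qed

lemma tupexp_mono:
  assumes "finite A" "\<And>v'. (\<And>a. a \<notin> A \<Longrightarrow> v' a = v a) \<Longrightarrow> \<phi> v' \<le> \<psi> v'"
  shows "tupexp A \<phi> v \<le> tupexp A \<psi> v"
  using assms
proof (induction A arbitrary: v rule: finite_induct)
  case (insert a A)
  have "tupexp A \<phi> (v(a := V)) \<le> tupexp A \<psi> (v(a := V))" for V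
    by (rule insert.IH, rule insert.prems) (auto split: if_splits)
  then show ?case
    using insert.hyps by (auto simp: tupexp_insert(1) resample_def intro!: rsexp_mono p_nonneg p_le_1)
qed simp

lemma tupexp_add:
  "finite A \<Longrightarrow> tupexp A (\<lambda>v. \<phi> v + \<psi> v) = (\<lambda>v. tupexp A \<phi> v + tupexp A \<psi> v)"
  by (induction A rule: finite_induct) (auto simp: tupexp_insert(1) resample_def rsexp_add)

lemma tupexp_cmult: "finite A \<Longrightarrow> tupexp A (\<lambda>v. c * \<phi> v) = (\<lambda>v. c * tupexp A \<phi> v)"
  by (induction A rule: finite_induct) (auto simp: tupexp_insert(1) resample_def rsexp_cmult)

lemma tupexp_const [simp]: "finite A \<Longrightarrow> tupexp A (\<lambda>v. c) = (\<lambda>v. c)"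
  by (induction A rule: finite_induct) (auto simp: tupexp_insert(1) resample_def finite_S)

lemma tupexp_sum:
  assumes "finite A"
  shows "tupexp A (\<lambda>v. \<Sum>x\<in>X. \<phi> x v) = (\<lambda>v. \<Sum>x\<in>X. tupexp A (\<phi> x) v)"
  by (induction X rule: infinite_finite_induct) (simp_all add: tupexp_add[OF assms] assms)

definition depends_on :: "'i set \<Rightarrow> (('i \<Rightarrow> 'a set) \<Rightarrow> real) \<Rightarrow> bool" where
  "depends_on B \<phi> \<longleftrightarrow> (\<forall>v v'. (\<forall>b\<in>B. v b = v' b) \<longrightarrow> \<phi> v = \<phi> v')"

lemma depends_onD: "depends_on B \<phi> \<Longrightarrow> (\<And>b. b \<in> B \<Longrightarrow> v b = v' b) \<Longrightarrow> \<phi> v = \<phi> v'"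
  unfolding depends_on_def by blast

text \<open>Taking out what is known, in the language of conditional expectation.\<close>

lemma tupexp_pull:
  assumes "finite A" "depends_on (- A) \<phi>"
  shows "tupexp A (\<lambda>v. \<phi> v * \<psi> v) = (\<lambda>v. \<phi> v * tupexp A \<psi> v)"
  using assms
proof (induction A rule: finite_induct)
  case (insert a A)
  have "depends_on (- A) \<phi>"
    using insert.prems by (auto simp: depends_on_def)
  moreover have "\<phi> (v(a := V)) = \<phi> v" for v V
    using insert.prems by (rule depends_onD) auto
  ultimately show ?case
    using insert by (simp add: tupexp_insert(1) resample_def rsexp_cmult)
qed simp

lemma depends_on_tupexp:
  assumes "finite A" "depends_on B \<phi>"
  shows "depends_on (B - A) (tupexp A \<phi>)"
  using assms(1)
proof (induction A rule: finite_induct)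
  case (insert a A)
  show ?case
    unfolding depends_on_def
  proof (intro allI impI)
    fix v v' :: "'b \<Rightarrow> 'a set" assume eq: "\<forall>b\<in>B - insert a A. v b = v' b"
    have "tupexp A \<phi> (v(a := V)) = tupexp A \<phi> (v'(a := V))" for V
      using insert.IH by (rule depends_onD) (use eq in auto)
    then show "tupexp (insert a A) \<phi> v = tupexp (insert a A) \<phi> v'"
      using insert.hyps by (simp add: tupexp_insert(1) resample_def)
  qed
qed (simp add: assms)

lemma tupexp_reindex:
  assumes "finite A" "inj e"
  shows "tupexp (e ` A) (\<lambda>v. \<phi> (v \<circ> e)) = (\<lambda>v. tupexp A \<phi> (v \<circ> e))"
  using assms(1)
proof (induction A rule: finite_induct)
  case (insert a A)
  have upd: "(v(e a := V)) \<circ> e = (v \<circ> e)(a := V)" for v :: "'c \<Rightarrow> 'a set" and V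
    using assms(2) by (auto simp: fun_eq_iff inj_eq)
  have "e a \<notin> e ` A"
    using insert.hyps assms(2) by (auto simp: inj_eq)
  show ?case
    unfolding image_insert tupexp_insert(1)[OF finite_imageI[OF insert.hyps(1)] \<open>e a \<notin> e ` A\<close>]
      tupexp_insert(1)[OF insert.hyps] resample_def insert.IH upd by (rule refl)
qed simp

lemma tupexp_Union:
  assumes "finite A"
  shows "tupexp A (\<lambda>v. \<phi> (Y \<union> \<Union>(v ` A))) v = rsexp S (1 - (1 - p) ^ card A) (\<lambda>V. \<phi> (Y \<union> V))"
  using assms
proof (induction A arbitrary: \<phi> rule: finite_induct)
  case empty
  have "rsexp S 0 \<psi> = \<psi> {}" for \<psi>
    using finite_S by (induction S arbitrary: \<psi> rule: finite_induct) (simp_all add: rsexp_insert)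
  then show ?case by simp
next
  case (insert a A)
  have "tupexp (insert a A) (\<lambda>v. \<phi> (Y \<union> \<Union>(v ` insert a A))) v
      = tupexp A (\<lambda>v. rsexp S p (\<lambda>V. \<phi> ((Y \<union> \<Union>(v ` A)) \<union> V))) v"
    using insert.hyps
    by (auto simp: tupexp_insert(2) resample_def fun_eq_iff Un_ac cong: image_cong
        intro!: arg_cong2[of _ _ _ _ tupexp] arg_cong[of _ _ "\<lambda>f. tupexp A f v"] rsexp_cong arg_cong[of _ _ \<phi>])
  also have "\<dots> = rsexp S (1 - (1 - p) ^ card A) (\<lambda>W. rsexp S p (\<lambda>V. \<phi> (Y \<union> (W \<union> V))))"
    by (subst insert.IH) (simp add: Un_assoc)
  also have "\<dots> = rsexp S (1 - (1 - p) ^ card (insert a A)) (\<lambda>V. \<phi> (Y \<union> V))"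
    using insert.hyps by (subst rsexp_union[OF finite_S]) (simp add: algebra_simps)
  finally show ?case .
qed

text \<open>\<open>N\<close> counts the choices of one of \<open>t\<close> copies for each
  coordinate that satisfy \<open>\<beta>\<close>. In its second moment a pair of choices agreeing
  exactly on a nonempty \<open>I\<close> contributes at most \<open>P * \<kappa> (card I)\<close>,
  and a given choice has at most \<open>t ^ (card A - card I)\<close> such partners. The pairs with
  \<open>I\<close> empty account for the squared mean, so only overlaps enter the bound.\<close>

lemma second_moment:
  fixes \<beta> :: "('i \<Rightarrow> 'a set) \<Rightarrow> bool" and t :: nat
  assumes A: "finite A" and t: "0 < t"
    and dep: "\<And>v v'. (\<And>a. a \<in> A \<Longrightarrow> v a = v' a) \<Longrightarrow> \<beta> v \<Longrightarrow> \<beta> v'"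
    and \<kappa>0: "\<And>i. 0 \<le> \<kappa> i"
    and \<kappa>: "\<And>I v. I \<subseteq> A \<Longrightarrow> I \<noteq> {} \<Longrightarrow> \<beta> v \<Longrightarrow> tupexp (A - I) (\<lambda>v. of_bool (\<beta> v)) v \<le> \<kappa> (card I)"
  shows "tupexp A (\<lambda>v. of_bool (\<beta> v)) v0 *
     (1 - tupexp (A \<times> {..<t}) (\<lambda>v. of_bool (\<exists>s\<in>A \<rightarrow>\<^sub>E {..<t}. \<beta> (\<lambda>a. v (a, s a)))) v1)
     \<le> (\<Sum>I\<in>Pow A - {{}}. \<kappa> (card I) / real t ^ card I)"
proof -
  define b where "b = (\<lambda>v. of_bool (\<beta> v) :: real)"
  define P where "P = tupexp A b v0"
  define \<Sigma> where "\<Sigma> = (A \<rightarrow>\<^sub>E {..<t})"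
  \<comment> \<open>Composition with \<open>e s\<close> reads off, from the array of all copies, the
    tuple selected by \<open>s\<close>.\<close>
  define e where "e = (\<lambda>s (a::'i). (a, s a :: nat))"
  define X where "X = (\<lambda>s v. b (v \<circ> e s))"
  define N where "N = (\<lambda>v. \<Sum>s\<in>\<Sigma>. X s v)"
  define G where "G = A \<times> {..<t}"
  define ag where "ag = (\<lambda>s s'. {a\<in>A. s a = (s' a :: nat)})"
  \<comment> \<open>Choices that agree nowhere are independent, which gives the factor
    \<open>P\<close> for the empty set.\<close>
  define \<kappa>' where "\<kappa>' = (\<lambda>I :: 'i set. if I = {} then P else \<kappa> (card I))"
  define m where "m = card A"
  have finG: "finite G" and fin\<Sigma>: "finite \<Sigma>"
    using A by (auto simp: G_def \<Sigma>_def intro!: finite_PiE)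
  have cardS: "card \<Sigma> = t ^ m"
    using A by (simp add: \<Sigma>_def m_def card_PiE)
  have inje: "inj (e s)" for s by (auto simp: e_def inj_on_def)
  have depb: "depends_on A b"
    unfolding depends_on_def b_def
  proof (intro allI impI)
    fix v v' :: "'i \<Rightarrow> 'a set" assume "\<forall>b\<in>A. v b = v' b"
    then have "\<beta> v = \<beta> v'" using dep[of v v'] dep[of v' v] by auto
    then show "of_bool (\<beta> v) = (of_bool (\<beta> v') :: real)" by simp
  qed
  have P: "tupexp A b v = P" for v
    using depends_on_tupexp[OF A depb] by (simp add: P_def depends_on_def)
  have P0: "0 \<le> P"
    using tupexp_mono[OF A, of v0 "\<lambda>_. 0" b] A by (simp add: P_def b_def)
  have XB: "tupexp B (X s) v = P" if "finite B" "e s ` A \<subseteq> B" for B s v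
  proof -
    have "tupexp (e s ` A) (X s) = (\<lambda>v. P)"
      unfolding X_def using tupexp_reindex[OF A inje, of s b] P by simp
    then show ?thesis
      using tupexp_subset[OF that, of "X s"] that by simp
  qed
  have eG: "e s ` A \<subseteq> G" if "s \<in> \<Sigma>" for s
    using that by (auto simp: e_def G_def \<Sigma>_def)
  have EN: "tupexp G N v = real t ^ m * P" for v
    unfolding N_def tupexp_sum[OF finG] using XB[OF finG eG] by (simp add: cardS)
  have XX: "tupexp G (\<lambda>v. X s v * X s' v) v \<le> \<kappa>' (ag s s') * P" if s: "s \<in> \<Sigma>" "s' \<in> \<Sigma>" for s s' v
  proof -
    define I where "I = ag s s'"
    \<comment> \<open>These are the cells used by the second choice only. Integrating them first
      leaves a conditional probability given the shared cells, to which the hypothesis on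
      \<open>\<kappa>\<close> applies.\<close>
    define D where "D = e s' ` (A - I)"
    have finD: "finite D" and DG: "D \<subseteq> G" and IA: "I \<subseteq> A"
      using A eG[OF s(2)] by (auto simp: D_def I_def ag_def)
    have disj: "D \<inter> e s ` A = {}"
      by (auto simp: D_def I_def ag_def e_def)
    have "depends_on (- D) (X s)"
      unfolding depends_on_def
    proof (intro allI impI)
      fix v v' :: "'i \<times> nat \<Rightarrow> 'a set" assume "\<forall>b\<in>- D. v b = v' b"
      then have "\<forall>a\<in>A. (v \<circ> e s) a = (v' \<circ> e s) a" using disj by auto
      then show "X s v = X s v'" using depb by (simp add: X_def depends_on_def)
    qed
    then have "tupexp D (\<lambda>v. X s v * X s' v) = (\<lambda>v. X s v * tupexp D (X s') v)"
      by (rule tupexp_pull[OF finD])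
    also have "tupexp D (X s') = (\<lambda>v. tupexp (A - I) b (v \<circ> e s'))"
      unfolding D_def X_def using A by (intro tupexp_reindex inje) auto
    finally have 1: "tupexp G (\<lambda>v. X s v * X s' v) v
        = tupexp (G - D) (\<lambda>v. X s v * tupexp (A - I) b (v \<circ> e s')) v"
      using tupexp_subset[OF finG DG] by simp
    have 2: "X s v * tupexp (A - I) b (v \<circ> e s') \<le> \<kappa>' I * X s v" for v
    proof (cases "I = {}")
      case True
      then show ?thesis by (simp add: \<kappa>'_def P)
    next
      case False
      show ?thesis
      proof (cases "X s v = 0")
        case False
        then have be: "\<beta> (v \<circ> e s)" "X s v = 1" by (auto simp: X_def b_def)
        have "depends_on (A - (A - I)) (tupexp (A - I) b)"
          using A depb by (intro depends_on_tupexp) auto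
        then have "tupexp (A - I) b (v \<circ> e s') = tupexp (A - I) b (v \<circ> e s)"
          by (rule depends_onD) (auto simp: I_def ag_def e_def)
        also have "\<dots> \<le> \<kappa> (card I)"
          using \<kappa>[OF IA \<open>I \<noteq> {}\<close> be(1)] by (simp add: b_def)
        finally show ?thesis using \<open>I \<noteq> {}\<close> be by (simp add: \<kappa>'_def)
      qed simp
    qed
    have "tupexp G (\<lambda>v. X s v * X s' v) v \<le> tupexp (G - D) (\<lambda>v. \<kappa>' I * X s v) v"
      unfolding 1 using finG 2 by (intro tupexp_mono) auto
    also have "\<dots> = \<kappa>' I * P"
      using XB[of "G - D" s] finG eG[OF s(1)] disj by (simp add: tupexp_cmult Int_commute) blast
    finally show ?thesis by (simp add: I_def)
  qed
  have \<kappa>'0: "0 \<le> \<kappa>' I" for I by (simp add: \<kappa>'_def P0 \<kappa>0)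
  have cnt: "(\<Sum>s'\<in>\<Sigma>. \<kappa>' (ag s s')) \<le> (\<Sum>I\<in>Pow A. real t ^ (m - card I) * \<kappa>' I)" if s: "s \<in> \<Sigma>" for s
  proof -
    have "(\<Sum>s'\<in>\<Sigma>. \<kappa>' (ag s s')) = (\<Sum>I\<in>Pow A. \<Sum>s'\<in>{s'\<in>\<Sigma>. ag s s' = I}. \<kappa>' (ag s s'))"
      using A fin\<Sigma> by (subst sum.group) (auto simp: ag_def)
    also have "\<dots> = (\<Sum>I\<in>Pow A. real (card {s'\<in>\<Sigma>. ag s s' = I}) * \<kappa>' I)"
      by (intro sum.cong) auto
    also have "\<dots> \<le> (\<Sum>I\<in>Pow A. real t ^ (m - card I) * \<kappa>' I)"
    proof (intro sum_mono mult_right_mono \<kappa>'0)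
      fix I assume I: "I \<in> Pow A"
      \<comment> \<open>On \<open>I\<close> the second choice is forced; elsewhere it is bounded by
        all \<open>t\<close> possibilities.\<close>
      define R where "R = (\<lambda>a. if a \<in> I then {s a} else {..<t})"
      have "{s'\<in>\<Sigma>. ag s s' = I} \<subseteq> PiE A R"
        by (auto simp: \<Sigma>_def R_def ag_def PiE_iff extensional_def)
      moreover have "finite (PiE A R)" using A by (intro finite_PiE) (auto simp: R_def)
      ultimately have "card {s'\<in>\<Sigma>. ag s s' = I} \<le> card (PiE A R)" by (rule card_mono[rotated])
      also have "\<dots> = (\<Prod>a\<in>A. if a \<in> I then 1 else t)"
        using A by (auto simp: card_PiE R_def intro!: prod.cong)
      also have "\<dots> = t ^ card (A - I)"
        using A by (simp add: prod.If_cases Diff_eq)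
      also have "card (A - I) = m - card I"
        using I A finite_subset[of I A] by (simp add: m_def card_Diff_subset)
      finally show "real (card {s'\<in>\<Sigma>. ag s s' = I}) \<le> real t ^ (m - card I)"
        by (simp flip: of_nat_power)
    qed
    finally show ?thesis .
  qed
  have EN2: "tupexp G (\<lambda>v. N v * N v) v \<le> real t ^ m * P * (\<Sum>I\<in>Pow A. real t ^ (m - card I) * \<kappa>' I)" for v
  proof -
    have "tupexp G (\<lambda>v. N v * N v) v = (\<Sum>s\<in>\<Sigma>. \<Sum>s'\<in>\<Sigma>. tupexp G (\<lambda>v. X s v * X s' v) v)"
      by (simp add: N_def sum_product tupexp_sum[OF finG])
    also have "\<dots> \<le> (\<Sum>s\<in>\<Sigma>. P * (\<Sum>s'\<in>\<Sigma>. \<kappa>' (ag s s')))"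
      unfolding sum_distrib_left using XX by (intro sum_mono) (simp add: mult.commute)
    also have "\<dots> \<le> (\<Sum>s\<in>\<Sigma>. P * (\<Sum>I\<in>Pow A. real t ^ (m - card I) * \<kappa>' I))"
      using cnt P0 by (intro sum_mono mult_left_mono) auto
    finally show ?thesis by (simp add: cardS)
  qed
  define Q where "Q = tupexp G (\<lambda>v. of_bool (\<exists>s\<in>\<Sigma>. \<beta> (\<lambda>a. v (a, s a)))) v1"
  \<comment> \<open>A linear substitute for the Cauchy-Schwarz step: 2 c N - c^2 N^2 = 1 - (c N -
    1)^2 never exceeds 1 and vanishes where N = 0.\<close>
  have low: "2 * c * (real t ^ m * P) - c\<^sup>2 * tupexp G (\<lambda>v. N v * N v) v1 \<le> Q" for c :: real
  proof -
    have "2 * c * N v + (- (c\<^sup>2)) * (N v * N v) \<le> of_bool (\<exists>s\<in>\<Sigma>. \<beta> (\<lambda>a. v (a, s a)))" for v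
    proof (cases "\<exists>s\<in>\<Sigma>. \<beta> (\<lambda>a. v (a, s a))")
      case True
      have "0 \<le> (c * N v - 1)\<^sup>2" by simp
      also have "\<dots> = 1 - (2 * c * N v + (- (c\<^sup>2)) * (N v * N v))"
        by (simp add: power2_eq_square algebra_simps)
      finally show ?thesis using True by simp
    next
      case False
      then have "N v = 0"
        by (auto simp: N_def X_def b_def e_def o_def)
      with False show ?thesis by simp
    qed
    then have "tupexp G (\<lambda>v. 2 * c * N v + (- (c\<^sup>2)) * (N v * N v)) v1 \<le> Q"
      unfolding Q_def by (intro tupexp_mono finG)
    then show ?thesis
      unfolding tupexp_add[OF finG] tupexp_cmult[OF finG] EN by linarith
  qed
  have "P * (1 - Q) \<le> (\<Sum>I\<in>Pow A - {{}}. \<kappa> (card I) / real t ^ card I)"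
  proof (cases "P = 0")
    case True
    then show ?thesis using \<kappa>0 by (simp add: sum_nonneg)
  next
    case False
    then have Pp: "0 < P" using P0 by simp
    \<comment> \<open>The reciprocal of the mean of \<open>N\<close>.\<close>
    define c where "c = 1 / (real t ^ m * P)"
    have cc: "c * (real t ^ m * P) = 1" "0 < c" using Pp t by (auto simp: c_def)
    have split: "(\<Sum>I\<in>Pow A. real t ^ (m - card I) * \<kappa>' I)
        = real t ^ m * (P + (\<Sum>I\<in>Pow A - {{}}. \<kappa> (card I) / real t ^ card I))"
    proof -
      have "(\<Sum>I\<in>Pow A. real t ^ (m - card I) * \<kappa>' I)
          = real t ^ m * P + (\<Sum>I\<in>Pow A - {{}}. real t ^ (m - card I) * \<kappa>' I)"
        using A by (subst sum.remove[of _ "{}"]) (auto simp: \<kappa>'_def)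
      also have "(\<Sum>I\<in>Pow A - {{}}. real t ^ (m - card I) * \<kappa>' I)
          = (\<Sum>I\<in>Pow A - {{}}. real t ^ m * (\<kappa> (card I) / real t ^ card I))"
        using A t by (intro sum.cong) (auto simp: \<kappa>'_def m_def power_diff card_mono)
      finally show ?thesis by (simp add: algebra_simps sum_distrib_left)
    qed
    define R where "R = (\<Sum>I\<in>Pow A - {{}}. \<kappa> (card I) / real t ^ card I)"
    have "c\<^sup>2 * tupexp G (\<lambda>v. N v * N v) v1 \<le> c\<^sup>2 * (real t ^ m * P * (real t ^ m * (P + R)))"
      using EN2[of v1] unfolding split R_def by (intro mult_left_mono) auto
    also have "\<dots> = (c * (real t ^ m * P)) * (c * (real t ^ m * P)) * (1 + R / P)"
      using Pp by (simp add: field_simps power2_eq_square)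
    also have "\<dots> = 1 + R / P" unfolding cc by simp
    finally have "1 - R / P \<le> Q" using low[of c] cc(1) by (simp add: mult.assoc)
    then show ?thesis using Pp by (simp add: R_def field_simps)
  qed
  then show ?thesis by (simp add: P_def Q_def b_def G_def \<Sigma>_def)
qed

end

text \<open>Coupling by densities: adding an independent set of density (q - p) / (1 - p) raises the
  density from \<open>p\<close> to \<open>q\<close>.\<close>

lemma rsprob_mono_dens:
  assumes "finite S" "0 \<le> p" "p \<le> q" "q \<le> 1" and mono: "\<And>V W. V \<subseteq> W \<Longrightarrow> g V \<Longrightarrow> g W"
  shows "rsprob S p g \<le> rsprob S q g"
proof (cases "p = 1")
  case False
  define r where "r = (q - p) / (1 - p)"
  have "r * (1 - p) = q - p" using False by (simp add: r_def)
  then have "p + r - p * r = q" by (simp add: algebra_simps)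
  moreover have "0 \<le> r" "r \<le> 1"
    using assms(2-4) False by (auto simp: r_def divide_le_eq_1)
  ultimately have r: "0 \<le> r" "r \<le> 1" "p + r - p * r = q" by auto
  have "rsprob S p g = rsexp S p (\<lambda>V. rsexp S r (\<lambda>W. of_bool (g V)))"
    using assms by (simp add: rsprob_def)
  also have "\<dots> \<le> rsexp S p (\<lambda>V. rsexp S r (\<lambda>W. of_bool (g (V \<union> W))))"
    using assms(2-4) r mono[OF Un_upper1] by (intro rsexp_mono) auto
  also have "\<dots> = rsprob S q g"
    using rsexp_union[OF assms(1), of p r "\<lambda>V. of_bool (g V)"] r by (simp add: rsprob_def)
  finally show ?thesis .
qed (use assms in simp)

context random_set
begin

text \<open>Fixing the parts in \<open>I\<close> and resampling the others yields an event of the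
  same kind, with \<open>Y\<close> enlarged by those parts and exponent \<open>j - card I\<close>.
  By induction this supplies the overlap bounds for \<open>second_moment\<close>. The failure
  probability there is at least \<open>\<eta>\<close>, because \<open>nb Y\<close> limits what the
  union of all copies can achieve.\<close>

lemma coarse:
  fixes g :: "'a set \<Rightarrow> bool" and A :: "'i set"
  assumes mono: "\<And>V W. V \<subseteq> W \<Longrightarrow> g V \<Longrightarrow> g W"
    and \<eta>: "0 < \<eta>" "\<eta> \<le> 1" and t: "0 < t"
    and nb: "\<And>Z. nb Z \<longleftrightarrow> rsprob S (1 - (1 - p) ^ (m * t)) (\<lambda>U. g (Z \<union> U)) \<le> 1 - \<eta>"
    and A: "finite A" "card A \<le> m"
  shows "tupexp A (\<lambda>v. of_bool (g (Y \<union> \<Union>(v ` A)) \<and> (\<forall>I\<subseteq>A. card I < j \<longrightarrow> nb (Y \<union> \<Union>(v ` I))))) v0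
    \<le> (2 ^ m / \<eta>) ^ j / real t ^ j"
  using A
proof (induction j arbitrary: A Y v0 rule: less_induct)
  case (less j)
  note A = less.prems
  define \<beta> where "\<beta> = (\<lambda>v. g (Y \<union> \<Union>(v ` A)) \<and> (\<forall>I\<subseteq>A. card I < j \<longrightarrow> nb (Y \<union> \<Union>(v ` I))))"
  define c where "c = 2 ^ m / \<eta>"
  have "\<eta> \<le> 2 ^ m" using \<eta> by (meson one_le_numeral one_le_power order_trans)
  then have c1: "1 \<le> c" using \<eta> by (simp add: c_def)
  have le1: "tupexp B (\<lambda>v. of_bool (P v)) v \<le> 1" if "finite B" for B P v
    using tupexp_mono[OF that, of v "\<lambda>v. of_bool (P v)" "\<lambda>_. 1"] that by simp
  consider "j = 0" | "0 < j" "\<not> nb Y" | "0 < j" "nb Y" by blast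
  then have "tupexp A (\<lambda>v. of_bool (\<beta> v)) v0 \<le> c ^ j / real t ^ j"
  proof cases
    case 1
    then show ?thesis using le1[OF A(1)] by simp
  next
    case 2
    \<comment> \<open>For positive \<open>j\<close> the empty set of parts is among those tested, so
      the event itself contains \<open>nb Y\<close>.\<close>
    have "\<not> \<beta> v" for v 
    proof
      assume "\<beta> v"
      then have "nb (Y \<union> \<Union>(v ` {}))" using 2(1) unfolding \<beta>_def by (metis card.empty empty_subsetI)
      then show False using 2(2) by simp
    qed
    then show ?thesis using A c1 by simp
  next
    case 3
    \<comment> \<open>An overlap in fewer than \<open>j\<close> parts is governed by the induction
      hypothesis; a larger one is already paid for by the factor
      \<open>1 / t ^ card I\<close>.\<close>
    define \<kappa> where "\<kappa> = (\<lambda>i. if i < j then c ^ (j - i) / real t ^ (j - i) else 1)"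
    have \<kappa>: "tupexp (A - I) (\<lambda>v. of_bool (\<beta> v)) v \<le> \<kappa> (card I)" if I: "I \<subseteq> A" "I \<noteq> {}" "\<beta> v" for I v
    proof (cases "card I < j")
      case True
      define Y' where "Y' = Y \<union> \<Union>(v ` I)"
      define \<beta>' where "\<beta>' = (\<lambda>v. g (Y' \<union> \<Union>(v ` (A - I))) \<and>
         (\<forall>I'\<subseteq>A - I. card I' < j - card I \<longrightarrow> nb (Y' \<union> \<Union>(v ` I'))))"
      have finI: "finite I" using I A finite_subset by blast
      have "tupexp (A - I) (\<lambda>v. of_bool (\<beta> v)) v \<le> tupexp (A - I) (\<lambda>v. of_bool (\<beta>' v)) v"
      proof (rule tupexp_mono)
        fix v' assume v': "\<And>a. a \<notin> A - I \<Longrightarrow> v' a = v a"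
        have eq: "Y' \<union> \<Union>(v' ` J) = Y \<union> \<Union>(v' ` (I \<union> J))" for J
          using v' by (force simp: Y'_def)
        have "\<beta>' v'" if "\<beta> v'"
          unfolding \<beta>'_def eq
        proof (intro conjI allI impI)
          show "g (Y \<union> \<Union>(v' ` (I \<union> (A - I))))"
            using that I by (simp add: \<beta>_def Un_absorb1)
          fix I' assume I': "I' \<subseteq> A - I" "card I' < j - card I"
          have "card (I \<union> I') < j" using card_Un_le[of I I'] I'(2) by linarith
          moreover have "I \<union> I' \<subseteq> A" using I I'(1) by auto
          ultimately show "nb (Y \<union> \<Union>(v' ` (I \<union> I')))"
            using that unfolding \<beta>_def by metis
        qed
        then show "of_bool (\<beta> v') \<le> (of_bool (\<beta>' v') :: real)" by simp
      qed (use A in simp)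
      also have "\<dots> \<le> c ^ (j - card I) / real t ^ (j - card I)"
        unfolding \<beta>'_def c_def
      proof (rule less.IH)
        show "j - card I < j" using True I(2) finI by (simp add: card_gt_0_iff)
        show "card (A - I) \<le> m" using A card_mono[of A "A - I"] by auto
      qed (use A in simp)
      finally show ?thesis using True by (simp add: \<kappa>_def)
    next
      case False
      then show ?thesis using le1[of "A - I"] A by (simp add: \<kappa>_def)
    qed
    define G where "G = A \<times> {..<t}"
    define Q where "Q = tupexp G (\<lambda>v. of_bool (\<exists>s\<in>A \<rightarrow>\<^sub>E {..<t}. \<beta> (\<lambda>a. v (a, s a)))) (\<lambda>_. {})"
    define P where "P = tupexp A (\<lambda>v. of_bool (\<beta> v)) v0"
    have P0: "0 \<le> P" unfolding P_def using tupexp_mono[OF A(1), of v0 "\<lambda>_. 0"] A by simp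
    have "P * (1 - Q) \<le> (\<Sum>I\<in>Pow A - {{}}. \<kappa> (card I) / real t ^ card I)"
      unfolding P_def Q_def G_def
    proof (rule second_moment[OF A(1) t _ _ \<kappa>])
      fix v v' :: "'i \<Rightarrow> 'a set" assume eq: "\<And>a. a \<in> A \<Longrightarrow> v a = v' a" and b: "\<beta> v"
      have "v ` I = v' ` I" if "I \<subseteq> A" for I using eq that by (intro image_cong) auto
      then show "\<beta> v'" using b unfolding \<beta>_def by simp
    qed (use c1 in \<open>auto simp: \<kappa>_def\<close>)
    also have "\<dots> \<le> (\<Sum>I\<in>Pow A - {{}}. c ^ (j - 1) / real t ^ j)"
    proof (rule sum_mono)
      fix I assume I: "I \<in> Pow A - {{}}"
      then have i: "1 \<le> card I" using A finite_subset[of I A] by (simp add: Suc_le_eq card_gt_0_iff)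
      show "\<kappa> (card I) / real t ^ card I \<le> c ^ (j - 1) / real t ^ j"
      proof (cases "card I < j")
        case True
        have "\<kappa> (card I) / real t ^ card I = c ^ (j - card I) / real t ^ j"
          using True by (simp add: \<kappa>_def flip: power_add)
        also have "\<dots> \<le> c ^ (j - 1) / real t ^ j"
          using c1 i by (intro divide_right_mono power_increasing) auto
        finally show ?thesis .
      next
        case False
        have "\<kappa> (card I) / real t ^ card I = 1 / real t ^ card I"
          using False by (simp add: \<kappa>_def)
        also have "\<dots> \<le> 1 / real t ^ j"
          using False t by (intro divide_left_mono power_increasing) auto
        also have "\<dots> \<le> c ^ (j - 1) / real t ^ j"
          using c1 by (intro divide_right_mono) auto
        finally show ?thesis .
      qed
    qed
    also have "\<dots> = real (card (Pow A - {{}})) * (c ^ (j - 1) / real t ^ j)" by simp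
    \<comment> \<open>The number of overlap sets, together with the later division by
      \<open>\<eta>\<close>, costs exactly one further factor \<open>c\<close>.\<close>
    also have "\<dots> \<le> 2 ^ m * (c ^ (j - 1) / real t ^ j)"
    proof (intro mult_right_mono)
      have "card (Pow A - {{}}) \<le> card (Pow A)" using A by (intro card_mono) auto
      also have "\<dots> \<le> 2 ^ m" using A by (simp add: card_Pow)
      finally show "real (card (Pow A - {{}})) \<le> 2 ^ m"
        using of_nat_mono[of "card (Pow A - {{}})" "2 ^ m", where ?'a = real] by simp
    qed (use c1 in simp)
    finally have main: "P * (1 - Q) \<le> 2 ^ m * (c ^ (j - 1) / real t ^ j)" .
    \<comment> \<open>By monotonicity of \<open>g\<close>, one successful choice suffices for the
      union of all copies.\<close>
    have "Q \<le> tupexp G (\<lambda>v. of_bool (g (Y \<union> \<Union>(v ` G)))) (\<lambda>_. {})"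
      unfolding Q_def
    proof (rule tupexp_mono)
      fix v :: "'i \<times> nat \<Rightarrow> 'a set"
      have "g (Y \<union> \<Union>(v ` G))" if "s \<in> A \<rightarrow>\<^sub>E {..<t}" "\<beta> (\<lambda>a. v (a, s a))" for s
      proof (rule mono)
        show "g (Y \<union> \<Union>((\<lambda>a. v (a, s a)) ` A))" using that by (simp add: \<beta>_def)
        show "Y \<union> \<Union>((\<lambda>a. v (a, s a)) ` A) \<subseteq> Y \<union> \<Union>(v ` G)"
          using that(1) by (fastforce simp: G_def)
      qed
      then show "of_bool (\<exists>s\<in>A \<rightarrow>\<^sub>E {..<t}. \<beta> (\<lambda>a. v (a, s a))) \<le> (of_bool (g (Y \<union> \<Union>(v ` G))) :: real)"
        by auto
    qed (use A in \<open>simp add: G_def\<close>)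
    also have "\<dots> = rsprob S (1 - (1 - p) ^ card G) (\<lambda>U. g (Y \<union> U))"
      using tupexp_Union[of G "\<lambda>Z. of_bool (g Z)" Y] A by (simp add: G_def rsprob_def)
    also have "\<dots> \<le> rsprob S (1 - (1 - p) ^ (m * t)) (\<lambda>U. g (Y \<union> U))"
    proof (rule rsprob_mono_dens)
      show "1 - (1 - p) ^ card G \<le> 1 - (1 - p) ^ (m * t)"
        using A p_nonneg p_le_1 by (auto simp: G_def card_cartesian_product intro!: power_decreasing)
      show "g (Y \<union> W)" if "V \<subseteq> W" "g (Y \<union> V)" for V W
        using mono[OF _ that(2), of "Y \<union> W"] that(1) by blast
    qed (use finite_S p_nonneg p_le_1 in \<open>auto simp: power_le_one\<close>)
    also have "\<dots> \<le> 1 - \<eta>" using 3 nb by simp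
    finally have "P * \<eta> \<le> P * (1 - Q)" using P0 by (intro mult_left_mono) auto
    with main have "P * \<eta> \<le> 2 ^ m * (c ^ (j - 1) / real t ^ j)" by linarith
    then have "P \<le> 2 ^ m * (c ^ (j - 1) / real t ^ j) / \<eta>"
      using \<eta>(1) by (simp only: pos_le_divide_eq)
    also have "\<dots> = (2 ^ m / \<eta>) * (c ^ (j - 1) / real t ^ j)" by simp
    also have "\<dots> = c ^ j / real t ^ j"
      using 3 by (cases j) (auto simp: c_def)
    finally show ?thesis by (simp add: P_def)
  qed
  then show ?case by (simp add: \<beta>_def c_def)
qed

end

section \<open>Small sets responsible for membership in a monotone family\<close>

text \<open>Split the set into \<open>3 * M\<close> parts. Either some union of at most three parts
  is not \<open>nb\<close>, which is paid for by a union bound over triples at rate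
  \<open>l / M\<close>, or \<open>coarse\<close> applies with exponent 4. The absence of
  \<open>c\<close> passes to unions of parts because \<open>c\<close> is upward closed.\<close>

lemma rsprob_split_step:
  fixes g :: "'a set \<Rightarrow> bool"
  assumes S: "finite S"
    and g: "\<And>V W. V \<subseteq> W \<Longrightarrow> g V \<Longrightarrow> g W"
    and g': "\<And>V W. V \<subseteq> W \<Longrightarrow> g' V \<Longrightarrow> g' W"
    and c: "\<And>V W. V \<subseteq> W \<Longrightarrow> c V \<Longrightarrow> c W"
    and \<eta>: "0 < \<eta>" "\<eta> \<le> 1" and l: "0 < l" "l \<le> q" and M: "0 < M"
    and gg': "\<And>Z. rsprob S (dens q) (\<lambda>U. g (Z \<union> U)) > 1 - \<eta> \<Longrightarrow> g' Z"
  shows "rsprob S (dens l) (\<lambda>V. g V \<and> \<not> c V)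
     \<le> real (3 * M) ^ 3 * rsprob S (dens (l / M)) (\<lambda>V. g' V \<and> \<not> c V)
       + (2 ^ (3 * M) / \<eta> * (2 * l / q)) ^ 4"
proof -
  define m where "m = 3 * M"
  define p where "p = dens (l / m)"
  \<comment> \<open>As many copies as the rate \<open>q\<close> allows: \<open>t\<close> copies of
    all parts have total rate \<open>t * l \<le> q\<close>, and rounding down loses at most a factor
    2.\<close>
  define t where "t = nat \<lfloor>q / l\<rfloor>"
  define A where "A = {..<m}"
  have m: "0 < m" using M by (simp add: m_def)
  have A: "finite A" "card A = m" by (auto simp: A_def)
  interpret random_set S p
    using S l by unfold_locales (auto simp: p_def intro!: dens_bounds)
  have pp: "1 - (1 - p) ^ i = dens (real i * (l / m))" for i
    unfolding p_def dens_mult ..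
  have "1 \<le> q / l" using l by simp
  then have "1 \<le> \<lfloor>q / l\<rfloor>" by linarith
  then have t: "0 < t" "real t = real_of_int \<lfloor>q / l\<rfloor>" by (auto simp: t_def)
  have tq: "real t * l \<le> q" using l t(2) by (simp add: pos_le_divide_eq[symmetric])
  have qt: "q \<le> 2 * real t * l"
  proof -
    have "q / l \<le> 2 * real t" using t \<open>1 \<le> \<lfloor>q / l\<rfloor>\<close> by linarith
    then show ?thesis using l by (simp add: divide_le_eq)
  qed
  define nb where "nb = (\<lambda>Z. rsprob S (1 - (1 - p) ^ (m * t)) (\<lambda>U. g (Z \<union> U)) \<le> 1 - \<eta>)"
  have nb: "g' Z" if "\<not> nb Z" for Z
  proof (rule gg')
    have "1 - (1 - p) ^ (m * t) = dens (real t * l)"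
      unfolding pp using m by simp
    then have "1 - \<eta> < rsprob S (dens (real t * l)) (\<lambda>U. g (Z \<union> U))"
      using that by (simp add: nb_def)
    also have "\<dots> \<le> rsprob S (dens q) (\<lambda>U. g (Z \<union> U))"
    proof (rule rsprob_dens_mono[OF S _ tq])
      show "g (Z \<union> W)" if "V \<subseteq> W" "g (Z \<union> V)" for V W
        by (rule g[OF _ that(2)]) (use that(1) in blast)
    qed (use l in simp)
    finally show "1 - \<eta> < rsprob S (dens q) (\<lambda>U. g (Z \<union> U))" .
  qed
  define \<beta> where "\<beta> = (\<lambda>v. g ({} \<union> \<Union>(v ` A)) \<and> (\<forall>I\<subseteq>A. card I < 4 \<longrightarrow> nb ({} \<union> \<Union>(v ` I))))"
  define T where "T = {I. I \<subseteq> A \<and> card I = 3}"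
  have finT: "finite T" unfolding T_def using A by simp
  have cardT: "card T \<le> m ^ 3"
    unfolding T_def using A n_subsets[OF A(1), of 3] binomial_le_pow[of 3 m] M by (simp add: m_def)
  define f where "f = (\<lambda>Z. of_bool (g' Z \<and> \<not> c Z) :: real)"
  have pt: "of_bool (g ({} \<union> \<Union>(v ` A)) \<and> \<not> c ({} \<union> \<Union>(v ` A)))
      \<le> of_bool (\<beta> v) + (\<Sum>I\<in>T. f ({} \<union> \<Union>(v ` I)))" for v :: "nat \<Rightarrow> 'a set"
  proof (cases "g (\<Union>(v ` A)) \<and> \<not> c (\<Union>(v ` A)) \<and> \<not> \<beta> v")
    case True
    then obtain I where I: "I \<subseteq> A" "card I < 4" "\<not> nb (\<Union>(v ` I))"
      by (auto simp: \<beta>_def)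
    have finI: "finite I" using I A finite_subset by blast
    \<comment> \<open>Padding to exactly three parts is harmless since \<open>g'\<close> is
      monotone, and it fixes the rate of the union at \<open>l / M\<close>.\<close>
    obtain J where J: "I \<subseteq> J" "J \<subseteq> A" "card J = 3"
      using exists_subset_between[of I 3 A] I A M finI by (auto simp: m_def)
    have "g' (\<Union>(v ` J))" using nb[OF I(3)] by (rule g'[rotated]) (use J in auto)
    moreover have "\<not> c (\<Union>(v ` J))"
    proof
      assume "c (\<Union>(v ` J))"
      then have "c (\<Union>(v ` A))" by (rule c[rotated]) (use J in auto)
      then show False using True by simp
    qed
    ultimately have "1 \<le> f ({} \<union> \<Union>(v ` J))" by (simp add: f_def)
    also have "\<dots> \<le> (\<Sum>I\<in>T. f ({} \<union> \<Union>(v ` I)))"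
      using J finT by (intro member_le_sum) (auto simp: T_def f_def)
    finally show ?thesis by (auto simp: add_increasing)
  next
    case False
    have "0 \<le> (\<Sum>I\<in>T. f ({} \<union> \<Union>(v ` I)))" by (intro sum_nonneg) (simp add: f_def)
    with False show ?thesis by auto
  qed
  have fT: "tupexp A (\<lambda>v. f ({} \<union> \<Union>(v ` I))) v = rsprob S (dens (l / M)) (\<lambda>V. g' V \<and> \<not> c V)"
    if "I \<in> T" for I v
  proof -
    have I: "I \<subseteq> A" "card I = 3" "finite I" using that A finite_subset by (auto simp: T_def)
    have "tupexp I (\<lambda>v. f ({} \<union> \<Union>(v ` I))) = (\<lambda>v. rsprob S (dens (l / M)) (\<lambda>V. g' V \<and> \<not> c V))"
    proof
      fix v :: "nat \<Rightarrow> 'a set"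
      show "tupexp I (\<lambda>v. f ({} \<union> \<Union>(v ` I))) v = rsprob S (dens (l / M)) (\<lambda>V. g' V \<and> \<not> c V)"
        unfolding tupexp_Union[OF I(3), of f "{}"] pp I(2) by (simp add: f_def rsprob_def m_def)
    qed
    then show ?thesis
      using tupexp_subset[OF A(1) I(1), of "\<lambda>v. f ({} \<union> \<Union>(v ` I))"] A by simp
  qed
  define e where "e = rsprob S (dens (l / M)) (\<lambda>V. g' V \<and> \<not> c V)"
  have e0: "0 \<le> e" unfolding e_def using l by (intro rsprob_nonneg dens_bounds) auto
  have coarse: "tupexp A (\<lambda>v. of_bool (\<beta> v)) (\<lambda>_. {}) \<le> (2 ^ m / \<eta>) ^ 4 / real t ^ 4"
    unfolding \<beta>_def by (rule coarse[OF g \<eta> t(1) _ A(1)]) (auto simp: nb_def A)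
  have "rsprob S (dens l) (\<lambda>V. g V \<and> \<not> c V)
      = tupexp A (\<lambda>v. of_bool (g ({} \<union> \<Union>(v ` A)) \<and> \<not> c ({} \<union> \<Union>(v ` A)))) (\<lambda>_. {})"
    unfolding tupexp_Union[OF A(1), of "\<lambda>Z. of_bool (g Z \<and> \<not> c Z)" "{}"] pp A(2)
    using m by (simp add: rsprob_def)
  also have "\<dots> \<le> tupexp A (\<lambda>v. of_bool (\<beta> v) + (\<Sum>I\<in>T. f ({} \<union> \<Union>(v ` I)))) (\<lambda>_. {})"
    by (rule tupexp_mono[OF A(1) pt])
  also have "\<dots> = tupexp A (\<lambda>v. of_bool (\<beta> v)) (\<lambda>_. {}) + real (card T) * e"
    unfolding tupexp_add[OF A(1)] tupexp_sum[OF A(1)] using fT by (simp add: e_def)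
  also have "\<dots> \<le> (2 ^ m / \<eta>) ^ 4 / real t ^ 4 + real m ^ 3 * e"
  proof (intro add_mono coarse mult_right_mono e0)
    show "real (card T) \<le> real m ^ 3" using cardT by (simp flip: of_nat_power)
  qed
  also have "(2 ^ m / \<eta>) ^ 4 / real t ^ 4 \<le> (2 ^ m / \<eta> * (2 * l / q)) ^ 4"
  proof -
    have "1 / real t \<le> 2 * l / q"
      using qt t l by (simp add: field_simps)
    then have "2 ^ m / \<eta> * (1 / real t) \<le> 2 ^ m / \<eta> * (2 * l / q)"
      using \<eta> by (intro mult_left_mono) auto
    then have "(2 ^ m / \<eta> * (1 / real t)) ^ 4 \<le> (2 ^ m / \<eta> * (2 * l / q)) ^ 4"
      using \<eta> by (intro power_mono) auto
    then show ?thesis by (simp add: power_divide power_mult_distrib)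
  qed
  finally show ?thesis by (simp add: m_def e_def)
qed

text \<open>Iterates \<open>rsprob_split_step\<close> with geometric budgets: the step from level
  \<open>r\<close> spends the fraction 2^(-r-1) of both \<open>\<eta>\<close> and \<open>q\<close>,
  so neither is exhausted. Each step multiplies the weight by 27 M^3 and divides the rate by M, so a
  fourth power of the rate gains a factor 27 / M per level.\<close>

theorem rsprob_no_small_core:
  fixes g :: "'a set \<Rightarrow> bool" and q \<eta> l :: real and M :: nat
  assumes S: "finite S"
    and g: "\<And>V W. V \<subseteq> W \<Longrightarrow> g V \<Longrightarrow> g W"
    and \<eta>: "0 < \<eta>" "\<eta> \<le> 1" and q: "0 < q" and M: "13824 \<le> M"
    and l: "0 < l" "l \<le> q / 2"
  shows "rsprob S (dens l) (\<lambda>V. g V \<and>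
      \<not> (\<exists>X\<subseteq>V. card X \<le> 3 \<and> 1 - \<eta> \<le> rsprob S (dens q) (\<lambda>U. g (X \<union> U))))
    \<le> 512 * (2 ^ (3 * M) * 2 / (\<eta> * q)) ^ 4 * l ^ 4"
proof -
  define h :: "nat \<Rightarrow> real" where "h = (\<lambda>r. 1 / 2 ^ r)"
  \<comment> \<open>Level 0 has rate 0 and error 0 and is therefore \<open>g\<close>; the levels
    interpolate between \<open>g\<close> and the condition on \<open>X\<close> in
    \<open>c\<close>.\<close>
  define B where "B = (\<lambda>r V. 1 - \<eta> * (1 - h r) \<le> rsprob S (dens (q * (1 - h r))) (\<lambda>U. g (V \<union> U)))"
  define c where "c = (\<lambda>V. \<exists>X\<subseteq>V. card X \<le> 3 \<and> 1 - \<eta> \<le> rsprob S (dens q) (\<lambda>U. g (X \<union> U)))"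
  define e where "e = (\<lambda>r x. rsprob S (dens x) (\<lambda>V. B r V \<and> \<not> c V))"
  define D where "D = (2 ^ (3 * M) * 2 / (\<eta> * q)) ^ 4"
  define L where "L = 27 * real M ^ 3"
  have Mp: "0 < real M" "M > 0" using M by auto
  have h: "0 < h r" "h r \<le> 1" "h (Suc r) = h r / 2" for r
    by (auto simp: h_def)
  have h0: "h 0 = 1" by (simp add: h_def)
  have qh: "0 \<le> q * (1 - h r)" for r using q h[of r] by simp
  have D0: "0 \<le> D" unfolding D_def using \<eta> q by (intro zero_le_power) auto
  have gZ: "g (Z \<union> W)" if "V \<subseteq> W" "g (Z \<union> V)" for Z V W
    by (rule g[OF _ that(2)]) (use that(1) in blast)
  have Bmono: "B r W" if "V \<subseteq> W" "B r V" for r V W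
  proof -
    have "rsprob S (dens (q * (1 - h r))) (\<lambda>U. g (V \<union> U)) \<le> rsprob S (dens (q * (1 - h r))) (\<lambda>U. g (W \<union> U))"
      using qh by (intro rsprob_mono dens_bounds) (auto intro: g[rotated] dest: that(1)[THEN subsetD])
    then show ?thesis using that(2) unfolding B_def by linarith
  qed
  have cmono: "c W" if "V \<subseteq> W" "c V" for V W
    using that unfolding c_def by (meson order_trans)
  have Bstep: "B (Suc r) Z" if Z: "rsprob S (dens (q * h (Suc r))) (\<lambda>U. B r (Z \<union> U)) > 1 - \<eta> * h (Suc r)" for r Z
  proof -
    define x where "x = \<eta> * h (Suc r)"
    define y where "y = \<eta> * (1 - h r)"
    have xy: "0 \<le> x" "0 \<le> y" "y \<le> 1" "x + y = \<eta> * (1 - h (Suc r))"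
      using \<eta> h[of r] h[of "Suc r"] mult_le_one[OF \<eta>(2), of "1 - h r"] by (auto simp: x_def y_def algebra_simps)
    have "q * (1 - h (Suc r)) = q * h (Suc r) + q * (1 - h r)"
      using h by (simp add: algebra_simps)
    then have "rsprob S (dens (q * (1 - h (Suc r)))) (\<lambda>U. g (Z \<union> U))
      = rsexp S (dens (q * h (Suc r))) (\<lambda>V. rsprob S (dens (q * (1 - h r))) (\<lambda>U. g ((Z \<union> V) \<union> U)))"
      using rsexp_dens_union[OF S, where a = "q * h (Suc r)" and b = "q * (1 - h r)" and \<phi> = "\<lambda>U. of_bool (g (Z \<union> U))"]
      by (simp add: rsprob_def Un_assoc)
    also have "\<dots> \<ge> rsexp S (dens (q * h (Suc r))) (\<lambda>V. (1 - y) * of_bool (B r (Z \<union> V)))"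
    proof (intro rsexp_mono dens_bounds)
      fix V
      show "(1 - y) * of_bool (B r (Z \<union> V)) \<le> rsprob S (dens (q * (1 - h r))) (\<lambda>U. g ((Z \<union> V) \<union> U))"
        using rsprob_nonneg[OF dens_bounds(1)[OF qh] dens_bounds(2), of S] by (simp add: B_def y_def)
    qed (use q h(1)[of "Suc r"] in simp)
    finally have "(1 - y) * rsprob S (dens (q * h (Suc r))) (\<lambda>U. B r (Z \<union> U))
      \<le> rsprob S (dens (q * (1 - h (Suc r)))) (\<lambda>U. g (Z \<union> U))"
      by (simp add: rsexp_cmult rsprob_def)
    moreover have "(1 - y) * (1 - x) \<le> (1 - y) * rsprob S (dens (q * h (Suc r))) (\<lambda>U. B r (Z \<union> U))"
      using Z xy by (intro mult_left_mono) (auto simp: x_def)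
    moreover have "1 - (x + y) \<le> (1 - y) * (1 - x)"
      using xy by (simp add: algebra_simps)
    ultimately show ?thesis
      unfolding B_def xy(4)[symmetric] by linarith
  qed
  have estep: "e r x \<le> L * e (Suc r) (x / M) + D * 256 * 256 ^ r * x ^ 4"
    if x: "0 < x" "x \<le> q * h (Suc r)" for r x
  proof -
    have *: "e r x \<le> real (3 * M) ^ 3 * e (Suc r) (x / M)
       + (2 ^ (3 * M) / (\<eta> * h (Suc r)) * (2 * x / (q * h (Suc r)))) ^ 4"
      unfolding e_def
    proof (rule rsprob_split_step[OF S])
      show "\<eta> * h (Suc r) \<le> 1" using \<eta> h[of "Suc r"] by (intro mult_le_one) auto
    qed (use Bmono cmono x \<eta> h(1)[of "Suc r"] Mp Bstep in auto)
    \<comment> \<open>The shrinking budgets enter as the inverse square of \<open>h (Suc r)\<close>,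
      whose fourth power is 256 * 256^r.\<close>
    have h4: "h (Suc r) * h (Suc r) = 1 / (4 * 4 ^ r)"
      by (simp add: h_def flip: power_mult_distrib)
    have "2 ^ (3 * M) / (\<eta> * h (Suc r)) * (2 * x / (q * h (Suc r)))
        = (2 ^ (3 * M) * 2 / (\<eta> * q)) * x / (h (Suc r) * h (Suc r))"
      by (simp add: mult_ac)
    also have "\<dots> = (2 ^ (3 * M) * 2 / (\<eta> * q)) * x * (4 * 4 ^ r)"
      unfolding h4 by simp
    also have "\<dots> ^ 4 = D * 256 * (4 ^ r) ^ 4 * x ^ 4"
      by (simp add: D_def power_mult_distrib power_divide)
    also have "((4::real) ^ r) ^ 4 = 256 ^ r"
      by (simp add: power_mult[symmetric] mult.commute[of r] power_mult)
    finally show ?thesis using * by (simp add: L_def power_mult_distrib)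
  qed
  have unroll: "e 0 l \<le> (\<Sum>r<R. D * 256 * l ^ 4 * (1 / 2) ^ r) + L ^ R * e R (l / real M ^ R)" for R
  proof (induction R)
    case (Suc R)
    have M2: "(2::real) ^ R \<le> real M ^ R" using M by (intro power_mono) auto
    have "l / real M ^ R \<le> (q / 2) / 2 ^ R"
      using l q M2 by (intro frac_le) auto
    then have "e R (l / real M ^ R) \<le> L * e (Suc R) (l / real M ^ R / real M) + D * 256 * 256 ^ R * (l / real M ^ R) ^ 4"
      using l Mp by (intro estep) (auto simp: h_def)
    then have "L ^ R * e R (l / real M ^ R)
       \<le> L ^ R * (L * e (Suc R) (l / real M ^ Suc R) + D * 256 * 256 ^ R * (l / real M ^ R) ^ 4)"
      by (intro mult_left_mono) (auto simp: L_def mult.commute)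
    also have "\<dots> = L ^ Suc R * e (Suc R) (l / real M ^ Suc R) + D * 256 * l ^ 4 * (L * 256 / real M ^ 4) ^ R"
      by (simp add: algebra_simps power_divide power_mult_distrib flip: power_mult)
    also have "(L * 256 / real M ^ 4) ^ R \<le> (1 / 2) ^ R"
    proof (rule power_mono)
      \<comment> \<open>The lower bound 13824 = 2 * 27 * 256 on \<open>M\<close> is chosen for this
        ratio to be at most 1/2.\<close>
      have "L * 256 / real M ^ 4 = 27 * 256 / real M"
        using Mp by (simp add: L_def power_eq_if field_simps)
      also have "\<dots> \<le> 1 / 2" using M by (simp add: field_simps)
      finally show "L * 256 / real M ^ 4 \<le> 1 / 2" .
    qed (simp add: L_def)
    finally have "L ^ R * e R (l / real M ^ R)
      \<le> L ^ Suc R * e (Suc R) (l / real M ^ Suc R) + D * 256 * l ^ 4 * (1 / 2) ^ R"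
      using D0 l by (simp add: mult_left_mono)
    with Suc show ?case by simp
  qed simp
  define n where "n = card S"
  \<comment> \<open>A set of at most three points satisfying \<open>B R\<close> is its own witness
    for \<open>c\<close>, so the remaining event forces four points.\<close>
  have terminal: "e R x \<le> real n ^ 4 * x ^ 4" if x: "0 \<le> x" for R x
  proof -
    define T where "T = {I. I \<subseteq> S \<and> card I = 4}"
    have finT: "finite T" using S by (simp add: T_def)
    have "card T = n choose 4" unfolding T_def n_def by (rule n_subsets[OF S])
    then have cardT: "card T \<le> n ^ 4"
      using binomial_le_pow[of 4 n] by (cases "4 \<le> n") (auto simp: binomial_eq_0)
    have "e R x \<le> rsprob S (dens x) (\<lambda>V. \<exists>I\<in>T. I \<subseteq> V)"
      unfolding e_def
    proof (intro rsprob_mono dens_bounds x)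
      fix V assume V: "V \<subseteq> S" "B R V \<and> \<not> c V"
      have "4 \<le> card V"
      proof (rule ccontr)
        assume "\<not> 4 \<le> card V"
        have "1 - \<eta> \<le> 1 - \<eta> * (1 - h R)" using \<eta> h[of R] mult_left_le[of "1 - h R" \<eta>] by simp
        also have "\<dots> \<le> rsprob S (dens (q * (1 - h R))) (\<lambda>U. g (V \<union> U))"
          using V(2) by (simp add: B_def)
        also have "\<dots> \<le> rsprob S (dens q) (\<lambda>U. g (V \<union> U))"
          using q h[of R] gZ by (intro rsprob_dens_mono S qh) (auto simp: mult_left_le)
        finally have "c V" using \<open>\<not> 4 \<le> card V\<close> unfolding c_def by (intro exI[of _ V]) auto
        then show False using V by simp
      qed
      then obtain I where "I \<subseteq> V" "card I = 4" using obtain_subset_with_card_n by metis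
      then show "\<exists>I\<in>T. I \<subseteq> V" using V by (auto simp: T_def)
    qed
    also have "\<dots> \<le> (\<Sum>I\<in>T. rsprob S (dens x) (\<lambda>V. I \<subseteq> V))"
      using x by (intro rsprob_bex_le finT dens_bounds) auto
    also have "\<dots> = (\<Sum>I\<in>T. dens x ^ 4)"
      by (intro sum.cong) (auto simp: T_def rsprob_superset[OF S])
    also have "\<dots> = real (card T) * dens x ^ 4" by simp
    also have "\<dots> \<le> real n ^ 4 * x ^ 4"
      using cardT x dens_bounds[of x] by (intro mult_mono power_mono) (auto simp flip: of_nat_power)
    finally show ?thesis .
  qed
  have bound: "e 0 l \<le> 512 * D * l ^ 4 + (real n * l) ^ 4 * (27 / real M) ^ R" for R
  proof -
    have "(\<Sum>r<R. D * 256 * l ^ 4 * (1 / 2) ^ r) = D * 256 * l ^ 4 * (\<Sum>r<R. (1 / 2) ^ r)"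
      by (simp add: sum_distrib_left)
    also have "\<dots> \<le> D * 256 * l ^ 4 * 2"
      using D0 l by (intro mult_left_mono) (auto simp: geometric_sum)
    finally have 1: "(\<Sum>r<R. D * 256 * l ^ 4 * (1 / 2) ^ r) \<le> 512 * D * l ^ 4" by simp
    have "L ^ R * e R (l / real M ^ R) \<le> L ^ R * (real n ^ 4 * (l / real M ^ R) ^ 4)"
      using l by (intro mult_left_mono terminal) (auto simp: L_def)
    also have "\<dots> = (real n * l) ^ 4 * (L / real M ^ 4) ^ R"
      by (simp add: power_divide power_mult_distrib flip: power_mult) (simp add: mult.commute)
    also have "L / real M ^ 4 = 27 / real M"
      using Mp by (simp add: L_def power_eq_if field_simps)
    finally show ?thesis using 1 unroll[of R] by simp
  qed
  \<comment> \<open>Letting the number of rounds tend to infinity removes the only term that depends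
    on the size of \<open>S\<close>.\<close>
  have "(\<lambda>R. 512 * D * l ^ 4 + (real n * l) ^ 4 * (27 / real M) ^ R) \<longlonglongrightarrow> 512 * D * l ^ 4 + (real n * l) ^ 4 * 0"
    using M by (intro tendsto_intros LIMSEQ_realpow_zero) auto
  then have "e 0 l \<le> 512 * D * l ^ 4 + (real n * l) ^ 4 * 0"
    by (rule LIMSEQ_le_const) (use bound in auto)
  moreover have "rsprob S 0 f = of_bool (f {})" for f
    unfolding rsprob_def using S by (induction S arbitrary: f rule: finite_induct) (simp_all add: rsexp_insert)
  then have "B 0 V = g V" for V
    by (simp add: B_def h0 dens_def)
  then have "e 0 l = rsprob S (dens l) (\<lambda>V. g V \<and> \<not> c V)" by (simp add: e_def)
  ultimately show ?thesis by (simp add: c_def D_def)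
qed

section \<open>Core sets\<close>

lemma mono_setD: "mono g \<Longrightarrow> V \<subseteq> W \<Longrightarrow> g V \<Longrightarrow> g W"
  by (auto dest: monoD simp: le_bool_def)

lemma rsexp_ge_point:
  assumes "finite T" "X \<subseteq> T" "0 \<le> p" "p \<le> 1" "\<And>V. 0 \<le> \<phi> V"
  shows "p ^ card X * (1 - p) ^ card (T - X) * \<phi> X \<le> rsexp T p \<phi>"
  unfolding rsexp_def
  using assms member_le_sum[of X "Pow T" "\<lambda>V. p ^ card V * (1 - p) ^ card (T - V) * \<phi> V"] by simp

text \<open>Containments of disjoint sets are independent; each induction step splits off the block
  \<open>Z s\<close>.\<close>

lemma rsprob_avoid_disjoint:
  fixes Z :: "nat \<Rightarrow> 'a set"
  assumes "finite S" "0 \<le> p" "p \<le> 1"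
    and "\<And>i. i < s \<Longrightarrow> Z i \<subseteq> S \<and> card (Z i) \<le> r"
    and "\<And>i j. i < s \<Longrightarrow> j < s \<Longrightarrow> i \<noteq> j \<Longrightarrow> Z i \<inter> Z j = {}"
  shows "rsprob S p (\<lambda>U. \<forall>i<s. \<not> Z i \<subseteq> U) \<le> (1 - p ^ r) ^ s"
  using assms(1,4,5)
proof (induction s arbitrary: S)
  case 0
  then show ?case using assms rsprob_le_1 by auto
next
  case (Suc s)
  have Zs: "Z s \<subseteq> S" "finite (Z s)" "card (Z s) \<le> r"
    using Suc.prems finite_subset[of "Z s" S] by auto
  define S' where "S' = S - Z s"
  have S': "S = Z s \<union> S'" "finite S'" "Z s \<inter> S' = {}"
    using Zs Suc.prems by (auto simp: S'_def)
  have IH: "rsprob S' p (\<lambda>U. \<forall>i<s. \<not> Z i \<subseteq> U) \<le> (1 - p ^ r) ^ s"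
  proof (rule Suc.IH)
    fix i assume "i < s"
    then show "Z i \<subseteq> S' \<and> card (Z i) \<le> r"
      using Suc.prems(2)[of i] Suc.prems(3)[of i s] by (auto simp: S'_def)
  qed (use S' Suc.prems in auto)
  define K where "K = rsprob S' p (\<lambda>U. \<forall>i<s. \<not> Z i \<subseteq> U)"
  have "rsprob S p (\<lambda>U. \<forall>i<Suc s. \<not> Z i \<subseteq> U)
      = rsexp (Z s) p (\<lambda>V. rsexp S' p (\<lambda>W. of_bool (\<forall>i<Suc s. \<not> Z i \<subseteq> V \<union> W)))"
    unfolding rsprob_def S'(1) using Zs S' by (intro rsexp_split) auto
  also have "\<dots> \<le> rsexp (Z s) p (\<lambda>V. rsexp S' p (\<lambda>W. of_bool (\<not> Z s \<subseteq> V) * of_bool (\<forall>i<s. \<not> Z i \<subseteq> W)))"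
  proof (intro rsexp_mono assms(2,3))
    fix V W
    show "of_bool (\<forall>i<Suc s. \<not> Z i \<subseteq> V \<union> W) \<le> (of_bool (\<not> Z s \<subseteq> V) * of_bool (\<forall>i<s. \<not> Z i \<subseteq> W) :: real)"
      by (auto simp: less_Suc_eq)
  qed
  also have "\<dots> = rsexp (Z s) p (\<lambda>V. K * of_bool (\<not> Z s \<subseteq> V))"
    unfolding rsexp_cmult[of S'] K_def rsprob_def by (simp only: mult.commute)
  also have "\<dots> = rsprob (Z s) p (\<lambda>V. \<not> Z s \<subseteq> V) * K"
    unfolding rsexp_cmult by (simp only: rsprob_def mult.commute)
  also have "\<dots> = (1 - p ^ card (Z s)) * K"
    using Zs by (simp add: rsprob_not rsprob_superset)
  also have "\<dots> \<le> (1 - p ^ r) * (1 - p ^ r) ^ s"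
    using IH Zs assms(2,3) unfolding K_def by (intro mult_mono rsprob_nonneg) (auto intro: power_decreasing power_le_one)
  finally show ?case by simp
qed

text \<open>Greedy choice: when no further disjoint set exists, the union of those chosen so far
  hits every set with \<open>P\<close>.\<close>

lemma disjoint_or_hitting:
  assumes "\<And>Z. P Z \<Longrightarrow> Z \<subseteq> S \<and> finite Z \<and> card Z \<le> r"
  shows "(\<exists>Z::nat \<Rightarrow> 'a set. (\<forall>i<s. P (Z i)) \<and> (\<forall>i<s. \<forall>j<s. i \<noteq> j \<longrightarrow> Z i \<inter> Z j = {})) \<or>
    (\<exists>C\<subseteq>S. finite C \<and> card C \<le> r * s \<and> (\<forall>Z. P Z \<longrightarrow> Z \<inter> C \<noteq> {}))"
proof (induction s)
  case 0
  show ?case by simp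
next
  case (Suc s)
  then show ?case
  proof
    assume "\<exists>C\<subseteq>S. finite C \<and> card C \<le> r * s \<and> (\<forall>Z. P Z \<longrightarrow> Z \<inter> C \<noteq> {})"
    then obtain C where "C \<subseteq> S" "finite C" "card C \<le> r * s" "\<forall>Z. P Z \<longrightarrow> Z \<inter> C \<noteq> {}" by blast
    then show ?thesis by (intro disjI2 exI[of _ C]) auto
  next
    assume "\<exists>Z::nat \<Rightarrow> 'a set. (\<forall>i<s. P (Z i)) \<and> (\<forall>i<s. \<forall>j<s. i \<noteq> j \<longrightarrow> Z i \<inter> Z j = {})"
    then obtain Z :: "nat \<Rightarrow> 'a set" where
      Z: "\<forall>i<s. P (Z i)" "\<forall>i<s. \<forall>j<s. i \<noteq> j \<longrightarrow> Z i \<inter> Z j = {}" by blast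
    define C where "C = (\<Union>i<s. Z i)"
    have Zi: "Z i \<subseteq> S \<and> finite (Z i) \<and> card (Z i) \<le> r" if "i < s" for i
      using assms Z(1) that by blast
    then have C: "C \<subseteq> S" "finite C" by (auto simp: C_def)
    have "card C \<le> (\<Sum>i<s. card (Z i))" unfolding C_def by (rule card_UN_le) simp
    also have "\<dots> \<le> (\<Sum>i<s. r)" using Zi by (intro sum_mono) auto
    finally have cC: "card C \<le> r * Suc s" by (simp add: mult.commute)
    show ?thesis
    proof (cases "\<forall>Z. P Z \<longrightarrow> Z \<inter> C \<noteq> {}")
      case True
      with C cC show ?thesis by blast
    next
      case False
      then obtain W where W: "P W" "W \<inter> C = {}" by blast
      have "(\<forall>i<Suc s. P ((Z(s := W)) i)) \<and>
        (\<forall>i<Suc s. \<forall>j<Suc s. i \<noteq> j \<longrightarrow> (Z(s := W)) i \<inter> (Z(s := W)) j = {})"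
        using Z W unfolding C_def by (auto simp: less_Suc_eq)
      then show ?thesis by blast
    qed
  qed
qed

text \<open>
  The rate decreases and the required probability increases with the size of the set, so that
  the kernel of a large sunflower of core sets is again a core set.
\<close>

definition core_rate :: "nat \<Rightarrow> real" where "core_rate i = ln 2 * (1 - real i / 4)"

definition core_err :: "nat \<Rightarrow> real" where "core_err i = 1 / (256 * 2 ^ i)"

definition core_set :: "'a set \<Rightarrow> ('a set \<Rightarrow> bool) \<Rightarrow> 'a set \<Rightarrow> bool" where
  "core_set S g X \<longleftrightarrow> X \<subseteq> S \<and> card X \<le> 3 \<and>
     1 - core_err (card X) \<le> rsprob S (dens (core_rate (card X))) (\<lambda>U. g (X \<union> U))"

definition minimal_core :: "'a set \<Rightarrow> ('a set \<Rightarrow> bool) \<Rightarrow> 'a set \<Rightarrow> bool" where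
  "minimal_core S g X \<longleftrightarrow> core_set S g X \<and> (\<forall>X'. X' \<subset> X \<longrightarrow> \<not> core_set S g X')"

definition hits_extensions :: "'a set \<Rightarrow> ('a set \<Rightarrow> bool) \<Rightarrow> 'a set \<Rightarrow> 'a set \<Rightarrow> bool" where
  "hits_extensions S g Y C \<longleftrightarrow>
     (\<forall>Z. Z \<inter> Y = {} \<longrightarrow> Z \<noteq> {} \<longrightarrow> core_set S g (Y \<union> Z) \<longrightarrow> Z \<inter> C \<noteq> {})"

text \<open>If many disjoint \<open>Z\<close> extended \<open>Y\<close> to a core set, a random set
  of rate ln 2 / 4 would contain one of them with probability near 1, and the remaining rate would
  then produce \<open>g\<close>, making \<open>Y\<close> a core set. So disjoint extensions are
  bounded in number, uniformly in \<open>S\<close> and \<open>g\<close>.\<close>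

lemma core_hitting:
  "\<exists>N. \<forall>(S::'a set) g Y. finite S \<longrightarrow> mono g \<longrightarrow> Y \<subseteq> S \<longrightarrow> \<not> core_set S g Y \<longrightarrow>
     (\<exists>C\<subseteq>S. card C \<le> N \<and> hits_extensions S g Y C)"
proof -
  \<comment> \<open>The density belonging to the gap between consecutive values of
    \<open>core_rate\<close>.\<close>
  define p where "p = dens (ln 2 / 4)"
  have p: "0 < p" "p \<le> 1" unfolding p_def by (auto simp: dens_def)
  have "(\<lambda>s. (1 - p ^ 3) ^ s) \<longlonglongrightarrow> 0"
    using p by (intro LIMSEQ_realpow_zero) (auto simp: power_le_one)
  \<comment> \<open>1/2048 is \<open>core_err 3\<close>, the smallest error that can occur.\<close>
  then have "\<forall>\<^sub>F s in sequentially. (1 - p ^ 3) ^ s < 1 / 2048"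
    by (rule order_tendstoD) simp
  then obtain s where s: "(1 - p ^ 3) ^ s < 1 / 2048"
    by (auto simp: eventually_sequentially)
  show ?thesis
  proof (intro exI[of _ "3 * s"] allI impI)
    fix S :: "'a set" and g :: "'a set \<Rightarrow> bool" and Y
    assume S: "finite S" and g': "mono g" and Y: "Y \<subseteq> S" "\<not> core_set S g Y"
    have g: "g W" if "V \<subseteq> W" "g V" for V W using g' that by (rule mono_setD)
    have finY: "finite Y" using Y S finite_subset by blast
    define P where "P = (\<lambda>Z. Z \<inter> Y = {} \<and> Z \<noteq> {} \<and> core_set S g (Y \<union> Z))"
    have PZ: "Z \<subseteq> S \<and> finite Z \<and> card Z \<le> 3" if "P Z" for Z
    proof -
      have "Z \<subseteq> S" "card (Y \<union> Z) \<le> 3" using that by (auto simp: P_def core_set_def)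
      moreover have "finite (Y \<union> Z)" using finY \<open>Z \<subseteq> S\<close> S finite_subset by auto
      ultimately show ?thesis using card_mono[of "Y \<union> Z" Z] by auto
    qed
    have no: "\<not> (\<exists>Z::nat \<Rightarrow> 'a set. (\<forall>i<s. P (Z i)) \<and> (\<forall>i<s. \<forall>j<s. i \<noteq> j \<longrightarrow> Z i \<inter> Z j = {}))"
    proof
      assume "\<exists>Z::nat \<Rightarrow> 'a set. (\<forall>i<s. P (Z i)) \<and> (\<forall>i<s. \<forall>j<s. i \<noteq> j \<longrightarrow> Z i \<inter> Z j = {})"
      then obtain Z :: "nat \<Rightarrow> 'a set" where
        Z: "\<And>i. i < s \<Longrightarrow> P (Z i)" "\<And>i j. i < s \<Longrightarrow> j < s \<Longrightarrow> i \<noteq> j \<Longrightarrow> Z i \<inter> Z j = {}" by blast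
      define y where "y = card Y"
      have "0 < s" using s by (cases s) auto
      have y2: "y + card (Z i) \<le> 3" "1 \<le> card (Z i)" if "i < s" for i
        using Z(1)[OF that] PZ[OF Z(1)[OF that]] finY unfolding P_def core_set_def y_def
        by (auto simp: card_Un_disjoint Int_commute Suc_le_eq card_gt_0_iff)
      then have y3: "y \<le> 2" using \<open>0 < s\<close> by fastforce
      have rates: "0 \<le> core_rate (Suc y)" "core_rate y = ln 2 / 4 + core_rate (Suc y)"
        using y3 by (auto simp: core_rate_def algebra_simps)
      define x where "x = core_err (Suc y)"
      have x: "1 / 2048 \<le> x" "x \<le> 1" "core_err y = 2 * x"
      proof -
        have "y = 0 \<or> y = 1 \<or> y = 2" using y3 by linarith
        then show "1 / 2048 \<le> x" "x \<le> 1" "core_err y = 2 * x" by (auto simp: x_def core_err_def)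
      qed
      \<comment> \<open>A larger extension has smaller rate and smaller error, so the guarantee for
        one added point holds for every \<open>Z i\<close>.\<close>
      have in_core: "1 - x \<le> rsprob S (dens (core_rate (Suc y))) (\<lambda>U'. g (Y \<union> Z i \<union> U'))" if i: "i < s" for i
      proof -
        have yz: "card (Y \<union> Z i) = y + card (Z i)"
          using Z(1)[OF i] PZ[OF Z(1)[OF i]] finY by (auto simp: P_def y_def card_Un_disjoint Int_commute)
        have "1 - x \<le> 1 - core_err (y + card (Z i))"
          using y2[OF i] by (auto simp: x_def core_err_def intro!: divide_left_mono power_increasing simp del: power_Suc)
        also have "\<dots> \<le> rsprob S (dens (core_rate (y + card (Z i)))) (\<lambda>U'. g (Y \<union> Z i \<union> U'))"
          using Z(1)[OF i] by (simp add: P_def core_set_def yz)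
        also have "\<dots> \<le> rsprob S (dens (core_rate (Suc y))) (\<lambda>U'. g (Y \<union> Z i \<union> U'))"
        proof (rule rsprob_dens_mono[OF S])
          show "0 \<le> core_rate (y + card (Z i))" "core_rate (y + card (Z i)) \<le> core_rate (Suc y)"
            using y2[OF i] by (auto simp: core_rate_def)
          show "g (Y \<union> Z i \<union> W)" if "V \<subseteq> W" "g (Y \<union> Z i \<union> V)" for V W
            by (rule g[OF _ that(2)]) (use that(1) in blast)
        qed
        finally show ?thesis .
      qed
      \<comment> \<open>Each of the two stages fails with probability at most \<open>x\<close>, and
        doubling the error is what going from \<open>y + 1\<close> to \<open>y\<close> points
        permits.\<close>
      have "(1 - x) * (1 - x) \<le> (1 - x) * (1 - (1 - p ^ 3) ^ s)"
        using x s by (intro mult_left_mono) auto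
      also have "\<dots> \<le> (1 - x) * rsprob S p (\<lambda>U. \<exists>i<s. Z i \<subseteq> U)"
      proof (intro mult_left_mono)
        have "rsprob S p (\<lambda>U. \<forall>i<s. \<not> Z i \<subseteq> U) \<le> (1 - p ^ 3) ^ s"
          using S p Z(2) PZ[OF Z(1)] by (intro rsprob_avoid_disjoint) auto
        also have "rsprob S p (\<lambda>U. \<forall>i<s. \<not> Z i \<subseteq> U) = rsprob S p (\<lambda>U. \<not> (\<exists>i<s. Z i \<subseteq> U))"
          by (rule rsprob_cong) auto
        also have "\<dots> = 1 - rsprob S p (\<lambda>U. \<exists>i<s. Z i \<subseteq> U)"
          by (rule rsprob_not[OF S])
        finally show "1 - (1 - p ^ 3) ^ s \<le> rsprob S p (\<lambda>U. \<exists>i<s. Z i \<subseteq> U)"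
          by linarith
      qed (use x in simp)
      also have "\<dots> = rsexp S p (\<lambda>U. (1 - x) * of_bool (\<exists>i<s. Z i \<subseteq> U))"
        by (simp add: rsprob_def rsexp_cmult)
      also have "\<dots> \<le> rsexp S p (\<lambda>U. rsprob S (dens (core_rate (Suc y))) (\<lambda>U'. g (Y \<union> (U \<union> U'))))"
      proof (intro rsexp_mono)
        fix U assume "U \<subseteq> S"
        show "(1 - x) * of_bool (\<exists>i<s. Z i \<subseteq> U) \<le> rsprob S (dens (core_rate (Suc y))) (\<lambda>U'. g (Y \<union> (U \<union> U')))"
        proof (cases "\<exists>i<s. Z i \<subseteq> U")
          case True
          then obtain i where i: "i < s" "Z i \<subseteq> U" by blast
          have "1 - x \<le> rsprob S (dens (core_rate (Suc y))) (\<lambda>U'. g (Y \<union> Z i \<union> U'))"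
            by (rule in_core[OF i(1)])
          also have "\<dots> \<le> rsprob S (dens (core_rate (Suc y))) (\<lambda>U'. g (Y \<union> (U \<union> U')))"
          proof (intro rsprob_mono dens_bounds rates)
            fix U' assume "g (Y \<union> Z i \<union> U')"
            then show "g (Y \<union> (U \<union> U'))" by (rule g[rotated]) (use i in auto)
          qed
          finally show ?thesis using True by simp
        next
          case False
          then have z: "(of_bool (\<exists>i<s. Z i \<subseteq> U) :: real) = 0" by simp
          have "0 \<le> rsprob S (dens (core_rate (Suc y))) (\<lambda>U'. g (Y \<union> (U \<union> U')))"
            by (intro rsprob_nonneg dens_bounds rates)
          then show ?thesis unfolding z by simp
        qed
      qed (use p in auto)
      also have "\<dots> = rsprob S (dens (core_rate y)) (\<lambda>U. g (Y \<union> U))"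
        unfolding rates(2) p_def rsprob_def by (rule rsexp_dens_union[OF S, where \<phi> = "\<lambda>U. of_bool (g (Y \<union> U))"])
      finally have *: "(1 - x) * (1 - x) \<le> rsprob S (dens (core_rate y)) (\<lambda>U. g (Y \<union> U))" .
      have "(1 - x) * (1 - x) = 1 - 2 * x + x * x" by (simp add: algebra_simps)
      then have "1 - core_err y \<le> rsprob S (dens (core_rate y)) (\<lambda>U. g (Y \<union> U))"
        using * x(1) x(3) by (smt (verit) zero_le_square)
      then have "core_set S g Y" using Y(1) y3 by (simp add: core_set_def y_def)
      then show False using Y(2) by simp
    qed
    have "\<exists>C\<subseteq>S. finite C \<and> card C \<le> 3 * s \<and> (\<forall>Z. P Z \<longrightarrow> Z \<inter> C \<noteq> {})"
      using disjoint_or_hitting[where P = P and S = S and r = 3 and s = s, OF PZ]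
    proof (rule disjE)
      show ?thesis if "\<exists>Z::nat \<Rightarrow> 'a set. (\<forall>i<s. P (Z i)) \<and> (\<forall>i<s. \<forall>j<s. i \<noteq> j \<longrightarrow> Z i \<inter> Z j = {})"
        using no that by (rule notE)
    qed
    then obtain C where "C \<subseteq> S" "card C \<le> 3 * s" "\<forall>Z. P Z \<longrightarrow> Z \<inter> C \<noteq> {}" by blast
    then show "\<exists>C\<subseteq>S. card C \<le> 3 * s \<and> hits_extensions S g Y C"
      by (intro exI[of _ C]) (simp add: hits_extensions_def P_def)
  qed
qed

text \<open>Starting from the empty set, add to \<open>T\<close> hitting sets for all its non-core
  subsets. A minimal core set \<open>X\<close> not inside \<open>T\<close> meets \<open>T\<close> in
  a proper, hence non-core, subset, so the new points hit \<open>X - T\<close>. Every round thus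
  captures another point of \<open>X\<close>, and three rounds suffice.\<close>

lemma minimal_core_sets_bounded:
  "\<exists>N. \<forall>(S::'a set) g. finite S \<longrightarrow> mono g \<longrightarrow>
     (\<exists>T\<subseteq>S. card T \<le> N \<and> (\<forall>X. minimal_core S g X \<longrightarrow> X \<subseteq> T))"
proof -
  obtain N where N: "\<forall>(S::'a set) g Y. finite S \<longrightarrow> mono g \<longrightarrow> Y \<subseteq> S \<longrightarrow> \<not> core_set S g Y \<longrightarrow>
     (\<exists>C\<subseteq>S. card C \<le> N \<and> hits_extensions S g Y C)"
    using core_hitting[where ?'a = 'a] by (rule exE)
  have "\<exists>N'. \<forall>(S::'a set) g. finite S \<longrightarrow> mono g \<longrightarrow>
     (\<exists>T\<subseteq>S. card T \<le> N' \<and> (\<forall>X. minimal_core S g X \<longrightarrow>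
        X \<subseteq> T \<or> i \<le> card (X \<inter> T)))" for i
  proof (induction i)
    case 0
    show ?case by (intro exI[of _ 0]) auto
  next
    case (Suc i)
    then obtain N' where N': "\<forall>(S::'a set) g. finite S \<longrightarrow> mono g \<longrightarrow>
     (\<exists>T\<subseteq>S. card T \<le> N' \<and> (\<forall>X. minimal_core S g X \<longrightarrow>
        X \<subseteq> T \<or> i \<le> card (X \<inter> T)))" by (rule exE)
    show ?case
    proof (intro exI[of _ "N' + 2 ^ N' * N"] allI impI)
      fix S :: "'a set" and g :: "'a set \<Rightarrow> bool" assume S: "finite S" and g: "mono g"
      obtain T where T: "T \<subseteq> S" "card T \<le> N'"
        "\<And>X. minimal_core S g X \<Longrightarrow> X \<subseteq> T \<or> i \<le> card (X \<inter> T)"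
        using N'[rule_format, OF S g] by blast
      have finT: "finite T" using T S finite_subset by blast
      define \<Y> where "\<Y> = {Y. Y \<subseteq> T \<and> \<not> core_set S g Y}"
      have "\<forall>Y\<in>\<Y>. \<exists>C\<subseteq>S. card C \<le> N \<and> hits_extensions S g Y C"
      proof
        fix Y assume "Y \<in> \<Y>"
        then have "Y \<subseteq> S" "\<not> core_set S g Y" using T(1) by (auto simp: \<Y>_def)
        then show "\<exists>C\<subseteq>S. card C \<le> N \<and> hits_extensions S g Y C"
          by (rule N[rule_format, OF S g])
      qed
      then obtain C where C: "\<And>Y. Y \<in> \<Y> \<Longrightarrow> C Y \<subseteq> S" "\<And>Y. Y \<in> \<Y> \<Longrightarrow> card (C Y) \<le> N"
        "\<And>Y. Y \<in> \<Y> \<Longrightarrow> hits_extensions S g Y (C Y)"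
        by metis
      have fin\<Y>: "finite \<Y>" using finT by (simp add: \<Y>_def)
      have "card \<Y> \<le> card (Pow T)" using finT by (intro card_mono) (auto simp: \<Y>_def)
      also have "\<dots> \<le> 2 ^ N'" using finT T(2) by (simp add: card_Pow)
      finally have c\<Y>: "card \<Y> \<le> 2 ^ N'" .
      define T' where "T' = T \<union> (\<Union>Y\<in>\<Y>. C Y)"
      have T'S: "T' \<subseteq> S" using T(1) C(1) by (auto simp: T'_def)
      have "card T' \<le> card T + card (\<Union>Y\<in>\<Y>. C Y)" unfolding T'_def by (rule card_Un_le)
      also have "card (\<Union>Y\<in>\<Y>. C Y) \<le> (\<Sum>Y\<in>\<Y>. card (C Y))" by (rule card_UN_le[OF fin\<Y>])
      also have "\<dots> \<le> (\<Sum>Y\<in>\<Y>. N)" using C(2) by (intro sum_mono) auto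
      also have "\<dots> \<le> 2 ^ N' * N" using c\<Y> by simp
      finally have cT': "card T' \<le> N' + 2 ^ N' * N" using T(2) by simp
      have "X \<subseteq> T' \<or> Suc i \<le> card (X \<inter> T')"
        if X: "minimal_core S g X" for X
      proof (cases "X \<subseteq> T")
        case False
        then have i: "i \<le> card (X \<inter> T)" using T(3)[OF X] by blast
        have Y: "X \<inter> T \<in> \<Y>" using X False by (auto simp: \<Y>_def minimal_core_def)
        have "X \<inter> T \<union> (X - T) = X" by blast
        then have "(X - T) \<inter> C (X \<inter> T) \<noteq> {}"
          using C(3)[OF Y] False X unfolding hits_extensions_def minimal_core_def by auto
        then obtain z where z: "z \<in> X - T" "z \<in> T'" using Y by (auto simp: T'_def)
        have "Suc (card (X \<inter> T)) = card (insert z (X \<inter> T))" using z finT by simp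
        also have "\<dots> \<le> card (X \<inter> T')"
          using z finite_subset[OF T'S S] by (intro card_mono) (auto simp: T'_def)
        finally show ?thesis using i by simp
      qed (auto simp: T'_def)
      then show "\<exists>T\<subseteq>S. card T \<le> N' + 2 ^ N' * N \<and> (\<forall>X. minimal_core S g X \<longrightarrow>
        X \<subseteq> T \<or> Suc i \<le> card (X \<inter> T))"
        using T'S cT' by blast
    qed
  qed
  from this[of 3] obtain N' where N': "\<forall>(S::'a set) g. finite S \<longrightarrow> mono g \<longrightarrow>
     (\<exists>T\<subseteq>S. card T \<le> N' \<and> (\<forall>X. minimal_core S g X \<longrightarrow>
        X \<subseteq> T \<or> 3 \<le> card (X \<inter> T)))" by (rule exE)
  show ?thesis
  proof (intro exI[of _ N'] allI impI)
    fix S :: "'a set" and g :: "'a set \<Rightarrow> bool" assume S: "finite S" and g: "mono g"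
    obtain T where T: "T \<subseteq> S" "card T \<le> N'"
      "\<And>X. minimal_core S g X \<Longrightarrow> X \<subseteq> T \<or> 3 \<le> card (X \<inter> T)"
      using N'[rule_format, OF S g] by blast
    have "X \<subseteq> T" if X: "minimal_core S g X" for X
    proof (rule ccontr)
      assume "\<not> X \<subseteq> T"
      moreover have "finite X" "card X \<le> 3" using X S finite_subset by (auto simp: minimal_core_def core_set_def)
      moreover have "X \<inter> T \<subset> X" using \<open>\<not> X \<subseteq> T\<close> by blast
      ultimately have "card (X \<inter> T) < 3" using psubset_card_mono[of X "X \<inter> T"] by simp
      then show False using T(3)[OF X] \<open>\<not> X \<subseteq> T\<close> by simp
    qed
    then show "\<exists>T\<subseteq>S. card T \<le> N' \<and> (\<forall>X. minimal_core S g X \<longrightarrow> X \<subseteq> T)"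
      using T by blast
  qed
qed

lemma core_sets_intersect:
  assumes S: "finite S" and F: "\<And>A B. A \<in> F \<Longrightarrow> B \<in> F \<Longrightarrow> A \<inter> B \<noteq> {}"
    and X: "core_set S (\<lambda>V. \<exists>A\<in>F. A \<subseteq> V) X" and Y: "core_set S (\<lambda>V. \<exists>A\<in>F. A \<subseteq> V) Y"
  shows "X \<inter> Y \<noteq> {}"
proof
  assume XY: "X \<inter> Y = {}"
  define g where "g = (\<lambda>V. \<exists>A\<in>F. A \<subseteq> V)"
  have half: "dens (ln 2) = 1 / 2" by (simp add: dens_def exp_minus)
  have hp: "255 / 256 \<le> rsprob S (1/2) (\<lambda>U. g (Z \<union> U))" if Z: "core_set S g Z" for Z
  proof -
    have "1 - core_err (card Z) \<ge> 255 / 256"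
      using one_le_power[of "2::real" "card Z"] by (simp add: core_err_def field_simps)
    also have "1 - core_err (card Z) \<le> rsprob S (dens (core_rate (card Z))) (\<lambda>U. g (Z \<union> U))"
      using Z by (simp add: core_set_def)
    also have "\<dots> \<le> rsprob S (dens (ln 2)) (\<lambda>U. g (Z \<union> U))"
      using Z by (intro rsprob_dens_mono S) (auto simp: core_rate_def core_set_def g_def mult_left_le)
    finally show ?thesis by (simp add: half)
  qed
  have XYS: "X \<subseteq> S" "Y \<subseteq> S" "card X \<le> 3" "card Y \<le> 3" using X Y by (auto simp: core_set_def)
  then have fin: "finite X" "finite Y" using S finite_subset by auto
  define T where "T = X \<union> Y"
  have "T \<subseteq> S" "finite T" "card T \<le> 6" using XYS fin card_Un_le[of X Y] by (auto simp: T_def)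
  have X': "core_set S g X" and Y': "core_set S g Y" using X Y by (simp_all add: g_def)
  have e1: "rsprob S (1/2) (\<lambda>U. \<not> g (X \<union> U)) \<le> 1 / 256"
    unfolding rsprob_not[OF S] using hp[OF X'] by simp
  have "rsprob S (1/2) (\<lambda>U. g (Y \<union> (S - U))) = rsprob S (1/2) (\<lambda>U. g (Y \<union> U))"
    using rsexp_compl[OF S, of "1/2" "\<lambda>U. of_bool (g (Y \<union> U))"] by (simp add: rsprob_def)
  then have e2: "rsprob S (1/2) (\<lambda>U. \<not> g (Y \<union> (S - U))) \<le> 1 / 256"
    unfolding rsprob_not[OF S] using hp[OF Y'] by simp
  \<comment> \<open>Two failures of probability at most 1/256 each cannot exhaust the event that
    \<open>U\<close> contains \<open>X\<close> and misses \<open>Y\<close>, which has probability at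
    least 1/64.\<close>
  have e3: "1 / 64 \<le> rsprob S (1/2) (\<lambda>U. U \<inter> T = X)"
  proof -
    have "S = T \<union> (S - T)" using \<open>T \<subseteq> S\<close> by blast
    then have "rsprob S (1/2) (\<lambda>U. U \<inter> T = X)
        = rsexp T (1/2) (\<lambda>V. rsexp (S - T) (1/2) (\<lambda>W. of_bool ((V \<union> W) \<inter> T = X)))"
      using rsexp_split[of T "S - T" "1/2" "\<lambda>U. of_bool (U \<inter> T = X)"] S \<open>finite T\<close> by (simp add: rsprob_def)
    also have "\<dots> = rsexp T (1/2) (\<lambda>V. rsexp (S - T) (1/2) (\<lambda>W. of_bool (V = X)))"
      by (intro rsexp_cong arg_cong[of _ _ of_bool]) auto
    also have "\<dots> = rsexp T (1/2) (\<lambda>V. of_bool (V = X))" using S by simp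
    also have "\<dots> \<ge> (1/2) ^ card X * (1 - 1/2) ^ card (T - X) * of_bool (X = X)"
      using \<open>finite T\<close> by (intro rsexp_ge_point) (auto simp: T_def)
    also have "(1/2::real) ^ card X * (1 - 1/2) ^ card (T - X) * of_bool (X = X) = (1/2) ^ (card X + card (T - X))"
      by (simp add: power_add)
    also have "card X + card (T - X) = card T"
      using \<open>finite T\<close> card_mono[of T X] card_Diff_subset[of X T] fin by (auto simp: T_def)
    finally have "(1/2::real) ^ card T \<le> rsprob S (1/2) (\<lambda>U. U \<inter> T = X)" .
    moreover have "(1/2::real) ^ 6 \<le> (1/2) ^ card T" using \<open>card T \<le> 6\<close> by (intro power_decreasing) auto
    moreover have "(1/2::real) ^ 6 = 1 / 64" by (simp add: power_divide)
    ultimately show ?thesis by linarith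
  qed
  have "\<exists>U\<subseteq>S. g (X \<union> U) \<and> g (Y \<union> (S - U)) \<and> U \<inter> T = X"
  proof (rule ccontr)
    assume no: "\<not> ?thesis"
    have "1 = rsprob S (1/2) (\<lambda>_. True)" using S by (simp add: rsprob_def)
    also have "\<dots> \<le> rsprob S (1/2) (\<lambda>U. (\<not> g (X \<union> U) \<or> \<not> g (Y \<union> (S - U))) \<or> \<not> (U \<inter> T = X))"
    proof (rule rsprob_mono)
      fix U assume "U \<subseteq> S"
      then show "(\<not> g (X \<union> U) \<or> \<not> g (Y \<union> (S - U))) \<or> \<not> (U \<inter> T = X)" using no by blast
    qed simp_all
    also have "\<dots> \<le> rsprob S (1/2) (\<lambda>U. \<not> g (X \<union> U)) + rsprob S (1/2) (\<lambda>U. \<not> g (Y \<union> (S - U)))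
       + rsprob S (1/2) (\<lambda>U. \<not> (U \<inter> T = X))"
      by (rule order_trans[OF rsprob_disj_le add_right_mono[OF rsprob_disj_le]]) simp_all
    also have "rsprob S (1/2) (\<lambda>U. \<not> (U \<inter> T = X)) = 1 - rsprob S (1/2) (\<lambda>U. U \<inter> T = X)"
      by (rule rsprob_not[OF S])
    finally show False using e1 e2 e3 by simp
  qed
  then obtain U where U: "U \<subseteq> S" "g (X \<union> U)" "g (Y \<union> (S - U))" "U \<inter> T = X" by blast
  have "X \<union> U = U" "Y \<union> (S - U) = S - U" using U XY XYS by (auto simp: T_def)
  then obtain A B where "A \<in> F" "A \<subseteq> U" "B \<in> F" "B \<subseteq> S - U" using U by (auto simp: g_def)
  then show False using F[of A B] by blast
qed

section \<open>Passing to uniform families\<close>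

lemma rsexp_card_cong:
  assumes "finite S" "finite S'" "card S = card S'"
  shows "rsexp S p (\<lambda>W. \<phi> (card W)) = rsexp S' p (\<lambda>W. \<phi> (card W))"
  using assms
proof (induction S arbitrary: S' \<phi> rule: finite_induct)
  case empty
  then show ?case by simp
next
  case (insert x S)
  then obtain y T where T: "S' = insert y T" "y \<notin> T" "card T = card S"
    by (metis card_insert_disjoint card_eq_SucD)
  then have finT: "finite T" using insert.prems by simp
  have "rsexp S p (\<lambda>W. \<phi> (card (insert x W))) = rsexp S p (\<lambda>W. \<phi> (Suc (card W)))"
    using insert.hyps by (intro rsexp_cong arg_cong[of _ _ \<phi>] card_insert_disjoint) (auto intro: finite_subset)
  moreover have "rsexp T p (\<lambda>W. \<phi> (card (insert y W))) = rsexp T p (\<lambda>W. \<phi> (Suc (card W)))"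
    using T finT by (intro rsexp_cong arg_cong[of _ _ \<phi>] card_insert_disjoint) (auto intro: finite_subset)
  ultimately show ?case
    using insert.hyps finT T insert.IH[of T \<phi>] insert.IH[of T "\<lambda>i. \<phi> (Suc i)"]
    by (simp add: rsexp_insert)
qed

text \<open>
  A $p$-random set conditioned to contain a $k$-set \<open>A\<close> has a size distribution that does not depend
  on \<open>A\<close>, so a random $k$-subset of a random set of size at least $k$ is uniform.
\<close>

lemma local_LYM:
  fixes S :: "'a set"
  assumes S: "finite S" and p: "0 \<le> p" "p \<le> 1" and \<A>: "\<And>A. A \<in> \<A> \<Longrightarrow> A \<subseteq> S \<and> card A = k"
  shows "real (card \<A>) * rsprob S p (\<lambda>W. k \<le> card W)
     \<le> real (card S choose k) * rsprob S p (\<lambda>W. \<exists>A\<in>\<A>. A \<subseteq> W)"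
proof -
  define \<K> where "\<K> = {A. A \<subseteq> S \<and> card A = k}"
  have fin\<K>: "finite \<K>" and card\<K>: "card \<K> = card S choose k"
    using S n_subsets[OF S, of k] by (auto simp: \<K>_def)
  have sub: "\<A> \<subseteq> \<K>" using \<A> by (auto simp: \<K>_def)
  then have fin\<A>: "finite \<A>" using fin\<K> finite_subset by blast
  \<comment> \<open>For a \<open>k\<close>-set \<open>A\<close>, the probability that a uniform
    \<open>k\<close>-subset of \<open>W\<close> equals \<open>A\<close>. If \<open>W\<close> has
    fewer than \<open>k\<close> points all these values are 0, the denominator 0 included.\<close>
  define f where "f = (\<lambda>(A::'a set) (W::'a set). of_bool (A \<subseteq> W) / real (card W choose k))"
  have fin_sub: "finite W" if "W \<subseteq> S" for W using that S finite_subset by blast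
  have count: "(\<Sum>A\<in>\<K>. f A W) = of_bool (k \<le> card W)" if W: "W \<subseteq> S" for W
  proof -
    have "(\<Sum>A\<in>\<K>. f A W) = real (card {A\<in>\<K>. A \<subseteq> W}) / real (card W choose k)"
      using fin\<K> by (simp add: f_def Int_def flip: sum_divide_distrib)
    also have "{A\<in>\<K>. A \<subseteq> W} = {A. A \<subseteq> W \<and> card A = k}" using W by (auto simp: \<K>_def)
    also have "card \<dots> = card W choose k" by (rule n_subsets[OF fin_sub[OF W]])
    also have "real (card W choose k) / real (card W choose k) = of_bool (k \<le> card W)"
      by (auto simp: binomial_eq_0_iff)
    finally show ?thesis .
  qed
  have f_nonneg: "0 \<le> f A W" for A W by (simp add: f_def)
  define \<tau> where "\<tau> = (\<lambda>A. rsexp S p (f A))"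
  have \<tau>_eq: "\<tau> A = \<tau> B" if "A \<in> \<K>" "B \<in> \<K>" for A B
  proof -
    have *: "\<tau> A = p ^ k * rsexp (S - A) p (\<lambda>W. 1 / real ((k + card W) choose k))" if A: "A \<in> \<K>" for A
    proof -
      have A': "A \<subseteq> S" "finite A" "card A = k" "S = A \<union> (S - A)" using A fin_sub by (auto simp: \<K>_def)
      have "\<tau> A = rsexp A p (\<lambda>V. rsexp (S - A) p (\<lambda>W. f A (V \<union> W)))"
        unfolding \<tau>_def using rsexp_split[of A "S - A" p "f A"] A' S by auto
      also have "\<dots> = rsexp A p (\<lambda>V. of_bool (V = A) * rsexp (S - A) p (\<lambda>W. 1 / real ((k + card W) choose k)))"
      proof (rule rsexp_cong)
        fix V assume V: "V \<subseteq> A"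
        show "rsexp (S - A) p (\<lambda>W. f A (V \<union> W))
            = of_bool (V = A) * rsexp (S - A) p (\<lambda>W. 1 / real ((k + card W) choose k))"
        proof (cases "V = A")
          case True
          have "f A (A \<union> W) = 1 / real ((k + card W) choose k)" if "W \<subseteq> S - A" for W
          proof -
            have "card (A \<union> W) = k + card W"
              using A' that fin_sub[of W] by (subst card_Un_disjoint) auto
            then show ?thesis by (simp add: f_def)
          qed
          then show ?thesis using True by (simp cong: rsexp_cong)
        next
          case False
          have "f A (V \<union> W) = 0" if "W \<subseteq> S - A" for W using that V False by (auto simp: f_def)
          then have "rsexp (S - A) p (\<lambda>W. f A (V \<union> W)) = rsexp (S - A) p (\<lambda>W. 0)"
            by (intro rsexp_cong) auto
          then show ?thesis using False S by simp
        qed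
      qed
      also have "\<dots> = rsexp (S - A) p (\<lambda>W. 1 / real ((k + card W) choose k)) * rsprob A p (\<lambda>V. A \<subseteq> V)"
        unfolding rsprob_def rsexp_cmult[symmetric] by (intro rsexp_cong) (use S in auto)
      also have "rsprob A p (\<lambda>V. A \<subseteq> V) = p ^ k"
        using rsprob_superset[OF A'(2), of A p] A' by simp
      finally show ?thesis by simp
    qed
    have "card (S - A) = card (S - B)"
      using that fin_sub[of A] fin_sub[of B] by (simp add: \<K>_def card_Diff_subset)
    then have "rsexp (S - A) p (\<lambda>W. 1 / real ((k + card W) choose k)) = rsexp (S - B) p (\<lambda>W. 1 / real ((k + card W) choose k))"
      using S by (intro rsexp_card_cong[where \<phi> = "\<lambda>i. 1 / real ((k + i) choose k)"]) auto
    then show ?thesis using *[OF that(1)] *[OF that(2)] by simp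
  qed
  have sum\<K>: "(\<Sum>A\<in>\<K>. \<tau> A) = rsprob S p (\<lambda>W. k \<le> card W)"
  proof -
    have "(\<Sum>A\<in>\<K>. \<tau> A) = rsexp S p (\<lambda>W. \<Sum>A\<in>\<K>. f A W)"
      unfolding \<tau>_def rsexp_def sum_distrib_left by (rule sum.swap)
    also have "\<dots> = rsprob S p (\<lambda>W. k \<le> card W)"
      unfolding rsprob_def using count by (intro rsexp_cong) auto
    finally show ?thesis .
  qed
  have sum\<A>: "(\<Sum>A\<in>\<A>. \<tau> A) \<le> rsprob S p (\<lambda>W. \<exists>A\<in>\<A>. A \<subseteq> W)"
  proof -
    have "(\<Sum>A\<in>\<A>. \<tau> A) = rsexp S p (\<lambda>W. \<Sum>A\<in>\<A>. f A W)"
      unfolding \<tau>_def rsexp_def sum_distrib_left by (rule sum.swap)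
    also have "\<dots> \<le> rsprob S p (\<lambda>W. \<exists>A\<in>\<A>. A \<subseteq> W)"
      unfolding rsprob_def
    proof (intro rsexp_mono p)
      fix W assume W: "W \<subseteq> S"
      show "(\<Sum>A\<in>\<A>. f A W) \<le> of_bool (\<exists>A\<in>\<A>. A \<subseteq> W)"
      proof (cases "\<exists>A\<in>\<A>. A \<subseteq> W")
        case True
        have "(\<Sum>A\<in>\<A>. f A W) \<le> (\<Sum>A\<in>\<K>. f A W)"
          using sub fin\<K> f_nonneg by (intro sum_mono2) auto
        also have "\<dots> \<le> 1" using count[OF W] by simp
        finally show ?thesis using True by simp
      next
        case False
        then have "(\<Sum>A\<in>\<A>. f A W) = (\<Sum>A\<in>\<A>. 0)" by (intro sum.cong) (auto simp: f_def)
        then show ?thesis using False by simp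
      qed
    qed
    finally show ?thesis .
  qed
  show ?thesis
  proof (cases "\<A> = {}")
    case False
    then obtain B where B: "B \<in> \<A>" by blast
    have "(\<Sum>A\<in>\<K>. \<tau> A) = (\<Sum>A\<in>\<K>. \<tau> B)"
      by (rule sum.cong[OF refl], rule \<tau>_eq) (use B sub in auto)
    then have 1: "real (card S choose k) * \<tau> B = rsprob S p (\<lambda>W. k \<le> card W)"
      using sum\<K> card\<K> by simp
    have "(\<Sum>A\<in>\<A>. \<tau> A) = (\<Sum>A\<in>\<A>. \<tau> B)"
      by (rule sum.cong[OF refl], rule \<tau>_eq) (use B sub in auto)
    then have 2: "real (card \<A>) * \<tau> B \<le> rsprob S p (\<lambda>W. \<exists>A\<in>\<A>. A \<subseteq> W)"
      using sum\<A> by simp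
    have "real (card \<A>) * rsprob S p (\<lambda>W. k \<le> card W) = real (card S choose k) * (real (card \<A>) * \<tau> B)"
      unfolding 1[symmetric] by simp
    also have "\<dots> \<le> real (card S choose k) * rsprob S p (\<lambda>W. \<exists>A\<in>\<A>. A \<subseteq> W)"
      using 2 by (intro mult_left_mono) auto
    finally show ?thesis .
  qed (use p rsprob_nonneg[of p S] in simp)
qed

text \<open>Exponential Markov inequality: \<open>card W < k\<close> implies
  \<open>x ^ k \<le> x ^ card W\<close> because \<open>x \<le> 1\<close>.\<close>

lemma rsprob_card_less:
  assumes S: "finite S" and p: "0 \<le> p" "p \<le> 1" and x: "0 < x" "x \<le> 1"
  shows "rsprob S p (\<lambda>W. card W < k) * x ^ k \<le> (1 - p + p * x) ^ card S"
proof -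
  have "rsprob S p (\<lambda>W. card W < k) * x ^ k = rsexp S p (\<lambda>W. x ^ k * of_bool (card W < k))"
    by (simp add: rsprob_def rsexp_cmult)
  also have "\<dots> \<le> rsexp S p (\<lambda>W. x ^ card W)"
    using p x by (intro rsexp_mono) (auto intro: power_decreasing)
  finally show ?thesis by (simp add: rsexp_power_card[OF S])
qed

text \<open>Taking x = 1/2 in the preceding tail bound gives 2^k exp(-2 k), which is at most 2^(-k)
  since exp 2 is at least 4.\<close>

lemma rsprob_card_ge_half:
  assumes S: "finite S" and p: "0 \<le> p" "p \<le> 1" and k: "1 \<le> k" "4 * real k \<le> p * real (card S)"
  shows "1 / 2 \<le> rsprob S p (\<lambda>W. k \<le> card W)"
proof -
  have e2: "4 \<le> exp (2::real)"
  proof -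
    have "2 \<le> exp (1::real)" using exp_ge_add_one_self[of 1] by simp
    then have "2 * 2 \<le> exp (1::real) * exp 1" by (intro mult_mono) auto
    then show ?thesis by (simp flip: exp_add)
  qed
  have "rsprob S p (\<lambda>W. card W < k) * (1/2) ^ k \<le> (1 - p / 2) ^ card S"
    using rsprob_card_less[OF S p, of "1/2" k] by simp
  also have "\<dots> \<le> exp (- p / 2) ^ card S"
    using p exp_ge_add_one_self[of "- p / 2"] by (intro power_mono) auto
  also have "\<dots> = exp (- (p * real (card S)) / 2)"
    by (simp add: exp_of_nat_mult[symmetric])
  also have "\<dots> \<le> exp (- 2 * real k)" using k by simp
  also have "\<dots> = (1 / exp 2) ^ k" by (simp add: exp_of_nat_mult[symmetric] exp_minus field_simps)
  also have "\<dots> \<le> (1 / 4) ^ k" using e2 by (intro power_mono) (auto intro: divide_left_mono)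
  finally have "rsprob S p (\<lambda>W. card W < k) * (1/2) ^ k \<le> (1/2) ^ k * (1/2) ^ k"
    by (simp flip: power_mult_distrib)
  then have "rsprob S p (\<lambda>W. card W < k) \<le> (1/2) ^ k" by simp
  also have "\<dots> \<le> (1/2) ^ 1" using k by (intro power_decreasing) auto
  finally have "rsprob S p (\<lambda>W. \<not> k \<le> card W) \<le> 1 / 2" by (simp add: not_le)
  then show ?thesis unfolding rsprob_not[OF S] by simp
qed

text \<open>A random \<open>k\<close>-set contains a fixed \<open>b\<close>-set with probability a
  product of factors (k - i) / (n - i), each at most k / n.\<close>

lemma binomial_shift_le:
  assumes "b \<le> k" "k \<le> n"
  shows "real ((n - b) choose (k - b)) \<le> (real k / real n) ^ b * real (n choose k)"
  using assms
proof (induction b)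
  case (Suc b)
  have "(k - b) * ((n - b) choose (k - b)) = (n - b) * ((n - Suc b) choose (k - Suc b))"
    using binomial_absorption[of "k - Suc b" "n - b"] Suc.prems by (simp add: Suc_diff_Suc)
  then have "real (((n - Suc b) choose (k - Suc b)) * (n - b)) = real ((k - b) * ((n - b) choose (k - b)))"
    by (simp only: mult.commute)
  then have "real ((n - Suc b) choose (k - Suc b)) * real (n - b) = real (k - b) * real ((n - b) choose (k - b))"
    by (simp only: of_nat_mult)
  then have "real ((n - Suc b) choose (k - Suc b)) = real (k - b) / real (n - b) * real ((n - b) choose (k - b))"
    using Suc.prems by (simp add: field_simps)
  also have "\<dots> \<le> real k / real n * ((real k / real n) ^ b * real (n choose k))"
  proof (intro mult_mono)
    have "(real k - real b) * real n \<le> real k * (real n - real b)"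
      using Suc.prems by (simp add: algebra_simps mult_left_mono)
    then show "real (k - b) / real (n - b) \<le> real k / real n"
      using Suc.prems by (simp add: of_nat_diff divide_simps)
  qed (use Suc in auto)
  finally show ?case by simp
qed simp

lemma ex_minimal_subset:
  assumes "finite X" "P X"
  shows "\<exists>X'\<subseteq>X. P X' \<and> (\<forall>Y. Y \<subset> X' \<longrightarrow> \<not> P Y)"
  using assms
proof (induction X rule: finite_psubset_induct)
  case (psubset X)
  show ?case
  proof (cases "\<exists>Y. Y \<subset> X \<and> P Y")
    case True
    then obtain Y where Y: "Y \<subset> X" "P Y" by blast
    from psubset.IH[OF this] obtain X' where "X' \<subseteq> Y" "P X' \<and> (\<forall>Y. Y \<subset> X' \<longrightarrow> \<not> P Y)" by blast
    then show ?thesis using Y(1) by (intro exI[of _ X']) auto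
  next
    case False
    then show ?thesis using psubset.prems by blast
  qed
qed

text \<open>Let \<open>T\<close> contain all minimal core sets. A core set inside \<open>V\<close>
  contains a minimal one, which lies in \<open>V \<inter> T\<close>; so being free of core sets
  depends only on the trace \<open>B\<close> of \<open>V\<close> on \<open>T\<close>. For fixed
  \<open>B\<close> what remains is a monotone event on \<open>S - T\<close>, to which
  \<open>local_LYM\<close> applies. Summing over the boundedly many traces costs a constant.\<close>

lemma few_sets_without_core:
  "\<exists>K C0. 0 < K \<and> 0 < C0 \<and> (\<forall>(S::'a set) F k. finite S \<longrightarrow> F \<subseteq> {A. A \<subseteq> S \<and> card A = k} \<longrightarrow> 1 \<le> k \<longrightarrow>
     C0 * real k \<le> real (card S) \<longrightarrow>
     real (card {A\<in>F. \<not> (\<exists>X\<subseteq>A. core_set S (\<lambda>V. \<exists>A\<in>F. A \<subseteq> V) X)})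
       \<le> K * (real k / real (card S)) ^ 4 * real (card S choose k))"
proof -
  \<comment> \<open>Rate and error (1/2048 below) of a three-point core set. They are the strictest,
    so a set satisfying them is a core set whatever its size up to 3.\<close>
  define q :: real where "q = ln 2 / 4"
  obtain M :: nat where M: "13824 \<le> M" by blast
  define D :: real where "D = 512 * (2 ^ (3 * M) * 2 / (1 / 2048 * q)) ^ 4"
  have q: "0 < q" by (simp add: q_def)
  have D0: "0 < D" unfolding D_def using q by (intro mult_pos_pos zero_less_power divide_pos_pos) simp_all
  have small: "rsprob S (dens l) (\<lambda>V. g V \<and> \<not> (\<exists>X\<subseteq>V. core_set S g X)) \<le> D * l ^ 4"
    if S: "finite S" and g: "mono g" and l: "0 < l" "l \<le> q / 2" for S :: "'a set" and g l
  proof -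
    have "rsprob S (dens l) (\<lambda>V. g V \<and> \<not> (\<exists>X\<subseteq>V. core_set S g X))
      \<le> rsprob S (dens l) (\<lambda>V. g V \<and>
          \<not> (\<exists>X\<subseteq>V. card X \<le> 3 \<and> 1 - 1 / 2048 \<le> rsprob S (dens q) (\<lambda>U. g (X \<union> U))))"
    proof (rule rsprob_mono)
      fix V assume V: "V \<subseteq> S" "g V \<and> \<not> (\<exists>X\<subseteq>V. core_set S g X)"
      have "core_set S g X" if X: "X \<subseteq> V" "card X \<le> 3" "1 - 1 / 2048 \<le> rsprob S (dens q) (\<lambda>U. g (X \<union> U))" for X
      proof -
        have "(2::real) ^ card X \<le> 2 ^ 3" using X(2) by (intro power_increasing) auto
        then have "1 - core_err (card X) \<le> 1 - 1 / 2048" by (simp add: core_err_def field_simps)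
        also note X(3)
        also have "rsprob S (dens q) (\<lambda>U. g (X \<union> U)) \<le> rsprob S (dens (core_rate (card X))) (\<lambda>U. g (X \<union> U))"
        proof (rule rsprob_dens_mono[OF S])
          have "1 / 4 \<le> 1 - real (card X) / 4" using X(2) by simp
          then have "ln 2 * (1 / 4) \<le> ln 2 * (1 - real (card X) / (4::real))"
            by (intro mult_left_mono) auto
          then show "q \<le> core_rate (card X)" by (simp add: core_rate_def q_def)
          show "g (X \<union> W)" if "U \<subseteq> W" "g (X \<union> U)" for U W
            by (rule mono_setD[OF g _ that(2)]) (use that(1) in blast)
        qed (use q in simp)
        finally show ?thesis using X V(1) by (auto simp: core_set_def)
      qed
      then show "g V \<and> \<not> (\<exists>X\<subseteq>V. card X \<le> 3 \<and> 1 - 1 / 2048 \<le> rsprob S (dens q) (\<lambda>U. g (X \<union> U)))"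
        using V(2) by blast
    qed (use l dens_bounds in auto)
    also have "\<dots> \<le> D * l ^ 4"
      unfolding D_def using mono_setD[OF g] q l M by (intro rsprob_no_small_core S) auto
    finally show ?thesis .
  qed
  obtain N where N: "\<forall>(S::'a set) g. finite S \<longrightarrow> mono g \<longrightarrow>
     (\<exists>T\<subseteq>S. card T \<le> N \<and> (\<forall>X. minimal_core S g X \<longrightarrow> X \<subseteq> T))"
    using minimal_core_sets_bounded[where ?'a = 'a] by (rule exE)
  define K where "K = 2 * 4 ^ N * D * 16 ^ 4"
  \<comment> \<open>Ensures, for the rate \<open>l\<close> chosen below, that
    \<open>l \<le> q / 2\<close> and \<open>l \<le> 1 / 2\<close>, and that \<open>T\<close> covers
    less than half of the points.\<close>
  define C0 where "C0 = max (32 / q) (2 * real N + 1) + 32"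
  show ?thesis
  proof (intro exI conjI allI impI)
    show "0 < K" using D0 by (simp add: K_def)
    show "0 < C0" by (simp add: C0_def)
    fix S :: "'a set" and F k
    assume S: "finite S" and F: "F \<subseteq> {A. A \<subseteq> S \<and> card A = k}" and k: "1 \<le> k" and n: "C0 * real k \<le> real (card S)"
    define n where "n = card S"
    define g where "g = (\<lambda>V. \<exists>A\<in>F. A \<subseteq> V)"
    have g: "mono g" unfolding g_def by (rule monoI) (auto simp: le_bool_def)
    obtain T where T: "T \<subseteq> S" "card T \<le> N"
      "\<And>X. minimal_core S g X \<Longrightarrow> X \<subseteq> T"
      using N[rule_format, OF S g] by blast
    have finT: "finite T" using T S finite_subset by blast
    \<comment> \<open>Then \<open>p\<close> is at least 8 k / n, so \<open>S - T\<close>, with at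
      least half of the points, still receives at least 4 k of them on average.\<close>
    define l where "l = 16 * real k / real n"
    define p where "p = dens l"
    have C0k: "C0 \<le> C0 * real k" using k mult_left_mono[of 1 "real k" C0] by (simp add: C0_def)
    have n0: "2 * N + 1 \<le> n" "0 < real n"
    proof -
      have "2 * real N + 1 \<le> C0" by (simp add: C0_def)
      then have "2 * real N + 1 \<le> real n" using n C0k unfolding n_def by linarith
      then show "2 * N + 1 \<le> n" by linarith
      then show "0 < real n" by simp
    qed
    have "32 / q * real k \<le> C0 * real k" by (intro mult_right_mono) (auto simp: C0_def)
    then have "32 / q * real k \<le> real n" using n by (simp add: n_def)
    then have lq: "0 < l" "l \<le> q / 2" using q k n0 by (auto simp: l_def field_simps)
    have "32 * real k \<le> C0 * real k" by (intro mult_right_mono) (auto simp: C0_def)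
    then have nk: "32 * real k \<le> real n" using n by (simp add: n_def)
    then have l2: "l \<le> 1 / 2" using n0 by (simp add: l_def field_simps)
    have p: "0 \<le> p" "p \<le> 1/2" "p \<le> 1" "l / 2 \<le> p"
    proof -
      show "0 \<le> p" "p \<le> 1" using dens_bounds lq by (auto simp: p_def)
      show "p \<le> 1/2" using dens_bounds(3)[of l] l2 lq by (simp add: p_def)
      have "exp (- l) \<le> 1 - l / 2"
      proof -
        have "1 + l \<le> exp l" by (rule exp_ge_add_one_self)
        then have "exp (- l) \<le> 1 / (1 + l)" using lq by (simp add: exp_minus divide_simps)
        also have "\<dots> \<le> 1 - l / 2"
        proof -
          have "l * l \<le> l * 1" using lq l2 by (intro mult_left_mono) auto
          then show ?thesis using lq by (simp add: field_simps)
        qed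
        finally show ?thesis .
      qed
      then show "l / 2 \<le> p" by (simp add: p_def dens_def)
    qed
    have kp: "real k / real n \<le> p" "0 < p"
    proof -
      have "real k / real n \<le> l / 2" using n0 by (simp add: l_def field_simps)
      then show "real k / real n \<le> p" using p(4) by linarith
      show "0 < p" using p(4) lq by linarith
    qed
    define free where "free = (\<lambda>V. g V \<and> \<not> (\<exists>X\<subseteq>V. core_set S g X))"
    define F' where "F' = {A\<in>F. \<not> (\<exists>X\<subseteq>A. core_set S g X)}"
    have finF: "finite F" using F S by (auto intro: finite_subset[of F "Pow S"])
    define FB where "FB = (\<lambda>B. {A\<in>F'. A \<inter> T = B})"
    define M where "M = 2 * 2 ^ N * (D * l ^ 4) * real (n choose k)"
    have M0: "0 \<le> M" using D0 lq by (simp add: M_def)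
    have FB_le: "real (card (FB B)) \<le> M" if B: "B \<subseteq> T" for B
    proof (cases "FB B = {}")
      case False
      then obtain A0 where A0: "A0 \<in> FB B" by blast
      have finB: "finite B" using B finT finite_subset by blast
      have B_core: "\<not> core_set S g X" if "X \<subseteq> B" for X
        using A0 that by (auto simp: FB_def F'_def)
      define b where "b = card B"
      have A0': "A0 \<subseteq> S" "card A0 = k" "B \<subseteq> A0" "finite A0"
        using A0 F S by (auto simp: FB_def F'_def intro: finite_subset)
      then have bk: "b \<le> k" unfolding b_def using card_mono by blast
      define \<A> where "\<A> = (\<lambda>A. A - T) ` FB B"
      have inj: "inj_on (\<lambda>A. A - T) (FB B)" by (auto simp: inj_on_def FB_def)
      have \<A>: "A \<subseteq> S - T \<and> card A = k - b" if "A \<in> \<A>" for A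
      proof -
        obtain A' where A': "A' \<in> F" "A' \<inter> T = B" "A = A' - T" using \<open>A \<in> \<A>\<close> by (auto simp: \<A>_def FB_def F'_def)
        have "A' \<subseteq> S" "card A' = k" using A' F by auto
        moreover have "A = A' - B" using A' by auto
        ultimately show ?thesis
          using A' finB by (auto simp: b_def card_Diff_subset)
      qed
      have finST: "finite (S - T)" using S by simp
      have cST: "card (S - T) = n - card T" using T(1) finT by (simp add: n_def card_Diff_subset)
      define h where "h = (\<lambda>W. \<exists>A\<in>\<A>. A \<subseteq> W)"
      \<comment> \<open>The bound for random subsets of \<open>S\<close>, restricted to those whose
        trace on \<open>T\<close> is \<open>B\<close>.\<close>
      have key: "p ^ b * (1 - p) ^ card (T - B) * rsprob (S - T) p h \<le> D * l ^ 4"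
      proof -
        have "p ^ b * (1 - p) ^ card (T - B) * rsprob (S - T) p h
           \<le> p ^ b * (1 - p) ^ card (T - B) *
             rsexp (S - T) p (\<lambda>W. of_bool (free (B \<union> W)))"
          unfolding rsprob_def
        proof (intro mult_left_mono rsexp_mono p)
          fix W assume W: "W \<subseteq> S - T"
          have "free (B \<union> W)" if "h W"
            unfolding free_def
          proof
            from that obtain A where A: "A \<in> F" "A \<inter> T = B" "A - T \<subseteq> W"
              by (auto simp: h_def \<A>_def FB_def F'_def)
            then have "A \<subseteq> B \<union> W" by blast
            then show "g (B \<union> W)" using A by (auto simp: g_def)
            show "\<not> (\<exists>X\<subseteq>B \<union> W. core_set S g X)"
            proof
              assume "\<exists>X\<subseteq>B \<union> W. core_set S g X"
              then obtain X where X: "X \<subseteq> B \<union> W" "core_set S g X" by blast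
              then have "finite X" using S finite_subset by (auto simp: core_set_def)
              then obtain X' where X': "X' \<subseteq> X" "core_set S g X'" "minimal_core S g X'"
                using ex_minimal_subset[of X "core_set S g"] X(2) unfolding minimal_core_def by blast
              have "X' \<subseteq> T" by (rule T(3)[OF X'(3)])
              then have "X' \<subseteq> B" using X'(1) X(1) W by blast
              then show False using B_core X'(2) by blast
            qed
          qed
          then show "of_bool (h W) \<le> (of_bool (free (B \<union> W)) :: real)"
            by simp
        qed (use p in simp)
        also have "\<dots> \<le> rsexp T p (\<lambda>V. rsexp (S - T) p (\<lambda>W. of_bool (free (V \<union> W))))"
          unfolding b_def using p by (intro rsexp_ge_point finT B rsexp_nonneg) auto
        also have "\<dots> = rsprob S p free"
        proof -
          have "S = T \<union> (S - T)" using T(1) by blast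
          then show ?thesis
            using rsexp_split[of T "S - T" p "\<lambda>V. of_bool (free V)"] S finT
            unfolding rsprob_def by (metis Diff_disjoint finite_Diff)
        qed
        also have "\<dots> \<le> D * l ^ 4" unfolding p_def free_def by (rule small[OF S g lq])
        finally show ?thesis .
      qed
      have half: "1 / 2 \<le> rsprob (S - T) p (\<lambda>W. k - b \<le> card W)"
      proof -
        have "real n / 2 \<le> real (card (S - T))" using cST T(2) n0(1) by linarith
        then have "l / 2 * (real n / 2) \<le> p * real (card (S - T))"
          using p lq by (intro mult_mono) auto
        moreover have "l / 2 * (real n / 2) = 4 * real k" using n0 by (simp add: l_def)
        ultimately have "1 / 2 \<le> rsprob (S - T) p (\<lambda>W. k \<le> card W)"
          using rsprob_card_ge_half[OF finST p(1) p(3) k] by simp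
        also have "\<dots> \<le> rsprob (S - T) p (\<lambda>W. k - b \<le> card W)"
          using p by (intro rsprob_mono) auto
        finally show ?thesis .
      qed
      have cA: "card \<A> = card (FB B)" unfolding \<A>_def by (rule card_image[OF inj])
      \<comment> \<open>Fixing the trace cost a factor \<open>p ^ b\<close>; the number of
        \<open>k\<close>-sets with trace \<open>B\<close> is smaller by the same factor, so it
        cancels.\<close>
      have bin: "real ((n - card T) choose (k - b)) \<le> p ^ b * real (n choose k)"
      proof -
        have "b \<le> card T" unfolding b_def using B finT by (rule card_mono[rotated])
        then have "(n - card T) choose (k - b) \<le> (n - b) choose (k - b)"
          by (intro binomial_right_mono) simp
        then have "real ((n - card T) choose (k - b)) \<le> real ((n - b) choose (k - b))" by simp
        also have "\<dots> \<le> (real k / real n) ^ b * real (n choose k)"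
          using bk nk by (intro binomial_shift_le) auto
        also have "\<dots> \<le> p ^ b * real (n choose k)"
          using kp by (intro mult_right_mono power_mono) auto
        finally show ?thesis .
      qed
      have "real (card (FB B)) * (1 / 2) \<le> real (card \<A>) * rsprob (S - T) p (\<lambda>W. k - b \<le> card W)"
        unfolding cA using half by (intro mult_left_mono) auto
      also have "\<dots> \<le> real ((n - card T) choose (k - b)) * rsprob (S - T) p h"
        unfolding h_def cST[symmetric] using \<A> p by (intro local_LYM finST) auto
      also have "\<dots> \<le> p ^ b * real (n choose k) * rsprob (S - T) p h"
        using bin p by (intro mult_right_mono rsprob_nonneg) auto
      also have "\<dots> \<le> 2 ^ N * (D * l ^ 4) * real (n choose k)"
      proof -
        \<comment> \<open>Missing the points of \<open>T - B\<close> costs at most 2^N, because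
          \<open>p \<le> 1 / 2\<close> and \<open>T\<close> has at most \<open>N\<close>
          points.\<close>
        have "1 \<le> 2 ^ N * (1 - p) ^ card (T - B)"
        proof -
          have "card (T - B) \<le> N" using T(2) card_mono[of T "T - B"] finT by auto
          then have "(1/2::real) ^ N \<le> (1/2) ^ card (T - B)" by (intro power_decreasing) auto
          also have "\<dots> \<le> (1 - p) ^ card (T - B)" using p by (intro power_mono) auto
          finally have "2 ^ N * (1/2) ^ N \<le> 2 ^ N * (1 - p) ^ card (T - B)" by (intro mult_left_mono) auto
          then show ?thesis by (simp flip: power_mult_distrib)
        qed
        then have "1 * (p ^ b * rsprob (S - T) p h) \<le> 2 ^ N * (1 - p) ^ card (T - B) * (p ^ b * rsprob (S - T) p h)"
          using p by (intro mult_right_mono mult_nonneg_nonneg rsprob_nonneg) auto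
        also have "\<dots> = 2 ^ N * (p ^ b * (1 - p) ^ card (T - B) * rsprob (S - T) p h)" by simp
        also have "\<dots> \<le> 2 ^ N * (D * l ^ 4)" using key by (intro mult_left_mono) auto
        finally have "p ^ b * rsprob (S - T) p h * real (n choose k) \<le> 2 ^ N * (D * l ^ 4) * real (n choose k)"
          by (intro mult_right_mono) auto
        then show ?thesis by (simp add: mult_ac)
      qed
      finally show ?thesis by (simp add: M_def)
    qed (use M0 in simp)
    have FU: "F' \<subseteq> (\<Union>B\<in>Pow T. FB B)"
    proof
      fix A assume "A \<in> F'"
      then have "A \<in> FB (A \<inter> T)" by (simp add: FB_def)
      then show "A \<in> (\<Union>B\<in>Pow T. FB B)" by (rule UN_I[rotated]) simp
    qed
    have finP: "finite (Pow T)" using finT by simp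
    have finFB: "finite (FB B)" for B
      by (rule finite_subset[OF _ finF]) (simp add: FB_def F'_def subset_iff)
    have "card F' \<le> card (\<Union>B\<in>Pow T. FB B)"
      by (rule card_mono[OF finite_UN_I[OF finP finFB] FU])
    also have "\<dots> \<le> (\<Sum>B\<in>Pow T. card (FB B))" by (rule card_UN_le[OF finP])
    finally have "real (card F') \<le> (\<Sum>B\<in>Pow T. real (card (FB B)))"
      unfolding of_nat_sum[symmetric] by (rule of_nat_mono)
    also have "\<dots> \<le> (\<Sum>B\<in>Pow T. M)" using FB_le by (intro sum_mono) auto
    also have "\<dots> = 2 ^ card T * M" using finT by (simp add: card_Pow)
    also have "\<dots> \<le> 2 ^ N * M" using T(2) M0 by (intro mult_right_mono power_increasing) auto
    also have "\<dots> = K * (real k / real n) ^ 4 * real (n choose k)"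
    proof -
      have "(2::real) ^ N * 2 ^ N = 4 ^ N" by (simp flip: power_mult_distrib)
      moreover have "l ^ 4 = 16 ^ 4 * (real k / real n) ^ 4" by (simp add: l_def power_mult_distrib power_divide)
      moreover have "2 ^ N * M = 2 * (2 ^ N * 2 ^ N) * (D * l ^ 4) * real (n choose k)"
        by (simp add: M_def mult_ac)
      ultimately show ?thesis by (simp add: K_def)
    qed
    finally show "real (card {A\<in>F. \<not> (\<exists>X\<subseteq>A. core_set S (\<lambda>V. \<exists>A\<in>F. A \<subseteq> V) X)})
       \<le> K * (real k / real (card S)) ^ 4 * real (card S choose k)"
      by (simp add: F'_def g_def n_def)
  qed
qed

section \<open>Triple systems without a fractional cover of weight two\<close>

text \<open>The usual drawing: corners \<open>b\<close>, \<open>c\<close>, \<open>d\<close>; third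
  points \<open>a\<close>, \<open>e\<close>, \<open>f\<close> on the sides \<open>b c\<close>,
  \<open>c d\<close>, \<open>b d\<close>; centre \<open>g\<close>; and \<open>{a,e,f}\<close> as the
  circle.\<close>

definition fano_lines :: "'a \<Rightarrow> 'a \<Rightarrow> 'a \<Rightarrow> 'a \<Rightarrow> 'a \<Rightarrow> 'a \<Rightarrow> 'a \<Rightarrow> 'a set set" where
  "fano_lines a b c d e f g = {{a,b,c},{c,d,e},{b,d,f},{a,d,g},{c,f,g},{b,e,g},{a,e,f}}"

text \<open>The Fano plane has no 2-colouring without a monochromatic line: a set meeting all lines
  cannot have a complement that does so too. It is a propositional fact about seven points.\<close>

lemma fano_lines_blocking:
  assumes "\<forall>P\<in>fano_lines a b c d e f g. A \<inter> P \<noteq> {}"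
  shows "\<exists>P\<in>fano_lines a b c d e f g. P \<subseteq> A"
proof -
  have "a \<in> A \<or> b \<in> A \<or> c \<in> A" "c \<in> A \<or> d \<in> A \<or> e \<in> A" "b \<in> A \<or> d \<in> A \<or> f \<in> A"
    "a \<in> A \<or> d \<in> A \<or> g \<in> A" "c \<in> A \<or> f \<in> A \<or> g \<in> A" "b \<in> A \<or> e \<in> A \<or> g \<in> A"
    "a \<in> A \<or> e \<in> A \<or> f \<in> A"
    using assms by (auto simp: fano_lines_def)
  then show ?thesis unfolding fano_lines_def by simp argo
qed

lemma card_3_extend:
  assumes "card X = 3" "p \<in> X" "q \<in> X" "p \<noteq> q"
  obtains r where "X = {p, q, r}" "r \<noteq> p" "r \<noteq> q"
proof -
  have "finite X" using assms(1) by (metis card.infinite zero_neq_numeral)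
  then have "card (X - {p, q}) = 1" using assms by (simp add: card_Diff_subset)
  then obtain r where "X - {p, q} = {r}" by (rule card_1_singletonE)
  then show thesis using that[of r] assms by blast
qed

text \<open>The last three assumptions exclude particular fractional covers of weight 2.
  \<open>no_pair_cover\<close> also makes the family nonempty, and \<open>no_six_points\<close> is
  the source of a seventh point.\<close>

locale triple_system =
  fixes \<X> :: "'a set set"
  assumes triples: "X \<in> \<X> \<Longrightarrow> card X = 3"
    and intersect: "X \<in> \<X> \<Longrightarrow> Y \<in> \<X> \<Longrightarrow> X \<inter> Y \<noteq> {}"
    and no_pair_cover: "\<exists>X\<in>\<X>. x \<notin> X \<and> y \<notin> X"
    and no_double_cover: "card Q = 4 \<Longrightarrow> \<exists>X\<in>\<X>. card (X \<inter> Q) \<le> 1"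
    and no_six_points: "card Q = 6 \<Longrightarrow> \<exists>X\<in>\<X>. \<not> X \<subseteq> Q"
begin

lemma hit: "X \<in> \<X> \<Longrightarrow> {p, q, r} \<in> \<X> \<Longrightarrow> p \<in> X \<or> q \<in> X \<or> r \<in> X"
  using intersect by blast

lemma finite_triple: "X \<in> \<X> \<Longrightarrow> finite X"
  using triples by (metis card.infinite zero_neq_numeral)

lemma at_most_3:
  assumes "X \<in> \<X>" "distinct [p, q, r, s]"
  shows "\<not> (p \<in> X \<and> q \<in> X \<and> r \<in> X \<and> s \<in> X)"
proof
  assume "p \<in> X \<and> q \<in> X \<and> r \<in> X \<and> s \<in> X"
  then have "set [p, q, r, s] \<subseteq> X" by simp
  then have "card (set [p, q, r, s]) \<le> card X" by (rule card_mono[OF finite_triple[OF assms(1)]])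
  then show False using distinct_card[OF assms(2)] triples[OF assms(1)] by simp
qed

lemma eq_triple:
  assumes "X \<in> \<X>" "distinct [p, q, r]" "p \<in> X" "q \<in> X" "r \<in> X"
  shows "{p, q, r} \<in> \<X>"
proof -
  have "card {p, q, r} = card X" using assms triples[OF assms(1)] by simp
  then have "{p, q, r} = X" using assms by (intro card_subset_eq finite_triple) auto
  then show ?thesis using assms by simp
qed

lemma avoid_double:
  assumes "distinct [p, q, r, s]"
  obtains X where "X \<in> \<X>" "\<not> (p \<in> X \<and> q \<in> X)" "\<not> (p \<in> X \<and> r \<in> X)" "\<not> (p \<in> X \<and> s \<in> X)"
    "\<not> (q \<in> X \<and> r \<in> X)" "\<not> (q \<in> X \<and> s \<in> X)" "\<not> (r \<in> X \<and> s \<in> X)"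
proof -
  have "card {p, q, r, s} = 4" using assms by simp
  then obtain X where X: "X \<in> \<X>" "card (X \<inter> {p, q, r, s}) \<le> 1" using no_double_cover by blast
  have *: "\<not> (u \<in> X \<and> v \<in> X)" if "u \<noteq> v" "u \<in> {p, q, r, s}" "v \<in> {p, q, r, s}" for u v
  proof
    assume "u \<in> X \<and> v \<in> X"
    then have "card {u, v} \<le> card (X \<inter> {p, q, r, s})" using that by (intro card_mono) auto
    then show False using X(2) that(1) by simp
  qed
  show thesis by (rule that[OF X(1)]; rule *) (use assms in auto)
qed

lemma new_point:
  assumes "distinct [a, b, c, d, e, f]"
  obtains X g where "X \<in> \<X>" "g \<in> X" "distinct [a, b, c, d, e, f, g]"
proof -
  have "card {a, b, c, d, e, f} = 6" using assms by simp
  then obtain X g where "X \<in> \<X>" "g \<in> X" "g \<notin> {a, b, c, d, e, f}" using no_six_points by blast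
  then show thesis using that[of X g] assms by auto
qed

text \<open>A triple through a seventh point \<open>g\<close> has two more points with which to meet
  five triples, which leaves \<open>{a,c,g}\<close> and \<open>{a,d,g}\<close>. A triple avoiding
  the pair \<open>a, c\<close> or \<open>a, d\<close>, respectively, would then need four
  points.\<close>

lemma no_config_cdf:
  assumes d: "distinct [a, b, c, d, e, f]"
    and m: "{a,b,c} \<in> \<X>" "{a,b,d} \<in> \<X>" "{c,d,e} \<in> \<X>" "{a,e,f} \<in> \<X>" "{c,d,f} \<in> \<X>"
  shows False
proof -
  obtain X g where X: "X \<in> \<X>" "g \<in> X" and d7: "distinct [a, b, c, d, e, f, g]"
    using new_point[OF d] by blast
  note h = hit[OF X(1)] and t = at_most_3[OF X(1)]
  have "a \<in> X \<and> c \<in> X \<or> a \<in> X \<and> d \<in> X"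
    using h[OF m(1)] h[OF m(2)] h[OF m(3)] h[OF m(4)] h[OF m(5)]
      t[of g b c d] t[of g b e c] t[of g b e d]
      t[of g b f c] t[of g b f d] t[of g b e f]
      t[of g a e f] t[of g c d e] t[of g c d f]
      X(2) d7 by simp argo
  then have "{a,c,g} \<in> \<X> \<or> {a,d,g} \<in> \<X>"
    using eq_triple[OF X(1), of a c g] eq_triple[OF X(1), of a d g] X(2) d7 by auto
  then show False
  proof
    assume n: "{a,c,g} \<in> \<X>"
    obtain Y where Y: "Y \<in> \<X>" "a \<notin> Y" "c \<notin> Y" using no_pair_cover by blast
    note h = hit[OF Y(1)] and t = at_most_3[OF Y(1)]
    show False
      using h[OF m(1)] h[OF n] h[OF m(3)] h[OF m(4)] h[OF m(5)]
        t[of b g d e] t[of b g d f] t[of b g e f]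
        Y(2,3) d7 by simp argo
  next
    assume n: "{a,d,g} \<in> \<X>"
    obtain Y where Y: "Y \<in> \<X>" "a \<notin> Y" "d \<notin> Y" using no_pair_cover by blast
    note h = hit[OF Y(1)] and t = at_most_3[OF Y(1)]
    show False
      using h[OF m(2)] h[OF n] h[OF m(3)] h[OF m(4)] h[OF m(5)]
        t[of b g c e] t[of b g c f] t[of b g e f]
        Y(2,3) d7 by simp argo
  qed
qed

text \<open>Through a seventh point \<open>g\<close> only \<open>{a,c,g}\<close> and
  \<open>{b,e,g}\<close> are possible, and each forces the other. The seven triples then all meet
  \<open>{a,b,c,e}\<close> at least twice, and no triple meeting it at most once can intersect them
  all.\<close>

lemma no_config_bcf:
  assumes d: "distinct [a, b, c, d, e, f]"
    and m: "{a,b,c} \<in> \<X>" "{a,b,d} \<in> \<X>" "{c,d,e} \<in> \<X>" "{a,e,f} \<in> \<X>" "{b,c,f} \<in> \<X>"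
  shows False
proof -
  obtain X g where X: "X \<in> \<X>" "g \<in> X" and d7: "distinct [a, b, c, d, e, f, g]"
    using new_point[OF d] by blast
  note h = hit[OF X(1)] and t = at_most_3[OF X(1)]
  have "a \<in> X \<and> c \<in> X \<or> b \<in> X \<and> e \<in> X"
    using h[OF m(1)] h[OF m(2)] h[OF m(3)] h[OF m(4)] h[OF m(5)]
      t[of g a b d] t[of g a d f] t[of g b c f]
      t[of g b d f] t[of g c d e] t[of g c d f]
      t[of g a e f] t[of g a b e] X(2) d7 by simp argo
  then have either: "{a,c,g} \<in> \<X> \<or> {b,e,g} \<in> \<X>"
    using eq_triple[OF X(1), of a c g] eq_triple[OF X(1), of b e g] X(2) d7 by auto
  have n: "{a,c,g} \<in> \<X>" "{b,e,g} \<in> \<X>"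
  proof -
    have "{b,e,g} \<in> \<X>" if n: "{a,c,g} \<in> \<X>"
    proof -
      obtain Y where Y: "Y \<in> \<X>" "a \<notin> Y" "c \<notin> Y" using no_pair_cover by blast
      note h = hit[OF Y(1)] and t = at_most_3[OF Y(1)]
      have "b \<in> Y \<and> e \<in> Y \<and> g \<in> Y"
        using h[OF m(1)] h[OF n] h[OF m(3)] h[OF m(4)]
          t[of b g d f] Y(2,3) d7 by simp argo
      then show ?thesis using eq_triple[OF Y(1), of b e g] d7 by auto
    qed
    moreover have "{a,c,g} \<in> \<X>" if n: "{b,e,g} \<in> \<X>"
    proof -
      obtain Y where Y: "Y \<in> \<X>" "b \<notin> Y" "e \<notin> Y" using no_pair_cover by blast
      note h = hit[OF Y(1)] and t = at_most_3[OF Y(1)]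
      have "a \<in> Y \<and> c \<in> Y \<and> g \<in> Y"
        using h[OF m(1)] h[OF m(2)] h[OF n] h[OF m(3)] h[OF m(4)] h[OF m(5)]
          t[of c d f g] t[of a d f g] Y(2,3) d7 by simp argo
      then show ?thesis using eq_triple[OF Y(1), of a c g] d7 by auto
    qed
    ultimately show "{a,c,g} \<in> \<X>" "{b,e,g} \<in> \<X>" using either by auto
  qed
  have "distinct [a, b, c, e]" using d by auto
  then obtain Y where Y: "Y \<in> \<X>" "\<not> (a \<in> Y \<and> b \<in> Y)" "\<not> (a \<in> Y \<and> c \<in> Y)" "\<not> (a \<in> Y \<and> e \<in> Y)"
    "\<not> (b \<in> Y \<and> c \<in> Y)" "\<not> (b \<in> Y \<and> e \<in> Y)" "\<not> (c \<in> Y \<and> e \<in> Y)"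
    using avoid_double by blast
  note h = hit[OF Y(1)] and t = at_most_3[OF Y(1)]
  show False
    using h[OF m(1)] h[OF m(2)] h[OF m(3)] h[OF m(4)] h[OF m(5)]
      h[OF n(1)] h[OF n(2)] t[of a d f g] t[of b d f g]
      t[of c d f g] Y(2-) d7 by simp argo
qed

text \<open>A triple avoiding \<open>a\<close> and \<open>e\<close> consists of \<open>f\<close> and
  two of \<open>b\<close>, \<open>c\<close>, \<open>d\<close>. Two of these cases are
  \<open>no_config_bcf\<close>, up to exchanging \<open>c\<close> and \<open>d\<close>.\<close>

lemma no_config_aef:
  assumes d: "distinct [a, b, c, d, e, f]"
    and m: "{a,b,c} \<in> \<X>" "{a,b,d} \<in> \<X>" "{c,d,e} \<in> \<X>" "{a,e,f} \<in> \<X>"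
  shows False
proof -
  obtain X where X: "X \<in> \<X>" "a \<notin> X" "e \<notin> X" using no_pair_cover by blast
  have "b \<in> X \<and> c \<in> X \<and> f \<in> X \<or> b \<in> X \<and> d \<in> X \<and> f \<in> X \<or> c \<in> X \<and> d \<in> X \<and> f \<in> X"
    using hit[OF X(1) m(1)] hit[OF X(1) m(2)] hit[OF X(1) m(3)] hit[OF X(1) m(4)] X(2,3) by argo
  then have "{b,c,f} \<in> \<X> \<or> {b,d,f} \<in> \<X> \<or> {c,d,f} \<in> \<X>"
    using eq_triple[OF X(1), of b c f] eq_triple[OF X(1), of b d f] eq_triple[OF X(1), of c d f] d by auto
  then show False
    using no_config_bcf[OF d m] no_config_cdf[OF d m] no_config_bcf[of a b d c e f] d m
    by (auto simp: insert_commute)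
qed

text \<open>Given \<open>{p,q,c}\<close> and \<open>{p,q,d}\<close>, a triple avoiding
  \<open>p, q\<close> is \<open>{c,d,e}\<close>. These three meet \<open>{p,q,c,d}\<close> twice, so
  some further triple meets it at most once; it has the form \<open>{p,e,f}\<close> or
  \<open>{q,e,f}\<close>, both excluded by \<open>no_config_aef\<close>.\<close>

lemma linear:
  assumes A: "A \<in> \<X>" "B \<in> \<X>" and p: "p \<noteq> q" "p \<in> A" "p \<in> B" "q \<in> A" "q \<in> B"
  shows "A = B"
proof (rule ccontr)
  assume "A \<noteq> B"
  obtain c where c: "A = {p, q, c}" "c \<noteq> p" "c \<noteq> q"
    using card_3_extend[OF triples[OF A(1)]] p by metis
  obtain d where d: "B = {p, q, d}" "d \<noteq> p" "d \<noteq> q"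
    using card_3_extend[OF triples[OF A(2)]] p by metis
  have cd: "c \<noteq> d" using \<open>A \<noteq> B\<close> c d by auto
  have m: "{p,q,c} \<in> \<X>" "{p,q,d} \<in> \<X>" using A c d by auto
  obtain X where X: "X \<in> \<X>" "p \<notin> X" "q \<notin> X" using no_pair_cover by blast
  then have "c \<in> X" "d \<in> X" using hit[OF X(1) m(1)] hit[OF X(1) m(2)] by auto
  then obtain e where e: "X = {c, d, e}" "e \<noteq> c" "e \<noteq> d"
    using card_3_extend[OF triples[OF X(1)]] cd by metis
  have m3: "{c,d,e} \<in> \<X>" using X e by simp
  have dist: "distinct [p, q, c, d, e]" using p(1) c d cd e X by auto
  have "distinct [p, q, c, d]" using dist by simp
  then obtain Y where Y: "Y \<in> \<X>" "\<not> (p \<in> Y \<and> q \<in> Y)" "\<not> (p \<in> Y \<and> c \<in> Y)" "\<not> (p \<in> Y \<and> d \<in> Y)"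
    "\<not> (q \<in> Y \<and> c \<in> Y)" "\<not> (q \<in> Y \<and> d \<in> Y)" "\<not> (c \<in> Y \<and> d \<in> Y)"
    using avoid_double by blast
  have "p \<in> Y \<and> q \<notin> Y \<and> e \<in> Y \<or> q \<in> Y \<and> p \<notin> Y \<and> e \<in> Y" and cdY: "c \<notin> Y" "d \<notin> Y"
    using hit[OF Y(1) m(1)] hit[OF Y(1) m(2)] hit[OF Y(1) m3] Y(2-) by argo+
  then show False
  proof (elim disjE)
    assume y: "p \<in> Y \<and> q \<notin> Y \<and> e \<in> Y"
    then obtain f where f: "Y = {p, e, f}" "f \<noteq> p" "f \<noteq> e"
      using card_3_extend[OF triples[OF Y(1)], of p e] dist by auto
    then show False
      using no_config_aef[of p q c d e f] dist y cdY m m3 Y(1) by auto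
  next
    assume y: "q \<in> Y \<and> p \<notin> Y \<and> e \<in> Y"
    then obtain f where f: "Y = {q, e, f}" "f \<noteq> q" "f \<noteq> e"
      using card_3_extend[OF triples[OF Y(1)], of q e] dist by auto
    then show False
      using no_config_aef[of q p c d e f] dist y cdY m m3 Y(1) by (auto simp: insert_commute)
  qed
qed

lemma not_both: "X \<in> \<X> \<Longrightarrow> {p, q, r} \<in> \<X> \<Longrightarrow> p = q \<or> p \<notin> X \<or> q \<notin> X \<or> r \<in> X"
  using linear[of X "{p, q, r}" p q] by auto

text \<open>All four lines have two points in \<open>{a,b,d,e}\<close>. A triple with at most one
  point there must, by linearity, be \<open>{c,f,g}\<close>.\<close>

lemma fifth_line:
  assumes d: "distinct [a, b, c, d, e, f, g]"
    and m: "{a,b,c} \<in> \<X>" "{c,d,e} \<in> \<X>" "{b,d,f} \<in> \<X>" "{a,d,g} \<in> \<X>"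
  shows "{c,f,g} \<in> \<X>"
proof -
  have r: "{a,c,b} \<in> \<X>" "{b,c,a} \<in> \<X>" "{c,e,d} \<in> \<X>"
    using m by (simp_all add: insert_commute)
  have "distinct [a, b, d, e]" using d by auto
  then obtain X where X: "X \<in> \<X>" "\<not> (a \<in> X \<and> b \<in> X)" "\<not> (a \<in> X \<and> d \<in> X)" "\<not> (a \<in> X \<and> e \<in> X)"
    "\<not> (b \<in> X \<and> d \<in> X)" "\<not> (b \<in> X \<and> e \<in> X)" "\<not> (d \<in> X \<and> e \<in> X)"
    using avoid_double by blast
  note h = hit[OF X(1)] and nb = not_both[OF X(1)]
  have "\<not> (a \<in> X \<and> c \<in> X \<and> b \<notin> X)" "\<not> (b \<in> X \<and> c \<in> X \<and> a \<notin> X)" "\<not> (c \<in> X \<and> d \<in> X \<and> e \<notin> X)" "\<not> (c \<in> X \<and> e \<in> X \<and> d \<notin> X)"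
    using nb[OF r(1)] nb[OF r(2)] nb[OF m(2)] nb[OF r(3)] d by auto
  then have "c \<in> X \<and> f \<in> X \<and> g \<in> X"
    using h[OF m(1)] h[OF m(2)] h[OF m(3)] h[OF m(4)] X(2-) by argo
  then show ?thesis using eq_triple[OF X(1), of c f g] d by auto
qed

text \<open>Symmetries of the figure turn \<open>fifth_line\<close> into the other missing lines.
  Nothing else can belong to the system, as a triple meeting all seven lines contains one of
  them.\<close>

lemma fano_of_four_lines:
  assumes d: "distinct [a, b, c, d, e, f, g]"
    and m: "{a,b,c} \<in> \<X>" "{c,d,e} \<in> \<X>" "{b,d,f} \<in> \<X>" "{a,d,g} \<in> \<X>"
  shows "\<X> = fano_lines a b c d e f g"
proof -
  have n: "{c,f,g} \<in> \<X>" "{b,e,g} \<in> \<X>" "{a,e,f} \<in> \<X>"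
    using fifth_line[OF d m] fifth_line[of a c b d f e g] fifth_line[of c b a d g f e] d m
    by (auto simp: insert_commute)
  have sub: "fano_lines a b c d e f g \<subseteq> \<X>"
    using m n by (simp add: fano_lines_def)
  moreover have "X \<in> fano_lines a b c d e f g" if X: "X \<in> \<X>" for X
  proof -
    have "\<forall>P\<in>fano_lines a b c d e f g. X \<inter> P \<noteq> {}"
      using sub intersect[OF X] by blast
    then obtain P where P: "P \<in> fano_lines a b c d e f g" "P \<subseteq> X"
      using fano_lines_blocking by metis
    then have "P = X"
      using triples[OF X] triples[of P] sub by (intro card_subset_eq finite_triple X) auto
    then show ?thesis using P by simp
  qed
  ultimately show ?thesis by blast
qed

text \<open>A triple avoiding the corners \<open>b, c\<close> passes through \<open>a\<close>. It is
  either the line from \<open>a\<close> to the opposite corner \<open>d\<close> or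
  \<open>{a,e,f}\<close>; in the second case a triple through a seventh point must join a corner to
  the third point of the opposite side. Each outcome is \<open>fano_of_four_lines\<close> after
  relabelling.\<close>

lemma fano_of_three_lines:
  assumes d: "distinct [a, b, c, d, e, f]"
    and m: "{a,b,c} \<in> \<X>" "{c,d,e} \<in> \<X>" "{b,d,f} \<in> \<X>"
  shows "\<exists>a b c d e f g. distinct [a, b, c, d, e, f, g] \<and> \<X> = fano_lines a b c d e f g"
proof -
  obtain Z where Z: "Z \<in> \<X>" "b \<notin> Z" "c \<notin> Z" using no_pair_cover by blast
  have aZ: "a \<in> Z" using hit[OF Z(1) m(1)] Z by auto
  show ?thesis
  proof (cases "d \<in> Z")
    case True
    then obtain g where g: "Z = {a, d, g}" "g \<noteq> a" "g \<noteq> d"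
      using card_3_extend[OF triples[OF Z(1)] aZ True] d by auto
    have "g \<noteq> e"
      using not_both[OF Z(1), of d e c] m(2) Z(3) g d by (auto simp: insert_commute)
    moreover have "g \<noteq> f"
      using not_both[OF Z(1), of d f b] m(3) Z(2) g d by (auto simp: insert_commute)
    ultimately have d7: "distinct [a, b, c, d, e, f, g]" using d g Z by auto
    have "{a, d, g} \<in> \<X>" using Z(1) g(1) by simp
    from fano_of_four_lines[OF d7 m this] d7 show ?thesis by (intro exI conjI)
  next
    case False
    then have "e \<in> Z" "f \<in> Z" using hit[OF Z(1) m(2)] hit[OF Z(1) m(3)] Z by auto
    then have m4: "{a,e,f} \<in> \<X>" using eq_triple[OF Z(1), of a e f] aZ d by auto
    obtain X g where X: "X \<in> \<X>" "g \<in> X" and d7: "distinct [a, b, c, d, e, f, g]"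
      using new_point[OF d] by blast
    note h = hit[OF X(1)] and t = at_most_3[OF X(1)]
    have "a \<in> X \<and> d \<in> X \<or> b \<in> X \<and> e \<in> X \<or> c \<in> X \<and> f \<in> X"
      using h[OF m(1)] h[OF m(2)] h[OF m(3)] h[OF m4]
        t[of g a b c] t[of g a b f] t[of g a e c]
        t[of g a e f] t[of g d b c] t[of g d b f]
        t[of g d e c] t[of g d e f]
        X(2) d7 by simp argo
    then have "{a,d,g} \<in> \<X> \<or> {b,e,g} \<in> \<X> \<or> {c,f,g} \<in> \<X>"
      using eq_triple[OF X(1), of a d g] eq_triple[OF X(1), of b e g] eq_triple[OF X(1), of c f g] X(2) d7 by auto
    then show ?thesis
    proof (elim disjE)
      assume "{a,d,g} \<in> \<X>"
      from fano_of_four_lines[OF d7 m this] d7 show ?thesis by (intro exI conjI)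
    next
      assume "{b,e,g} \<in> \<X>"
      then have "{a,f,e} \<in> \<X>" "{e,b,g} \<in> \<X>" "{f,b,d} \<in> \<X>" "{a,b,c} \<in> \<X>"
        using m m4 by (simp_all add: insert_commute)
      moreover have "distinct [a, f, e, b, g, d, c]" using d7 by auto
      ultimately have "distinct [a, f, e, b, g, d, c] \<and> \<X> = fano_lines a f e b g d c"
        using fano_of_four_lines[of a f e b g d c] by simp
      then show ?thesis by (intro exI)
    next
      assume "{c,f,g} \<in> \<X>"
      then have "{a,e,f} \<in> \<X>" "{f,c,g} \<in> \<X>" "{e,c,d} \<in> \<X>" "{a,c,b} \<in> \<X>"
        using m m4 by (simp_all add: insert_commute)
      moreover have "distinct [a, e, f, c, g, d, b]" using d7 by auto
      ultimately have "distinct [a, e, f, c, g, d, b] \<and> \<X> = fano_lines a e f c g d b"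
        using fano_of_four_lines[of a e f c g d b] by simp
      then show ?thesis by (intro exI)
    qed
  qed
qed

text \<open>Start from one triple \<open>{a,b,c}\<close>. A triple avoiding \<open>a, b\<close> and
  one avoiding \<open>a, c\<close> pass through \<open>c\<close> and \<open>b\<close>, and meet in a
  fourth point \<open>d\<close>; with the first triple they form a triangle.\<close>

theorem is_fano:
  "\<exists>a b c d e f g. distinct [a, b, c, d, e, f, g] \<and> \<X> = fano_lines a b c d e f g"
proof -
  obtain A where A: "A \<in> \<X>" using no_pair_cover by blast
  obtain a b c where abc: "A = {a, b, c}" "a \<noteq> b" "b \<noteq> c" "a \<noteq> c"
    using triples[OF A] by (auto simp: card_3_iff)
  have m1: "{a,b,c} \<in> \<X>" using A abc by simp
  obtain X where X: "X \<in> \<X>" "a \<notin> X" "b \<notin> X" using no_pair_cover by blast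
  have cX: "c \<in> X" using hit[OF X(1) m1] X by auto
  obtain Y where Y: "Y \<in> \<X>" "a \<notin> Y" "c \<notin> Y" using no_pair_cover by blast
  have bY: "b \<in> Y" using hit[OF Y(1) m1] Y by auto
  obtain d where d: "d \<in> X" "d \<in> Y" using intersect[OF X(1) Y(1)] by blast
  then have dn: "d \<noteq> a" "d \<noteq> b" "d \<noteq> c" using X Y by auto
  obtain e where e: "X = {c, d, e}" "e \<noteq> c" "e \<noteq> d"
    using card_3_extend[OF triples[OF X(1)] cX d(1)] dn by auto
  obtain f where f: "Y = {b, d, f}" "f \<noteq> b" "f \<noteq> d"
    using card_3_extend[OF triples[OF Y(1)] bY d(2)] dn by auto
  have "e \<noteq> f" using linear[OF X(1) Y(1), of d e] d e f Y(3) cX by auto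
  then have d6: "distinct [a, b, c, d, e, f]" using abc dn e f X Y by auto
  have "{c, d, e} \<in> \<X>" "{b, d, f} \<in> \<X>" using X(1) Y(1) e(1) f(1) by auto
  then show ?thesis by (rule fano_of_three_lines[OF d6 m1])
qed

end

section \<open>Fano planes, their labellings and isomorphisms\<close>

lemma sum_card_inter:
  assumes "finite \<P>" "finite Q"
  shows "(\<Sum>P\<in>\<P>. card (P \<inter> Q)) = (\<Sum>q\<in>Q. card {P\<in>\<P>. q \<in> P})"
proof -
  have "(\<Sum>P\<in>\<P>. card (P \<inter> Q)) = (\<Sum>P\<in>\<P>. \<Sum>q\<in>Q. if q \<in> P then 1 else 0)"
    using assms by (intro sum.cong) (auto simp: Int_def sum.If_cases conj_commute)
  also have "\<dots> = (\<Sum>q\<in>Q. \<Sum>P\<in>\<P>. if q \<in> P then 1 else 0)" by (rule sum.swap)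
  also have "\<dots> = (\<Sum>q\<in>Q. card {P\<in>\<P>. q \<in> P})"
    using assms by (intro sum.cong) (auto simp: Int_def sum.If_cases)
  finally show ?thesis .
qed

text \<open>The lines through \<open>x\<close>, with \<open>x\<close> removed, are disjoint pairs
  among the six other points.\<close>

lemma fano_plane_degree:
  assumes "fano_plane \<P>"
  shows "card {P\<in>\<P>. x \<in> P} \<le> 3"
proof -
  have c7: "card \<P> = 7" "card (\<Union>\<P>) = 7" and c3: "\<And>P. P \<in> \<P> \<Longrightarrow> card P = 3"
    and c1: "\<And>P Q. P \<in> \<P> \<Longrightarrow> Q \<in> \<P> \<Longrightarrow> P \<noteq> Q \<Longrightarrow> card (P \<inter> Q) = 1"
    using assms by (auto simp: fano_plane_def)
  have fin: "finite \<P>" "finite (\<Union>\<P>)" using c7 by (metis card.infinite zero_neq_numeral)+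
  have finP: "finite P" if "P \<in> \<P>" for P using fin that by (metis Sup_upper finite_subset)
  show ?thesis
  proof (cases "x \<in> \<Union>\<P>")
    case True
    define R where "R = {P\<in>\<P>. x \<in> P}"
    have "card (\<Union>P\<in>R. P - {x}) = (\<Sum>P\<in>R. card (P - {x}))"
    proof (rule card_UN_disjoint)
      show "\<forall>P\<in>R. \<forall>Q\<in>R. P \<noteq> Q \<longrightarrow> (P - {x}) \<inter> (Q - {x}) = {}"
      proof (intro ballI impI)
        fix P Q assume PQ: "P \<in> R" "Q \<in> R" "P \<noteq> Q"
        then have "card (P \<inter> Q) = 1" "x \<in> P \<inter> Q" using c1 by (auto simp: R_def)
        then have "P \<inter> Q = {x}" by (metis card_1_singletonE singletonD)
        then show "(P - {x}) \<inter> (Q - {x}) = {}" by blast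
      qed
    qed (use fin finP in \<open>auto simp: R_def\<close>)
    also have "\<dots> = (\<Sum>P\<in>R. 2)"
      using c3 finP by (intro sum.cong) (auto simp: R_def)
    finally have "2 * card R = card (\<Union>P\<in>R. P - {x})" by simp
    also have "\<dots> \<le> card (\<Union>\<P> - {x})" using fin by (intro card_mono) (auto simp: R_def)
    also have "\<dots> = 6" using True c7 by simp
    finally show ?thesis by (simp add: R_def)
  next
    case False
    then have e: "{P\<in>\<P>. x \<in> P} = {}" by blast
    show ?thesis unfolding e by simp
  qed
qed

text \<open>Degrees at most 3 yield the axioms of a triple system: two points meet at most 6 of the
  7 lines, and four points have at most 12 incidences, fewer than 14.\<close>

lemma fano_plane_lines:
  assumes "fano_plane \<P>"
  shows "\<exists>a b c d e f g. distinct [a, b, c, d, e, f, g] \<and> \<P> = fano_lines a b c d e f g"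
proof -
  have c7: "card \<P> = 7" "card (\<Union>\<P>) = 7" and c3: "\<And>P. P \<in> \<P> \<Longrightarrow> card P = 3"
    and c1: "\<And>P Q. P \<in> \<P> \<Longrightarrow> Q \<in> \<P> \<Longrightarrow> P \<noteq> Q \<Longrightarrow> card (P \<inter> Q) = 1"
    using assms by (auto simp: fano_plane_def)
  have fin: "finite \<P>" "finite (\<Union>\<P>)" using c7 by (metis card.infinite zero_neq_numeral)+
  note deg = fano_plane_degree[OF assms]
  interpret triple_system \<P>
  proof
    fix P Q assume PQ: "P \<in> \<P>" "Q \<in> \<P>"
    show "P \<inter> Q \<noteq> {}"
    proof (cases "P = Q")
      case True
      then show ?thesis using c3[OF PQ(1)] by auto
    next
      case False
      then show ?thesis using c1[OF PQ False] by auto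
    qed
  next
    fix x y
    show "\<exists>P\<in>\<P>. x \<notin> P \<and> y \<notin> P"
    proof (rule ccontr)
      assume "\<not> ?thesis"
      then have "\<P> = {P\<in>\<P>. x \<in> P} \<union> {P\<in>\<P>. y \<in> P}" by blast
      then have "card \<P> \<le> card {P\<in>\<P>. x \<in> P} + card {P\<in>\<P>. y \<in> P}" by (metis card_Un_le)
      then show False using c7 deg[of x] deg[of y] by simp
    qed
  next
    fix Q :: "nat set" assume Q: "card Q = 4"
    show "\<exists>P\<in>\<P>. card (P \<inter> Q) \<le> 1"
    proof (rule ccontr)
      assume no: "\<not> ?thesis"
      have finQ: "finite Q" using Q by (metis card.infinite zero_neq_numeral)
      have "(\<Sum>P\<in>\<P>. 2) \<le> (\<Sum>P\<in>\<P>. card (P \<inter> Q))" using no by (intro sum_mono) force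
      also have "\<dots> \<le> (\<Sum>q\<in>Q. 3)" unfolding sum_card_inter[OF fin(1) finQ] by (intro sum_mono deg)
      finally show False using c7 Q by simp
    qed
  next
    fix Q :: "nat set" assume Q: "card Q = 6"
    show "\<exists>P\<in>\<P>. \<not> P \<subseteq> Q"
    proof (rule ccontr)
      assume "\<not> ?thesis"
      then have "card (\<Union>\<P>) \<le> card Q" using Q by (intro card_mono) (auto intro: card_ge_0_finite)
      then show False using Q c7 by simp
    qed
  qed (rule c3)
  show ?thesis by (rule is_fano)
qed

lemma extend_to_permutation:
  assumes S: "finite S" and L: "L \<subseteq> S" "L' \<subseteq> S" and f: "bij_betw f L L'"
  shows "\<exists>\<pi>. \<pi> permutes S \<and> (\<forall>x\<in>L. \<pi> x = f x)"
proof -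
  have fin: "finite L" "finite L'" using S L finite_subset by auto
  have "card (S - L) = card (S - L')"
    using L fin bij_betw_same_card[OF f] by (simp add: card_Diff_subset)
  then obtain h where h: "bij_betw h (S - L) (S - L')"
    using finite_same_card_bij S by blast
  define \<pi> where "\<pi> = (\<lambda>x. if x \<in> L then f x else if x \<in> S then h x else x)"
  have "bij_betw \<pi> L L'" using f by (rule bij_betw_cong[THEN iffD1, rotated]) (simp add: \<pi>_def)
  moreover have "bij_betw \<pi> (S - L) (S - L')"
    using h by (rule bij_betw_cong[THEN iffD1, rotated]) (simp add: \<pi>_def)
  ultimately have "bij_betw \<pi> (L \<union> (S - L)) (L' \<union> (S - L'))"
    by (rule bij_betw_combine) auto
  then have "bij_betw \<pi> S S" using L by (simp add: Un_absorb1)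
  then have "\<pi> permutes S" using L by (intro bij_imp_permutes) (auto simp: \<pi>_def)
  then show ?thesis by (intro exI[of _ \<pi>]) (auto simp: \<pi>_def)
qed

lemma fano_lines_isomorphic:
  assumes S: "finite S"
    and d: "distinct [a, b, c, d, e, f, g]" "set [a, b, c, d, e, f, g] \<subseteq> S"
    and d': "distinct [a', b', c', d', e', f', g']" "set [a', b', c', d', e', f', g'] \<subseteq> S"
  shows "\<exists>\<pi>. \<pi> permutes S \<and> fano_lines a' b' c' d' e' f' g' = (\<lambda>A. \<pi> ` A) ` fano_lines a b c d e f g"
proof -
  define h where "h = (\<lambda>x. if x = a then a' else if x = b then b' else if x = c then c' else if x = d then d'
    else if x = e then e' else if x = f then f' else g')"
  have v: "h a = a'" "h b = b'" "h c = c'" "h d = d'" "h e = e'" "h f = f'" "h g = g'"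
    using d(1) by (auto simp: h_def)
  have "map h [a, b, c, d, e, f, g] = [a', b', c', d', e', f', g']" using v by simp
  then have "distinct (map h [a, b, c, d, e, f, g])" "h ` set [a, b, c, d, e, f, g] = set [a', b', c', d', e', f', g']"
    using d'(1) by (metis, metis set_map)
  then have "bij_betw h (set [a, b, c, d, e, f, g]) (set [a', b', c', d', e', f', g'])"
    unfolding bij_betw_def distinct_map by blast
  from extend_to_permutation[OF S d(2) d'(2) this] obtain \<pi> where
    \<pi>: "\<pi> permutes S" "\<forall>x\<in>set [a, b, c, d, e, f, g]. \<pi> x = h x" by blast
  have w: "\<pi> a = a'" "\<pi> b = b'" "\<pi> c = c'" "\<pi> d = d'" "\<pi> e = e'" "\<pi> f = f'" "\<pi> g = g'"
    using \<pi>(2) v by simp_all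
  show ?thesis
    using \<pi>(1) by (intro exI[of _ \<pi>]) (simp add: fano_lines_def w)
qed

section \<open>Exceptional sets and low degree\<close>

text \<open>The intersection of independent sets has density \<open>p * q\<close>, and if it
  satisfies a monotone \<open>g\<close> then both sets do.\<close>

lemma rsprob_mult_le:
  assumes S: "finite S" and p: "0 \<le> p" "p \<le> 1" "0 \<le> q" "q \<le> 1"
    and g: "\<And>V W. V \<subseteq> W \<Longrightarrow> g V \<Longrightarrow> g W"
  shows "rsprob S (p * q) g \<le> rsprob S p g * rsprob S q g"
proof -
  have "rsprob S (p * q) g = rsexp S p (\<lambda>V. rsexp S q (\<lambda>W. of_bool (g (V \<inter> W))))"
    unfolding rsprob_def by (rule rsexp_inter[OF S, of p q "\<lambda>V. of_bool (g V)", symmetric])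
  also have "\<dots> \<le> rsexp S p (\<lambda>V. rsexp S q (\<lambda>W. of_bool (g V) * of_bool (g W)))"
  proof (intro rsexp_mono p)
    fix V W :: "'a set"
    show "of_bool (g (V \<inter> W)) \<le> (of_bool (g V) * of_bool (g W) :: real)"
      using g[of "V \<inter> W" V] g[of "V \<inter> W" W] by simp
  qed
  also have "\<dots> = rsexp S p (\<lambda>V. rsprob S q g * of_bool (g V))"
    unfolding rsexp_cmult[of S q] rsprob_def by (simp only: mult.commute)
  also have "\<dots> = rsprob S p g * rsprob S q g"
    unfolding rsexp_cmult by (simp only: rsprob_def mult.commute)
  finally show ?thesis .
qed

text \<open>If \<open>W\<close> contains a \<open>b\<close>-set that meets every member of
  \<open>H\<close>, the complement of \<open>W\<close> contains no member of \<open>H\<close>. At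
  density 1/2 this bounds the up-set generated by \<open>H\<close> by essentially the proportion of
  \<open>b\<close>-sets in the family counted on the right. Passing to density 1/32, where sets
  still typically have at least \<open>k\<close> points, compares with \<open>H\<close> itself at
  the price of a fifth power.\<close>

lemma card_disjoint_partners_ge:
  fixes S :: "'a set"
  assumes S: "finite S" and H: "\<And>A. A \<in> H \<Longrightarrow> A \<subseteq> S \<and> card A = k" and A0: "A0 \<in> H"
    and k: "1 \<le> k" "b \<le> k" "128 * k \<le> card S"
  shows "real (card H) * real (card S choose b) ^ 5
    \<le> 64 * real (card {B. B \<subseteq> S \<and> card B = b \<and> (\<exists>A\<in>H. A \<inter> B = {})}) ^ 5 * real (card S choose k)"
proof -
  define n where "n = card S"
  define L where "L = {B. B \<subseteq> S \<and> card B = b \<and> (\<exists>A\<in>H. A \<inter> B = {})}"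
  define N where "N = real (n choose b)"
  define h where "h = (\<lambda>U. \<exists>A\<in>H. A \<subseteq> U)"
  define x where "x = rsprob S (1/2) h"
  define \<delta> where "\<delta> = rsprob S (1/2) (\<lambda>W. card W < b)"
  have h: "h W" if "V \<subseteq> W" "h V" for V W using that by (auto simp: h_def)
  have half: "0 \<le> (1/2::real)" "(1/2::real) \<le> 1" by auto
  have N0: "0 < N" using k by (simp add: N_def n_def)
  have fin\<K>: "finite {B. B \<subseteq> S \<and> card B = b}" using S by simp
  have Lsub: "L \<subseteq> {B. B \<subseteq> S \<and> card B = b}" by (auto simp: L_def)
  have "card L \<le> n choose b"
    using card_mono[OF fin\<K> Lsub] n_subsets[OF S, of b] by (simp add: n_def)
  then have LN: "real (card L) \<le> N" by (simp add: N_def)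
  have x0: "0 \<le> x" unfolding x_def by (rule rsprob_nonneg[OF half])
  have A0': "A0 \<subseteq> S" "card A0 = k" using H[OF A0] by auto
  have x_ge: "(1/2) ^ k \<le> x"
  proof -
    have "(1/2::real) ^ k = rsprob S (1/2) (\<lambda>V. A0 \<subseteq> V)" using rsprob_superset[OF S A0'(1)] A0'(2) by simp
    also have "\<dots> \<le> x" unfolding x_def using A0 by (intro rsprob_mono half) (auto simp: h_def)
    finally show ?thesis .
  qed
  \<comment> \<open>The error has to stay below \<open>x / 2\<close>, and the only lower bound on
    \<open>x\<close> is 2^(-k), coming from the single member \<open>A0\<close>.\<close>
  have \<delta>: "\<delta> \<le> (1/2) ^ Suc k"
  proof -
    have "\<delta> * (1/4) ^ b \<le> (5/8) ^ n"
      using rsprob_card_less[OF S half, of "1/4" b] by (simp add: \<delta>_def n_def)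
    moreover have "\<delta> * (1/4) ^ k \<le> \<delta> * (1/4) ^ b"
      unfolding \<delta>_def using k by (intro mult_left_mono power_decreasing rsprob_nonneg half) auto
    moreover have "(5/8::real) ^ n \<le> (5/8) ^ (2 * (3 * k + 1))"
      using k by (intro power_decreasing) (simp_all add: n_def)
    moreover have "(5/8::real) ^ (2 * (3 * k + 1)) \<le> (1/2) ^ (3 * k + 1)"
      unfolding power_mult by (intro power_mono) (auto simp: power2_eq_square)
    moreover have "(1/2::real) ^ (3 * k + 1) = (1/2) ^ Suc k * (1/4) ^ k"
    proof -
      have "(1/2::real) ^ (2 * k) = (1/4) ^ k" unfolding power_mult by (simp add: power2_eq_square)
      moreover have "3 * k + 1 = Suc k + 2 * k" by simp
      ultimately show ?thesis by (simp only: power_add)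
    qed
    ultimately have "\<delta> * (1/4) ^ k \<le> (1/2) ^ Suc k * (1/4) ^ k" by linarith
    then show ?thesis by simp
  qed
  have x_le: "x \<le> real (card L) / N + \<delta>"
  proof -
    define \<A> where "\<A> = {B. B \<subseteq> S \<and> card B = b} - L"
    have "real (card \<A>) * rsprob S (1/2) (\<lambda>W. b \<le> card W)
        \<le> real (card S choose b) * rsprob S (1/2) (\<lambda>W. \<exists>B\<in>\<A>. B \<subseteq> W)"
      by (rule local_LYM[OF S half]) (auto simp: \<A>_def)
    also have "rsprob S (1/2) (\<lambda>W. \<exists>B\<in>\<A>. B \<subseteq> W) \<le> rsprob S (1/2) (\<lambda>W. \<not> h (S - W))"
    proof (rule rsprob_mono[OF half])
      fix W assume "W \<subseteq> S" "\<exists>B\<in>\<A>. B \<subseteq> W"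
      then show "\<not> h (S - W)" by (fastforce simp: \<A>_def L_def h_def)
    qed
    also have "\<dots> = 1 - x"
    proof -
      have "rsprob S (1/2) (\<lambda>W. h (S - W)) = x"
        using rsexp_compl[OF S, of "1/2" "\<lambda>U. of_bool (h U)"] by (simp add: rsprob_def x_def)
      then show ?thesis unfolding rsprob_not[OF S] by simp
    qed
    also have "rsprob S (1/2) (\<lambda>W. b \<le> card W) = 1 - \<delta>"
      using rsprob_not[OF S, of "1/2" "\<lambda>W. card W < b"] by (simp add: \<delta>_def not_less)
    also have "real (card \<A>) = N - real (card L)"
    proof -
      have "card \<A> = (n choose b) - card L"
        unfolding \<A>_def using card_Diff_subset[OF finite_subset[OF Lsub fin\<K>] Lsub] n_subsets[OF S, of b] by (simp add: n_def)
      then show ?thesis using LN by (simp add: N_def of_nat_diff)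
    qed
    finally have *: "(N - real (card L)) * (1 - \<delta>) \<le> N * (1 - x)"
      by (simp add: N_def n_def mult_left_mono)
    have "0 \<le> \<delta>" unfolding \<delta>_def by (rule rsprob_nonneg[OF half])
    then have "0 \<le> real (card L) * \<delta>" by simp
    then have "N * x \<le> real (card L) + N * \<delta>" using * by (simp add: algebra_simps)
    then show ?thesis using N0 by (simp add: field_simps)
  qed
  have "x \<le> 2 * (real (card L) / N)"
    using x_le \<delta> x_ge by simp
  then have xN: "x * N \<le> 2 * real (card L)" using N0 by (simp add: field_simps)
  have "rsprob S (1/32) h \<le> x ^ 5"
  proof -
    have mult: "rsprob S (q * (1/2)) h \<le> rsprob S q h * x" if "0 \<le> q" "q \<le> 1" for q
      unfolding x_def by (rule rsprob_mult_le[OF S that half h])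
    have step: "rsprob S (q * (1/2)) h \<le> x ^ i * x" if "0 \<le> q" "q \<le> 1" "rsprob S q h \<le> x ^ i" for q i
      using mult[OF that(1,2)] mult_right_mono[OF that(3) x0] by linarith
    have "rsprob S (1/2 * (1/2)) h \<le> x ^ 1 * x" by (rule step) (auto simp: x_def)
    then have "rsprob S (1/4 * (1/2)) h \<le> x ^ 2 * x" by (intro step) (auto simp: power2_eq_square)
    then have "rsprob S (1/8 * (1/2)) h \<le> x ^ 3 * x" by (intro step) (auto simp: power3_eq_cube power2_eq_square)
    then have "rsprob S (1/16 * (1/2)) h \<le> x ^ 4 * x" by (intro step) (auto simp: power3_eq_cube power4_eq_xxxx)
    then show ?thesis using power_Suc2[of x 4] by simp
  qed
  moreover have "real (card H) * (1/2) \<le> real (n choose k) * rsprob S (1/32) h"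
  proof -
    \<comment> \<open>With at least 128 k points, density 1/32 gives a mean size of at least 4
      k.\<close>
    have "real (card H) * (1/2) \<le> real (card H) * rsprob S (1/32) (\<lambda>W. k \<le> card W)"
      using k by (intro mult_left_mono rsprob_card_ge_half S) auto
    also have "\<dots> \<le> real (card S choose k) * rsprob S (1/32) (\<lambda>W. \<exists>A\<in>H. A \<subseteq> W)"
      by (rule local_LYM[OF S]) (use H in auto)
    finally show ?thesis by (simp add: h_def n_def)
  qed
  ultimately have "real (card H) * (1/2) \<le> real (n choose k) * x ^ 5"
    using mult_left_mono[of "rsprob S (1/32) h" "x ^ 5" "real (n choose k)"] by linarith
  then have "real (card H) * (1/2) * N ^ 5 \<le> real (n choose k) * x ^ 5 * N ^ 5"
    using N0 by (intro mult_right_mono) auto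
  also have "\<dots> = real (n choose k) * (x * N) ^ 5" by (simp add: power_mult_distrib)
  also have "\<dots> \<le> real (n choose k) * (2 * real (card L)) ^ 5"
    using xN x0 N0 by (intro mult_left_mono power_mono) auto
  also have "\<dots> = 32 * (real (card L) ^ 5 * real (n choose k))"
    unfolding power_mult_distrib by simp
  finally have "real (card H) * N ^ 5 \<le> 64 * (real (card L) ^ 5 * real (n choose k))" by simp
  then show ?thesis unfolding N_def n_def L_def by (simp only: mult.assoc)
qed

lemma card_supersets:
  assumes "finite S" "R \<subseteq> S" "card R \<le> k"
  shows "card {A. A \<subseteq> S \<and> card A = k \<and> R \<subseteq> A} = (card S - card R) choose (k - card R)"
proof -
  have finR: "finite R" using assms finite_subset by blast
  have "bij_betw (\<lambda>B. R \<union> B) {B. B \<subseteq> S - R \<and> card B = k - card R} {A. A \<subseteq> S \<and> card A = k \<and> R \<subseteq> A}"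
  proof (rule bij_betwI[where g = "\<lambda>A. A - R"])
    show "(\<lambda>B. R \<union> B) \<in> {B. B \<subseteq> S - R \<and> card B = k - card R} \<rightarrow> {A. A \<subseteq> S \<and> card A = k \<and> R \<subseteq> A}"
    proof
      fix B assume B: "B \<in> {B. B \<subseteq> S - R \<and> card B = k - card R}"
      then have "finite B" using assms(1) finite_subset[of B S] by auto
      then have "card (R \<union> B) = card R + card B" using finR B by (intro card_Un_disjoint) auto
      then show "R \<union> B \<in> {A. A \<subseteq> S \<and> card A = k \<and> R \<subseteq> A}" using B assms by auto
    qed
    show "(\<lambda>A. A - R) \<in> {A. A \<subseteq> S \<and> card A = k \<and> R \<subseteq> A} \<rightarrow> {B. B \<subseteq> S - R \<and> card B = k - card R}"
      using finR by (auto simp: card_Diff_subset)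
  qed auto
  from bij_betw_same_card[OF this] show ?thesis
    using n_subsets[of "S - R" "k - card R"] assms finR by (simp add: card_Diff_subset)
qed

text \<open>A converse to \<open>binomial_shift_le\<close> for three points. The ratio k (k - 1) (k
  - 2) / k^3 is smallest at k = 3, where it equals 2/9.\<close>

lemma binomial_minus_3_ge:
  assumes "3 \<le> k" "k \<le> n"
  shows "2 / 9 * (real k / real n) ^ 3 * real (n choose k) \<le> real ((n - 3) choose (k - 3))"
proof -
  obtain j where j: "k = j + 3" using assms(1) by (metis add.commute le_Suc_ex)
  obtain m where m: "n = m + 3" using assms by (metis add.commute le_Suc_ex le_trans)
  have abs: "real (Suc i) * real (Suc l choose Suc i) = real (Suc l) * real (l choose i)" for i l
    unfolding of_nat_mult[symmetric] by (subst Suc_times_binomial) simp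
  have kn: "(real j + 3) * (real j + 2) * (real j + 1) * real (n choose k)
      = (real m + 3) * (real m + 2) * (real m + 1) * real (m choose j)"
  proof -
    define a where "a = real (n choose k)"
    define b where "b = real (Suc (Suc m) choose Suc (Suc j))"
    define c where "c = real (Suc m choose Suc j)"
    define d where "d = real (m choose j)"
    have e: "(real j + 3) * a = (real m + 3) * b" "(real j + 2) * b = (real m + 2) * c" "(real j + 1) * c = (real m + 1) * d"
      using abs[of "Suc (Suc j)" "Suc (Suc m)"] abs[of "Suc j" "Suc m"] abs[of j m]
      by (simp_all add: a_def b_def c_def d_def j m numeral_3_eq_3 add_ac del: binomial_Suc_Suc)
    have "(real j + 3) * (real j + 2) * (real j + 1) * a = (real j + 2) * (real j + 1) * ((real j + 3) * a)" by simp
    also have "\<dots> = (real j + 1) * (real m + 3) * ((real j + 2) * b)" unfolding e(1) by simp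
    also have "\<dots> = (real m + 3) * (real m + 2) * ((real j + 1) * c)" unfolding e(2) by simp
    also have "\<dots> = (real m + 3) * (real m + 2) * (real m + 1) * d" unfolding e(3) by simp
    finally show ?thesis by (simp add: a_def d_def)
  qed
  have "2 * real k ^ 3 * real (n choose k) \<le> 9 * ((real j + 3) * (real j + 2) * (real j + 1)) * real (n choose k)"
  proof (intro mult_right_mono)
    have "2 * (real j + 3) * (real j + 3) \<le> 9 * ((real j + 2) * (real j + 1))" by (simp add: algebra_simps)
    then have "(real j + 3) * (2 * (real j + 3) * (real j + 3)) \<le> (real j + 3) * (9 * ((real j + 2) * (real j + 1)))"
      by (intro mult_left_mono) auto
    moreover have "2 * real k ^ 3 = (real j + 3) * (2 * (real j + 3) * (real j + 3))"
      by (simp add: j power3_eq_cube algebra_simps)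
    moreover have "9 * ((real j + 3) * (real j + 2) * (real j + 1)) = (real j + 3) * (9 * ((real j + 2) * (real j + 1)))"
      by (simp add: algebra_simps)
    ultimately show "2 * real k ^ 3 \<le> 9 * ((real j + 3) * (real j + 2) * (real j + 1))" by linarith
  qed simp
  also have "\<dots> = 9 * ((real m + 3) * (real m + 2) * (real m + 1) * real (m choose j))"
    using kn by (simp add: mult.assoc)
  also have "\<dots> \<le> 9 * (real n ^ 3 * real (m choose j))"
  proof (intro mult_left_mono mult_right_mono)
    have "(real m + 3) * (real m + 2) * (real m + 1) \<le> real n * real n * real n"
      by (intro mult_mono) (auto simp: m)
    then show "(real m + 3) * (real m + 2) * (real m + 1) \<le> real n ^ 3" by (simp add: power3_eq_cube)
  qed auto
  finally have "2 * real k ^ 3 * real (n choose k) \<le> 9 * (real n ^ 3 * real (m choose j))" .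
  moreover have "0 < real n ^ 3" using m by simp
  ultimately show ?thesis
    by (simp add: j m power_divide divide_simps mult_ac)
qed

lemma degree_le_max_degree:
  assumes "1 \<le> n" "\<F> \<subseteq> nsets {1..n} k"
  shows "card {A\<in>\<F>. i \<in> A} \<le> max_degree n \<F>"
proof (cases "i \<in> {1..n}")
  case True
  then show ?thesis unfolding max_degree_def by (intro Max_ge) auto
next
  case False
  then have e: "{A\<in>\<F>. i \<in> A} = {}" using assms(2) unfolding nsets_def by blast
  show ?thesis unfolding e by simp
qed

text \<open>
  If \<open>\<X>\<close> violated one of the axioms of a triple system, it would have a fractional cover of
  total weight 2, with weights 1 on two points, 1/2 on four points or 1/3 on six points.
\<close>

lemma triple_system_of_low_degree:
  assumes G: "finite G" and XG: "\<And>A. A \<in> G \<Longrightarrow> \<exists>X\<in>\<X>. X \<subseteq> A"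
    and X3: "\<And>X. X \<in> \<X> \<Longrightarrow> finite X \<and> card X \<le> 3"
    and X_int: "\<And>X Y. X \<in> \<X> \<Longrightarrow> Y \<in> \<X> \<Longrightarrow> X \<inter> Y \<noteq> {}"
    and deg: "\<And>i. card {A\<in>G. i \<in> A} \<le> \<Delta>" and big: "2 * \<Delta> < card G"
    and finA: "\<And>A. A \<in> G \<Longrightarrow> finite A"
  shows "triple_system \<X>"
proof -
  have pair: "\<exists>X\<in>\<X>. x \<notin> X \<and> y \<notin> X" for x y
  proof (rule ccontr)
    assume no: "\<not> ?thesis"
    have "G \<subseteq> {A\<in>G. x \<in> A} \<union> {A\<in>G. y \<in> A}" using XG no by blast
    then have "card G \<le> card ({A\<in>G. x \<in> A} \<union> {A\<in>G. y \<in> A})" using G by (intro card_mono) auto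
    also have "\<dots> \<le> card {A\<in>G. x \<in> A} + card {A\<in>G. y \<in> A}" by (rule card_Un_le)
    finally show False using deg[of x] deg[of y] big by linarith
  qed
  \<comment> \<open>Corresponds to weight 1/r on each of the 2 r points of \<open>Q\<close>.\<close>
  have weight: "\<exists>X\<in>\<X>. card (X \<inter> Q) < r" if Q: "finite Q" "card Q = 2 * r" and r: "0 < r" for Q r
  proof (rule ccontr)
    assume no: "\<not> ?thesis"
    have "r \<le> card (A \<inter> Q)" if A: "A \<in> G" for A
    proof -
      obtain X where X: "X \<in> \<X>" "X \<subseteq> A" using XG[OF A] by blast
      then have "r \<le> card (X \<inter> Q)" using no by (meson not_less)
      also have "\<dots> \<le> card (A \<inter> Q)" using X Q by (intro card_mono) auto
      finally show ?thesis .
    qed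
    then have "(\<Sum>A\<in>G. r) \<le> (\<Sum>A\<in>G. card (A \<inter> Q))" by (intro sum_mono)
    also have "\<dots> = (\<Sum>q\<in>Q. card {A\<in>G. q \<in> A})" by (rule sum_card_inter[OF G Q(1)])
    also have "\<dots> \<le> (\<Sum>q\<in>Q. \<Delta>)" by (intro sum_mono deg)
    finally have "r * card G \<le> r * (2 * \<Delta>)" using Q by (simp add: mult_ac)
    then show False using r big by simp
  qed
  \<comment> \<open>A member with at most two points would itself be a pair meeting every
    member.\<close>
  have three: "card X = 3" if X: "X \<in> \<X>" for X
  proof (rule ccontr)
    assume "card X \<noteq> 3"
    then have "card X \<le> 2" using X3[OF X] by linarith
    have "X \<noteq> {}" using X_int[OF X X] by auto
    then obtain x where x: "x \<in> X" by blast
    then have c: "card (X - {x}) \<le> 1" "finite (X - {x})" using X3[OF X] \<open>card X \<le> 2\<close> by simp_all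
    obtain y where "X - {x} \<subseteq> {y}"
    proof (cases "X - {x} = {}")
      case False
      then obtain y where "y \<in> X - {x}" by blast
      then have "X - {x} \<subseteq> {y}" using c card_le_Suc0_iff_eq[of "X - {x}"] by auto
      then show thesis by (rule that)
    next
      case True
      then have "X - {x} \<subseteq> {x}" by blast
      then show thesis by (rule that)
    qed
    then have "X \<subseteq> {x, y}" by blast
    moreover obtain Y where "Y \<in> \<X>" "x \<notin> Y" "y \<notin> Y" using pair by blast
    ultimately show False using X_int[OF X, of Y] by blast
  qed
  show ?thesis
  proof
    fix Q :: "'a set" assume Q: "card Q = 4"
    then have "finite Q" by (metis card.infinite zero_neq_numeral)
    then obtain X where "X \<in> \<X>" "card (X \<inter> Q) < 2" using weight[of Q 2] Q by auto
    then show "\<exists>X\<in>\<X>. card (X \<inter> Q) \<le> 1" by (intro bexI[of _ X]) auto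
  next
    fix Q :: "'a set" assume Q: "card Q = 6"
    then have "finite Q" by (metis card.infinite zero_neq_numeral)
    then obtain X where X: "X \<in> \<X>" "card (X \<inter> Q) < 3" using weight[of Q 3] Q by auto
    then have "\<not> X \<subseteq> Q" using three[OF X(1)] by (metis Int_absorb2 less_irrefl)
    then show "\<exists>X\<in>\<X>. \<not> X \<subseteq> Q" using X(1) by blast
  qed (use pair X_int three in auto)
qed

section \<open>The Fano family and the extremal problem\<close>

definition supersets :: "nat \<Rightarrow> nat \<Rightarrow> nat set \<Rightarrow> nat set set" where
  "supersets n k R = {A. A \<subseteq> {1..n} \<and> card A = k \<and> R \<subseteq> A}"

lemma finite_supersets: "finite (supersets n k R)"
  by (rule finite_subset[of _ "Pow {1..n}"]) (auto simp: supersets_def)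

lemma nsets_finite: "finite S \<Longrightarrow> nsets S k = {A. A \<subseteq> S \<and> card A = k}"
  unfolding nsets_def using finite_subset by blast

lemma fano_family_eq: "fano_family \<P> n k = (\<Union>P\<in>\<P>. supersets n k P)"
  by (auto simp: fano_family_def nsets_finite supersets_def)

lemma card_supersets_3:
  "P \<subseteq> {1..n} \<Longrightarrow> card P = 3 \<Longrightarrow> 3 \<le> k \<Longrightarrow> card (supersets n k P) = (n - 3) choose (k - 3)"
  unfolding supersets_def using card_supersets[of "{1..n}" P k] by simp

lemma card_supersets_4:
  assumes R: "R \<subseteq> {1..n}" "card R = 4" and k: "3 \<le> k" "k \<le> n"
  shows "real (card (supersets n k R)) \<le> real k / real n * real ((n - 3) choose (k - 3))"
proof (cases "k = 3")
  \<comment> \<open>Here \<open>k - 4\<close> truncates to 0, so the general binomial would count 1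
    where there is no superset at all.\<close>
  case True
  have "supersets n k R = {}"
  proof (rule ccontr)
    assume "supersets n k R \<noteq> {}"
    then obtain A where A: "A \<subseteq> {1..n}" "card A = 3" "R \<subseteq> A" using True by (auto simp: supersets_def)
    then have "card R \<le> card A" using finite_subset[of A "{1..n}"] by (intro card_mono) auto
    then show False using A R by simp
  qed
  then show ?thesis by simp
next
  case False
  then have k4: "4 \<le> k" using k by simp
  have "real (card (supersets n k R)) = real ((n - 3 - 1) choose (k - 3 - 1))"
    unfolding supersets_def using card_supersets[of "{1..n}" R k] R k4 by simp
  also have "\<dots> \<le> (real (k - 3) / real (n - 3)) ^ 1 * real ((n - 3) choose (k - 3))"
    using k4 k by (intro binomial_shift_le) auto
  also have "\<dots> \<le> real k / real n * real ((n - 3) choose (k - 3))"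
  proof (intro mult_right_mono)
    have "(real k - 3) * real n \<le> real k * (real n - 3)" using k by (simp add: algebra_simps)
    then show "(real (k - 3) / real (n - 3)) ^ 1 \<le> real k / real n"
      using k4 k by (simp add: of_nat_diff divide_simps)
  qed simp
  finally show ?thesis .
qed

lemma finite_fano_plane:
  assumes "fano_plane \<P>"
  shows "finite \<P>" "card \<P> = 7" "finite (\<Union>\<P>)" "card (\<Union>\<P>) = 7" "P \<in> \<P> \<Longrightarrow> card P = 3" "P \<in> \<P> \<Longrightarrow> finite P"
proof -
  show c: "card \<P> = 7" "card (\<Union>\<P>) = 7" "P \<in> \<P> \<Longrightarrow> card P = 3"
    using assms by (auto simp: fano_plane_def)
  show "finite \<P>" "finite (\<Union>\<P>)" using c by (metis card.infinite zero_neq_numeral)+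
  then show "P \<in> \<P> \<Longrightarrow> finite P" by (metis Sup_upper finite_subset)
qed

text \<open>Count only the sets whose trace on the seven points is exactly a line, so that different
  lines count disjoint families. Each of the four points off the line costs at most a fraction k /
  n.\<close>

lemma card_fano_family_ge:
  assumes \<P>: "fano_plane \<P>" "\<Union>\<P> \<subseteq> {1..n}" and k: "3 \<le> k" "k \<le> n"
  shows "7 * (1 - 4 * (real k / real n)) * real ((n - 3) choose (k - 3)) \<le> real (card (fano_family \<P> n k))"
proof -
  note fp = finite_fano_plane[OF \<P>(1)]
  define T where "T = \<Union>\<P>"
  define N where "N = real ((n - 3) choose (k - 3))"
  define E where "E = (\<lambda>P. supersets n k P - (\<Union>t\<in>T - P. supersets n k (insert t P)))"
  have finE: "finite (E P)" for P by (simp add: E_def finite_supersets)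
  have E_ge: "N - 4 * (real k / real n * N) \<le> real (card (E P))" if P: "P \<in> \<P>" for P
  proof -
    have PT: "P \<subseteq> T" "finite T" using P fp by (auto simp: T_def)
    have c4: "card (T - P) = 4"
      using fp P PT by (simp add: card_Diff_subset T_def)
    have "real (card (\<Union>t\<in>T - P. supersets n k (insert t P))) \<le> (\<Sum>t\<in>T - P. real (card (supersets n k (insert t P))))"
      unfolding of_nat_sum[symmetric] using PT by (intro of_nat_mono card_UN_le) auto
    also have "\<dots> \<le> (\<Sum>t\<in>T - P. real k / real n * N)"
    proof (rule sum_mono)
      fix t assume t: "t \<in> T - P"
      then have "card (insert t P) = 4" "insert t P \<subseteq> {1..n}"
        using fp P PT \<P>(2) by (auto simp: T_def)
      then show "real (card (supersets n k (insert t P))) \<le> real k / real n * N"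
        unfolding N_def using k by (intro card_supersets_4) auto
    qed
    also have "\<dots> = 4 * (real k / real n * N)" using c4 by simp
    finally have 1: "real (card (\<Union>t\<in>T - P. supersets n k (insert t P))) \<le> 4 * (real k / real n * N)" .
    have "card (supersets n k P) \<le> card (E P \<union> (\<Union>t\<in>T - P. supersets n k (insert t P)))"
      using PT by (intro card_mono) (auto simp: E_def finite_supersets)
    also have "\<dots> \<le> card (E P) + card (\<Union>t\<in>T - P. supersets n k (insert t P))" by (rule card_Un_le)
    finally have "real (card (supersets n k P)) \<le> real (card (E P)) + real (card (\<Union>t\<in>T - P. supersets n k (insert t P)))"
      by simp
    moreover have "real (card (supersets n k P)) = N"
      unfolding N_def using P fp \<P>(2) k by (subst card_supersets_3) auto
    ultimately show ?thesis using 1 by simp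
  qed
  have trace: "A \<inter> T = P" if "P \<in> \<P>" "A \<in> E P" for A P
  proof -
    have "t \<notin> A" if "t \<in> T - P" for t
      using that \<open>A \<in> E P\<close> by (auto simp: E_def supersets_def)
    moreover have "P \<subseteq> A" using that(2) by (auto simp: E_def supersets_def)
    ultimately show ?thesis using that(1) by (auto simp: T_def)
  qed
  have "7 * (1 - 4 * (real k / real n)) * N = (\<Sum>P\<in>\<P>. N - 4 * (real k / real n * N))"
    using fp by (simp add: algebra_simps)
  also have "\<dots> \<le> (\<Sum>P\<in>\<P>. real (card (E P)))" by (intro sum_mono E_ge)
  also have "\<dots> = real (card (\<Union>P\<in>\<P>. E P))"
  proof -
    have "card (\<Union>P\<in>\<P>. E P) = (\<Sum>P\<in>\<P>. card (E P))"
    proof (rule card_UN_disjoint)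
      show "\<forall>P\<in>\<P>. \<forall>Q\<in>\<P>. P \<noteq> Q \<longrightarrow> E P \<inter> E Q = {}" using trace by blast
    qed (use fp finE in auto)
    then show ?thesis by simp
  qed
  also have "\<dots> \<le> real (card (fano_family \<P> n k))"
    unfolding fano_family_eq using fp
    by (intro of_nat_mono card_mono) (auto simp: E_def finite_supersets)
  finally show ?thesis by (simp add: N_def)
qed

text \<open>At most three lines pass through a point and contribute fully; for a line off the point,
  prescribing the point costs a factor k / n.\<close>

lemma max_degree_fano_family_le:
  assumes \<P>: "fano_plane \<P>" "\<Union>\<P> \<subseteq> {1..n}" and k: "3 \<le> k" "k \<le> n"
  shows "real (max_degree n (fano_family \<P> n k)) \<le> (3 + 7 * (real k / real n)) * real ((n - 3) choose (k - 3))"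
proof -
  note fp = finite_fano_plane[OF \<P>(1)]
  define N where "N = real ((n - 3) choose (k - 3))"
  have "real (card {A \<in> fano_family \<P> n k. i \<in> A}) \<le> (3 + 7 * (real k / real n)) * N" if i: "i \<in> {1..n}" for i
  proof -
    have "card {A \<in> fano_family \<P> n k. i \<in> A} \<le> card (\<Union>P\<in>\<P>. supersets n k (insert i P))"
      using fp by (intro card_mono) (auto simp: fano_family_eq supersets_def finite_supersets[unfolded supersets_def])
    also have "\<dots> \<le> (\<Sum>P\<in>\<P>. card (supersets n k (insert i P)))" using fp by (intro card_UN_le)
    finally have "real (card {A \<in> fano_family \<P> n k. i \<in> A}) \<le> (\<Sum>P\<in>\<P>. real (card (supersets n k (insert i P))))"
      unfolding of_nat_sum[symmetric] by (rule of_nat_mono)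
    also have "\<dots> \<le> (\<Sum>P\<in>\<P>. of_bool (i \<in> P) * N + real k / real n * N)"
    proof (rule sum_mono)
      fix P assume P: "P \<in> \<P>"
      show "real (card (supersets n k (insert i P))) \<le> of_bool (i \<in> P) * N + real k / real n * N"
      proof (cases "i \<in> P")
        case True
        then have "real (card (supersets n k (insert i P))) = N"
          unfolding N_def using P fp \<P>(2) k by (subst card_supersets_3) (auto simp: insert_absorb)
        then show ?thesis using True by (simp add: N_def)
      next
        case False
        then have "real (card (supersets n k (insert i P))) \<le> real k / real n * N"
          unfolding N_def using P fp \<P>(2) k i by (intro card_supersets_4) auto
        then show ?thesis using False by simp
      qed
    qed
    also have "\<dots> = real (card {P\<in>\<P>. i \<in> P}) * N + 7 * (real k / real n * N)"
      using fp by (simp add: sum.distrib Int_def flip: sum_distrib_right)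
    also have "\<dots> \<le> 3 * N + 7 * (real k / real n * N)"
      using fano_plane_degree[OF \<P>(1), of i] by (intro add_right_mono mult_right_mono) (auto simp: N_def)
    finally show ?thesis by (simp add: algebra_simps)
  qed
  moreover have "max_degree n (fano_family \<P> n k) \<in> (\<lambda>i. card {A \<in> fano_family \<P> n k. i \<in> A}) ` {1..n}"
    unfolding max_degree_def using k by (intro Max_in) auto
  ultimately show ?thesis unfolding N_def by auto
qed

lemma intersecting_fano_family:
  assumes \<P>: "fano_plane \<P>"
  shows "intersecting (fano_family \<P> n k)"
  unfolding intersecting_def
proof (intro ballI)
  fix A B assume "A \<in> fano_family \<P> n k" "B \<in> fano_family \<P> n k"
  then obtain P Q where PQ: "P \<in> \<P>" "P \<subseteq> A" "Q \<in> \<P>" "Q \<subseteq> B" by (auto simp: fano_family_def)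
  have "P \<inter> Q \<noteq> {}"
  proof (cases "P = Q")
    case True
    then show ?thesis using finite_fano_plane(5)[OF \<P> PQ(1)] by auto
  next
    case False
    then have "card (P \<inter> Q) = 1" using \<P> PQ by (auto simp: fano_plane_def)
    then show ?thesis by auto
  qed
  then show "A \<inter> B \<noteq> {}" using PQ by blast
qed

lemma fano_family_image:
  assumes "\<pi> permutes {1..n}"
  shows "fano_family ((\<lambda>A. \<pi> ` A) ` \<Q>) n k = (\<lambda>A. \<pi> ` A) ` fano_family \<Q> n k"
proof -
  have inj: "inj \<pi>" and im: "\<pi> ` {1..n} = {1..n}"
    using permutes_inj[OF assms] permutes_image[OF assms] by auto
  have ns: "\<pi> ` A \<in> nsets {1..n} k \<longleftrightarrow> A \<in> nsets {1..n} k" for A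
  proof -
    have "\<pi> ` A \<subseteq> {1..n} \<longleftrightarrow> A \<subseteq> {1..n}"
      using inj_image_subset_iff[OF inj, of A "{1..n}"] unfolding im .
    then show ?thesis using inj by (simp add: nsets_finite card_image inj_on_subset)
  qed
  show ?thesis
  proof (intro equalityI subsetI)
    fix B assume B: "B \<in> fano_family ((\<lambda>A. \<pi> ` A) ` \<Q>) n k"
    define A where "A = inv \<pi> ` B"
    have BA: "B = \<pi> ` A" using permutes_surj[OF assms] by (simp add: A_def image_image surj_f_inv_f)
    have "A \<in> fano_family \<Q> n k"
      using B ns[of A] inj_image_subset_iff[OF inj] by (auto simp: fano_family_def BA)
    then show "B \<in> (\<lambda>A. \<pi> ` A) ` fano_family \<Q> n k" using BA by blast
  next
    fix B assume "B \<in> (\<lambda>A. \<pi> ` A) ` fano_family \<Q> n k"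
    then obtain A where A: "A \<in> fano_family \<Q> n k" "B = \<pi> ` A" by blast
    then show "B \<in> fano_family ((\<lambda>A. \<pi> ` A) ` \<Q>) n k"
      using ns[of A] by (auto simp: fano_family_def)
  qed
qed

text \<open>
  A set of \<open>F0\<close> contains no line, hence is disjoint from some line \<open>P\<close>.  The sets of \<open>F0\<close> disjoint
  from the most popular such line rule out too many members of the Fano family that contain \<open>P\<close>.
\<close>

lemma no_exceptional_sets:
  fixes n k :: nat and K :: real
  assumes d: "distinct [a, b, c, d, e, f, g]" and sub: "\<Union>(fano_lines a b c d e f g) \<subseteq> {1..n}"
    and k: "3 \<le> k" "128 * k + 3 \<le> n" and F: "F \<subseteq> nsets {1..n} k" "intersecting F"
    and D: "D = fano_family (fano_lines a b c d e f g) n k" and DF: "card D \<le> card F"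
    and K: "0 < K" "real (card (F - D)) \<le> K * (real k / real n) ^ 4 * real (n choose k)"
    and small: "2 * 14 ^ 5 * K ^ 4 * (9 / 2) ^ 5 * (real k / real n) < 1"
  shows "F = D"
proof -
  define p where "p = real k / real n"
  define \<Q> where "\<Q> = fano_lines a b c d e f g"
  define F0 where "F0 = F - D"
  have finF: "finite F" by (rule finite_subset[OF F(1) finite_imp_finite_nsets]) simp
  have finD: "finite D" unfolding D fano_family_def using finite_imp_finite_nsets[of "{1..n}" k] by simp
  have finF0: "finite F0" using finF by (simp add: F0_def)
  have fin\<Q>: "finite \<Q>" "card \<Q> \<le> 7" and c3: "\<And>P. P \<in> \<Q> \<Longrightarrow> card P = 3" "\<Q> \<noteq> {}"
  proof -
    show "finite \<Q>" "\<Q> \<noteq> {}" by (simp_all add: \<Q>_def fano_lines_def)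
    have "card (set [{a,b,c},{c,d,e},{b,d,f},{a,d,g},{c,f,g},{b,e,g},{a,e,f}]) \<le> 7"
      by (rule order_trans[OF card_length]) simp
    then show "card \<Q> \<le> 7" by (simp add: \<Q>_def fano_lines_def)
    show "\<And>P. P \<in> \<Q> \<Longrightarrow> card P = 3" using d by (auto simp: \<Q>_def fano_lines_def)
  qed
  have "F0 = {}"
  proof (rule ccontr)
    assume "F0 \<noteq> {}"
    define H where "H = (\<lambda>P. {A\<in>F0. A \<inter> P = {}})"
    have cover: "F0 \<subseteq> (\<Union>P\<in>\<Q>. H P)"
    proof
      fix A assume A: "A \<in> F0"
      have "\<exists>P\<in>\<Q>. A \<inter> P = {}"
      proof (rule ccontr)
        assume "\<not> ?thesis"
        then have "\<exists>P\<in>\<Q>. P \<subseteq> A" unfolding \<Q>_def by (intro fano_lines_blocking) blast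
        then have "A \<in> D" using A F(1) by (auto simp: D fano_family_def F0_def \<Q>_def)
        then show False using A by (simp add: F0_def)
      qed
      then show "A \<in> (\<Union>P\<in>\<Q>. H P)" using A by (auto simp: H_def)
    qed
    \<comment> \<open>The most frequently avoided of the at most seven lines is disjoint from at
      least one seventh of \<open>F0\<close>.\<close>
    define x where "x = Max ((\<lambda>P. card (H P)) ` \<Q>)"
    have "x \<in> (\<lambda>P. card (H P)) ` \<Q>" unfolding x_def using fin\<Q> c3 by (intro Max_in) auto
    then obtain P where P: "P \<in> \<Q>" "card (H P) = x" by auto
    have finH: "finite (H P)" for P using finF0 by (simp add: H_def)
    have "card F0 \<le> card (\<Union>P\<in>\<Q>. H P)" using cover fin\<Q> finH by (intro card_mono) auto
    also have "\<dots> \<le> (\<Sum>P\<in>\<Q>. card (H P))" using fin\<Q> by (intro card_UN_le)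
    also have "\<dots> \<le> (\<Sum>P\<in>\<Q>. x)" unfolding x_def using fin\<Q> by (intro sum_mono Max_ge) auto
    also have "\<dots> \<le> 7 * x" using fin\<Q> by simp
    finally have F0x: "card F0 \<le> 7 * x" .
    then have x0: "0 < x" using \<open>F0 \<noteq> {}\<close> finF0 by (metis card_gt_0_iff mult_0_right not_gr_zero not_le)
    then obtain A0 where A0: "A0 \<in> H P" using P by (metis card.empty ex_in_conv less_irrefl)
    define S where "S = {1..n} - P"
    have PS: "P \<subseteq> {1..n}" "finite P" "card P = 3"
      using P sub c3 by (auto simp: \<Q>_def intro: card_ge_0_finite)
    have S: "finite S" "card S = n - 3" using PS by (auto simp: S_def card_Diff_subset)
    \<comment> \<open>For \<open>B\<close> in \<open>L\<close>, the set \<open>P \<union> B\<close>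
      belongs to \<open>D\<close> but misses a member of \<open>F\<close>, so it is absent from
      \<open>F\<close>. As \<open>card D \<le> card F\<close>, at most \<open>card F0\<close>
      members of \<open>D\<close> can be absent.\<close>
    define L where "L = {B. B \<subseteq> S \<and> card B = k - 3 \<and> (\<exists>A\<in>H P. A \<inter> B = {})}"
    have HS: "A \<subseteq> S \<and> card A = k" if "A \<in> H P" for A
      using that F(1) by (auto simp: H_def F0_def nsets_finite S_def)
    have ineq: "real x * real ((n - 3) choose (k - 3)) ^ 5 \<le> 64 * real (card L) ^ 5 * real ((n - 3) choose k)"
      using card_disjoint_partners_ge[OF S(1) HS A0, of "k - 3"] k P(2) S by (simp add: L_def)
    have finL: "finite L" using S by (simp add: L_def)
    have "inj_on (\<lambda>B. P \<union> B) L" by (rule inj_onI) (auto simp: L_def S_def)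
    then have "card L = card ((\<lambda>B. P \<union> B) ` L)" by (simp add: card_image)
    also have "\<dots> \<le> card (D - F)"
    proof (intro card_mono image_subsetI)
      fix B assume B: "B \<in> L"
      then obtain A where A: "A \<in> H P" "A \<inter> B = {}" "B \<subseteq> S" "card B = k - 3" by (auto simp: L_def)
      have "finite B" using A(3) S(1) finite_subset by blast
      then have "card (P \<union> B) = k" using A PS k by (subst card_Un_disjoint) (auto simp: S_def)
      then have "P \<union> B \<in> D" using A PS P by (auto simp: D fano_family_def nsets_finite S_def \<Q>_def)
      moreover have "P \<union> B \<notin> F"
      proof
        assume "P \<union> B \<in> F"
        moreover have "A \<in> F" "A \<inter> (P \<union> B) = {}" using A by (auto simp: H_def F0_def)
        ultimately show False using F(2) by (auto simp: intersecting_def)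
      qed
      ultimately show "P \<union> B \<in> D - F" by simp
    qed (use finD in simp)
    also have "card (D - F) \<le> card F0"
    proof -
      have split: "card A = card (A \<inter> B) + card (A - B)" if "finite A" for A B :: "nat set set"
      proof -
        have "card (A \<inter> B \<union> (A - B)) = card (A \<inter> B) + card (A - B)"
          using that by (intro card_Un_disjoint) auto
        then show ?thesis by (simp only: Int_Diff_Un)
      qed
      have "card D = card (D \<inter> F) + card (D - F)" "card F = card (D \<inter> F) + card F0"
        using split[OF finD, of F] split[OF finF, of D] by (simp_all only: F0_def Int_commute)
      then show ?thesis using DF by linarith
    qed
    finally have Lx: "card L \<le> 7 * x" using F0x by linarith
    define N where "N = real (n choose k)"
    define N3 where "N3 = real ((n - 3) choose (k - 3))"
    have kn: "k \<le> n" "0 < n" using k by auto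
    have N0: "0 < N" using kn by (simp add: N_def)
    have p0: "0 < p" using k by (simp add: p_def)
    have N3_ge: "2 / 9 * p ^ 3 * N \<le> N3"
      unfolding p_def N_def N3_def using k kn by (intro binomial_minus_3_ge) auto
    have xK: "real x \<le> K * p ^ 4 * N"
    proof -
      have "x \<le> card F0" unfolding P(2)[symmetric] using finF0 by (intro card_mono) (auto simp: H_def)
      then show ?thesis using K(2) by (simp add: F0_def p_def N_def)
    qed
    have "real x * N3 ^ 5 \<le> 64 * real (card L) ^ 5 * N"
    proof -
      have "(n - 3) choose k \<le> n choose k" by (rule binomial_right_mono) simp
      then have "real ((n - 3) choose k) \<le> N" by (simp add: N_def)
      then have "64 * real (card L) ^ 5 * real ((n - 3) choose k) \<le> 64 * real (card L) ^ 5 * N"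
        by (intro mult_left_mono) auto
      then show ?thesis using ineq by (simp add: N3_def)
    qed
    also have "\<dots> \<le> 64 * (7 * real x) ^ 5 * N"
      using Lx N0 by (intro mult_right_mono mult_left_mono power_mono) auto
    also have "\<dots> = real x * (2 * 14 ^ 5 * real x ^ 4 * N)" by (simp add: power_mult_distrib power_eq_if)
    finally have "N3 ^ 5 \<le> 2 * 14 ^ 5 * real x ^ 4 * N" using x0 by simp
    also have "\<dots> \<le> 2 * 14 ^ 5 * (K * p ^ 4 * N) ^ 4 * N"
      using xK N0 by (intro mult_right_mono mult_left_mono power_mono) auto
    finally have 1: "N3 ^ 5 \<le> 2 * 14 ^ 5 * (K * p ^ 4 * N) ^ 4 * N" .
    have "(2 / 9 * p ^ 3 * N) ^ 5 \<le> N3 ^ 5" using N3_ge p0 N0 by (intro power_mono) auto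
    with 1 have "(2 / 9 * p ^ 3 * N) ^ 5 \<le> 2 * 14 ^ 5 * (K * p ^ 4 * N) ^ 4 * N" by linarith
    also have "(2 / 9 * p ^ 3 * N) ^ 5 = (2/9) ^ 5 * (p ^ 15 * N ^ 5)"
      unfolding power_mult_distrib power_mult[symmetric] by simp
    \<comment> \<open>The fourth power of a bound of order p^4 meets the fifth power of one of order
      p^3, and the surplus factor \<open>p\<close> gives the contradiction.\<close>
    also have "2 * 14 ^ 5 * (K * p ^ 4 * N) ^ 4 * N = 2 * 14 ^ 5 * K ^ 4 * p * (p ^ 15 * N ^ 5)"
    proof -
      have "p ^ 16 = p * p ^ 15" "N ^ 5 = N ^ 4 * N" using power_Suc[of p 15] power_Suc2[of N 4] by simp_all
      then show ?thesis unfolding power_mult_distrib power_mult[symmetric] by simp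
    qed
    finally have "(2/9) ^ 5 \<le> 2 * 14 ^ 5 * K ^ 4 * p" using p0 N0 by simp
    then have "(9/2) ^ 5 * (2/9) ^ 5 \<le> (9/2) ^ 5 * (2 * 14 ^ 5 * K ^ 4 * p)" by (intro mult_left_mono) auto
    then have "1 \<le> 2 * 14 ^ 5 * K ^ 4 * (9 / 2) ^ 5 * p" by (simp add: mult_ac flip: power_mult_distrib)
    then show False using small by (simp add: p_def)
  qed
  then have "F \<subseteq> D" by (auto simp: F0_def)
  then show ?thesis using DF finD by (intro card_seteq) auto
qed

text \<open>Discarding the members without a core set loses less than 2 \<epsilon> of the family, so
  every degree stays below half of the rest and the core sets form a triple system. The size
  comparison is what \<open>no_exceptional_sets\<close> then needs to force equality.\<close>

lemma large_low_degree_family_is_fano: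
  "\<exists>C>0. \<forall>\<epsilon> n k \<P> \<F>. 0 < \<epsilon> \<longrightarrow> \<epsilon> \<le> 1 / 28 \<longrightarrow> real n > C / \<epsilon> * real k \<longrightarrow> 3 \<le> k \<longrightarrow>
     fano_plane \<P> \<longrightarrow> \<Union>\<P> \<subseteq> {1..n} \<longrightarrow> \<F> \<subseteq> nsets {1..n} k \<longrightarrow> intersecting \<F> \<longrightarrow>
     real (max_degree n \<F>) \<le> (1 / 2 - \<epsilon>) * real (card \<F>) \<longrightarrow> card (fano_family \<P> n k) \<le> card \<F> \<longrightarrow>
     isomorphic_families n \<F> (fano_family \<P> n k)"
proof -
  obtain K C0 :: real where K: "0 < K" and C0: "0 < C0" and
    few: "\<forall>(S::nat set) F k. finite S \<longrightarrow> F \<subseteq> {A. A \<subseteq> S \<and> card A = k} \<longrightarrow> 1 \<le> k \<longrightarrow>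
     C0 * real k \<le> real (card S) \<longrightarrow>
     real (card {A\<in>F. \<not> (\<exists>X\<subseteq>A. core_set S (\<lambda>V. \<exists>A\<in>F. A \<subseteq> V) X)})
       \<le> K * (real k / real (card S)) ^ 4 * real (card S choose k)"
    using few_sets_without_core[where ?'a = nat] by (elim exE conjE)
  define M where "M = 2 * 14 ^ 5 * K ^ 4 * (9 / 2) ^ 5"
  have M: "0 < M" using K by (simp add: M_def)
  \<comment> \<open>\<open>C0\<close> serves \<open>few_sets_without_core\<close>,
    \<open>5 * K\<close> makes \<open>F'\<close> small against \<epsilon>, \<open>M\<close> serves
    \<open>no_exceptional_sets\<close>, and 200 covers the numerical estimates.\<close>
  define C where "C = C0 + 5 * K + M + 200"
  have C: "0 < C" "C0 \<le> C" "5 * K \<le> C" "M \<le> C" "200 \<le> C" using C0 K M by (auto simp: C_def)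
  show ?thesis
  proof (intro exI[of _ C] conjI allI impI C(1))
    fix \<epsilon> :: real and n k :: nat and \<P> :: "nat set set" and \<F>
    assume \<epsilon>: "0 < \<epsilon>" "\<epsilon> \<le> 1 / 28" and n: "C / \<epsilon> * real k < real n" and k: "3 \<le> k"
      and \<P>: "fano_plane \<P>" "\<Union>\<P> \<subseteq> {1..n}" and \<F>: "\<F> \<subseteq> nsets {1..n} k" "intersecting \<F>"
      and deg: "real (max_degree n \<F>) \<le> (1 / 2 - \<epsilon>) * real (card \<F>)" and DF: "card (fano_family \<P> n k) \<le> card \<F>"
    define p where "p = real k / real n"
    have "C * real k < \<epsilon> * real n" using n \<epsilon> by (simp add: field_simps)
    have "C * 28 * real k \<le> C / \<epsilon> * real k"
      using \<epsilon> C by (intro mult_right_mono) (auto simp: field_simps)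
    then have nk: "C * 28 * real k < real n" using n by linarith
    have n0: "0 < real n" using nk C k by (smt (verit) mult_nonneg_nonneg of_nat_0_le_iff)
    have pC: "C * p < \<epsilon>" using \<open>C * real k < \<epsilon> * real n\<close> n0 by (simp add: p_def field_simps)
    have p0: "0 < p" using k n0 by (simp add: p_def)
    have "200 * 28 * real k \<le> C * 28 * real k" using C by (intro mult_right_mono) auto
    then have "200 * 28 * real k < real n" using nk by linarith
    then have nk2: "5600 * k < n" by linarith
    define N where "N = real (n choose k)"
    define N3 where "N3 = real ((n - 3) choose (k - 3))"
    have kn: "k \<le> n" "1 \<le> n" using nk2 by auto
    have N0: "0 < N" using kn by (simp add: N_def)
    have N3_ge: "2 / 9 * p ^ 3 * N \<le> N3"
      unfolding p_def N_def N3_def using k kn by (intro binomial_minus_3_ge) auto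
    have "200 * p \<le> C * p" using C p0 by (intro mult_right_mono) auto
    then have p200: "200 * p < 1" using pC \<epsilon> by linarith
    have N30: "0 \<le> N3" by (simp add: N3_def)
    have F_ge: "N3 \<le> real (card \<F>)"
    proof -
      have "1 * N3 \<le> 7 * (1 - 4 * p) * N3" using p200 N30 by (intro mult_right_mono) auto
      also have "\<dots> \<le> real (card (fano_family \<P> n k))"
        unfolding p_def N3_def by (rule card_fano_family_ge[OF \<P> k kn(1)])
      finally show ?thesis using DF by simp
    qed
    have F_pos: "0 < real (card \<F>)"
    proof -
      have "0 < 2 / 9 * p ^ 3 * N" using p0 N0 by simp
      then show ?thesis using N3_ge F_ge by linarith
    qed
    define S where "S = {1..n}"
    define core where "core = core_set S (\<lambda>V. \<exists>A\<in>\<F>. A \<subseteq> V)"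
    define F' where "F' = {A\<in>\<F>. \<not> (\<exists>X\<subseteq>A. core X)}"
    have finF: "finite \<F>" using F_pos by (simp add: card_gt_0_iff)
    have F'_le: "real (card F') \<le> K * p ^ 4 * N"
    proof -
      have "C0 * real k \<le> real (card S)"
      proof -
        have "C0 * real k \<le> C * 28 * real k" using C by (intro mult_right_mono) auto
        then show ?thesis using nk by (simp add: S_def)
      qed
      moreover have "\<F> \<subseteq> {A. A \<subseteq> S \<and> card A = k}" using \<F>(1) by (auto simp: nsets_finite S_def)
      ultimately have "real (card F') \<le> K * (real k / real (card S)) ^ 4 * real (card S choose k)"
        unfolding F'_def core_def using k by (intro few[rule_format]) (auto simp: S_def)
      then show ?thesis by (simp add: S_def p_def N_def)
    qed
    have F'_small: "real (card F') < 2 * \<epsilon> * real (card \<F>)"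
    proof -
      note F'_le
      \<comment> \<open>One factor \<open>p\<close> is split off; the rest is bounded by the size of
        the family, and \<open>5 * K * p < \<epsilon>\<close> by the choice of
        \<open>C\<close>.\<close>
      also have "K * p ^ 4 * N = 9 / 2 * (K * p) * (2 / 9 * p ^ 3 * N)" by (simp add: power_eq_if)
      also have "\<dots> \<le> 9 / 2 * (K * p) * real (card \<F>)"
        using N3_ge F_ge K p0 by (intro mult_left_mono) auto
      also have "\<dots> < 2 * \<epsilon> * real (card \<F>)"
      proof (rule mult_strict_right_mono[OF _ F_pos])
        have "5 * K * p \<le> C * p" using C p0 by (intro mult_right_mono) auto
        then show "9 / 2 * (K * p) < 2 * \<epsilon>" using pC \<epsilon> mult_pos_pos[OF K p0] by linarith
      qed
      finally show ?thesis .
    qed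
    define \<X> where "\<X> = {X. core X}"
    define G where "G = \<F> - F'"
    have XS: "X \<subseteq> S \<and> finite X \<and> card X \<le> 3" if "X \<in> \<X>" for X
      using that finite_subset[of X S] by (auto simp: \<X>_def core_def core_set_def S_def)
    interpret triple_system \<X>
    proof (rule triple_system_of_low_degree[where G = G and \<Delta> = "max_degree n \<F>"])
      show "finite G" using finF by (simp add: G_def)
      show "\<exists>X\<in>\<X>. X \<subseteq> A" if "A \<in> G" for A using that by (auto simp: G_def F'_def \<X>_def)
      show "finite X \<and> card X \<le> 3" if "X \<in> \<X>" for X using XS[OF that] by simp
      show "X \<inter> Y \<noteq> {}" if "X \<in> \<X>" "Y \<in> \<X>" for X Y
      proof (rule core_sets_intersect[of S \<F>])
        show "A \<inter> B \<noteq> {}" if "A \<in> \<F>" "B \<in> \<F>" for A B using that \<F>(2) by (simp add: intersecting_def)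
      qed (use that in \<open>auto simp: S_def \<X>_def core_def\<close>)
      show "card {A\<in>G. i \<in> A} \<le> max_degree n \<F>" for i
      proof -
        have "card {A\<in>G. i \<in> A} \<le> card {A\<in>\<F>. i \<in> A}" using finF by (intro card_mono) (auto simp: G_def)
        then show ?thesis using degree_le_max_degree[OF kn(2) \<F>(1), of i] by linarith
      qed
      have "card G = card \<F> - card F'"
        unfolding G_def using finF by (intro card_Diff_subset) (auto simp: F'_def)
      moreover have "card F' \<le> card \<F>" using finF by (intro card_mono) (auto simp: F'_def)
      ultimately have "real (card G) = real (card \<F>) - real (card F')" by simp
      moreover have "2 * ((1 / 2 - \<epsilon>) * real (card \<F>)) = real (card \<F>) - 2 * \<epsilon> * real (card \<F>)" by (simp add: algebra_simps)
      ultimately have "2 * real (max_degree n \<F>) < real (card G)" using deg F'_small by linarith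
      then show "2 * max_degree n \<F> < card G" by linarith
      show "finite A" if "A \<in> G" for A using that \<F>(1) by (auto simp: G_def nsets_def)
    qed
    obtain a b c d e f g where lab: "distinct [a, b, c, d, e, f, g]" "\<X> = fano_lines a b c d e f g"
      using is_fano by blast
    obtain a' b' c' d' e' f' g' where lab': "distinct [a', b', c', d', e', f', g']" "\<P> = fano_lines a' b' c' d' e' f' g'"
      using fano_plane_lines[OF \<P>(1)] by blast
    have sub: "\<Union>\<X> \<subseteq> {1..n}" using XS by (auto simp: S_def)
    have "set [a, b, c, d, e, f, g] \<subseteq> {1..n}" using sub unfolding lab(2) by (simp add: fano_lines_def)
    moreover have "set [a', b', c', d', e', f', g'] \<subseteq> {1..n}" using \<P>(2) unfolding lab'(2) by (simp add: fano_lines_def)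
    ultimately obtain \<pi> where \<pi>: "\<pi> permutes {1..n}" "\<P> = (\<lambda>A. \<pi> ` A) ` \<X>"
      using fano_lines_isomorphic[of "{1..n}" a b c d e f g a' b' c' d' e' f' g'] lab lab' by auto
    have im: "fano_family \<P> n k = (\<lambda>A. \<pi> ` A) ` fano_family \<X> n k"
      unfolding \<pi>(2) by (rule fano_family_image[OF \<pi>(1)])
    have "inj (\<lambda>A. \<pi> ` A)" using permutes_inj[OF \<pi>(1)] by (simp add: inj_image_eq_iff inj_def)
    then have "card (fano_family \<P> n k) = card (fano_family \<X> n k)"
      unfolding im by (intro card_image) (rule inj_on_subset, auto)
    then have DF': "card (fano_family \<X> n k) \<le> card \<F>" using DF by simp
    have "\<F> = fano_family \<X> n k"
    proof (rule no_exceptional_sets[OF lab(1) _ k _ \<F> _ DF' K])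
      show "\<Union>(fano_lines a b c d e f g) \<subseteq> {1..n}" using sub lab(2) by simp
      show "128 * k + 3 \<le> n" using nk2 k by linarith
      show "fano_family \<X> n k = fano_family (fano_lines a b c d e f g) n k" using lab(2) by simp
      have "\<F> - fano_family \<X> n k \<subseteq> F'"
        using \<F>(1) by (auto simp: F'_def fano_family_def \<X>_def)
      then have "card (\<F> - fano_family \<X> n k) \<le> card F'" using finF by (intro card_mono) (auto simp: F'_def)
      then show "real (card (\<F> - fano_family \<X> n k)) \<le> K * (real k / real n) ^ 4 * real (n choose k)"
        using F'_le by (simp add: p_def N_def)
      have "M * p \<le> C * p" using C p0 by (intro mult_right_mono) auto
      then show "2 * 14 ^ 5 * K ^ 4 * (9 / 2) ^ 5 * (real k / real n) < 1"
        using pC \<epsilon> unfolding M_def p_def by linarith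
    qed
    then show "isomorphic_families n \<F> (fano_family \<P> n k)"
      unfolding isomorphic_families_def using \<pi>(1) im by blast
  qed
qed

text \<open>For \<open>k \<le> 2\<close> a nonempty such family could serve as its own system of
  core sets, which would force its members to have three points.\<close>

lemma small_uniformity_empty:
  assumes k: "k \<le> 2" and n: "1 \<le> n" and \<F>: "\<F> \<subseteq> nsets {1..n} k" "intersecting \<F>"
    and deg: "2 * max_degree n \<F> < card \<F> \<or> \<F> = {}"
  shows "\<F> = {}"
proof (rule ccontr)
  assume ne: "\<F> \<noteq> {}"
  have fk: "finite A \<and> card A = k" if "A \<in> \<F>" for A using that \<F>(1) by (auto simp: nsets_def)
  have "finite \<F>" by (rule finite_subset[OF \<F>(1) finite_imp_finite_nsets]) simp
  then have "triple_system \<F>"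
  proof (rule triple_system_of_low_degree)
    show "card {A\<in>\<F>. i \<in> A} \<le> max_degree n \<F>" for i by (rule degree_le_max_degree[OF n \<F>(1)])
    show "finite X \<and> card X \<le> 3" if "X \<in> \<F>" for X using fk[OF that] k by simp
  qed (use \<F>(2) deg ne fk in \<open>auto simp: intersecting_def\<close>)
  then have "card A = 3" if "A \<in> \<F>" for A using that by (rule triple_system.triples)
  then show False using ne fk k by fastforce
qed

text \<open>The lower bound on \<open>c\<close> makes the Fano family an admissible competitor, so
  the extremal family is at least as large; the upper bound gives the degree condition that fixes
  its structure.\<close>

theorem theorem12:
  shows "\<exists>C::real. 0 < C \<and>
    (\<forall>(\<epsilon>::real) (c::real) (n::nat) (k::nat) (\<P>::nat set set) (\<F>::nat set set).
       0 < \<epsilon> \<longrightarrow> c \<in> {3/7 + \<epsilon> .. 1/2 - \<epsilon>} \<longrightarrow> real n > C / \<epsilon> * real k \<longrightarrow>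
       fano_plane \<P> \<longrightarrow> \<Union>\<P> \<subseteq> {1..n} \<longrightarrow>
       \<F> \<subseteq> nsets {1..n} k \<longrightarrow> intersecting \<F> \<longrightarrow>
       real (max_degree n \<F>) \<le> c * real (card \<F>) \<longrightarrow>
       (\<forall>\<G>. \<G> \<subseteq> nsets {1..n} k \<longrightarrow> intersecting \<G> \<longrightarrow>
            real (max_degree n \<G>) \<le> c * real (card \<G>) \<longrightarrow> card \<G> \<le> card \<F>) \<longrightarrow>
       isomorphic_families n \<F> (fano_family \<P> n k))"
proof -
  obtain C1 :: real where C1: "0 < C1" and
    main: "\<forall>\<epsilon> n k \<P> \<F>. 0 < \<epsilon> \<longrightarrow> \<epsilon> \<le> 1 / 28 \<longrightarrow> real n > C1 / \<epsilon> * real k \<longrightarrow> 3 \<le> k \<longrightarrow>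
     fano_plane \<P> \<longrightarrow> \<Union>\<P> \<subseteq> {1..n} \<longrightarrow> \<F> \<subseteq> nsets {1..n} k \<longrightarrow> intersecting \<F> \<longrightarrow>
     real (max_degree n \<F>) \<le> (1 / 2 - \<epsilon>) * real (card \<F>) \<longrightarrow> card (fano_family \<P> n k) \<le> card \<F> \<longrightarrow>
     isomorphic_families n \<F> (fano_family \<P> n k)"
    using large_low_degree_family_is_fano by (elim exE conjE)
  define C where "C = C1 + 3"
  have C: "0 < C" "C1 \<le> C" "3 \<le> C" using C1 by (auto simp: C_def)
  show ?thesis
  proof (intro exI[of _ C] conjI allI impI C(1))
    fix \<epsilon> c :: real and n k :: nat and \<P> \<F> :: "nat set set"
    assume \<epsilon>: "0 < \<epsilon>" and c: "c \<in> {3/7 + \<epsilon> .. 1/2 - \<epsilon>}" and n: "C / \<epsilon> * real k < real n"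
      and \<P>: "fano_plane \<P>" "\<Union>\<P> \<subseteq> {1..n}" and \<F>: "\<F> \<subseteq> nsets {1..n} k" "intersecting \<F>"
      and deg: "real (max_degree n \<F>) \<le> c * real (card \<F>)"
      and opt: "\<forall>\<G>. \<G> \<subseteq> nsets {1..n} k \<longrightarrow> intersecting \<G> \<longrightarrow>
            real (max_degree n \<G>) \<le> c * real (card \<G>) \<longrightarrow> card \<G> \<le> card \<F>"
    \<comment> \<open>The interval for \<open>c\<close> is nonempty only if \<epsilon> is at most
      1/28.\<close>
    have cc: "3/7 + \<epsilon> \<le> c" "c \<le> 1/2 - \<epsilon>" "\<epsilon> \<le> 1/28" using c by auto
    have "0 \<le> C / \<epsilon> * real k" using C \<epsilon> by simp
    then have "0 < real n" using n by linarith
    then have n1: "1 \<le> n" by simp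
    have deg': "real (max_degree n \<F>) \<le> (1/2 - \<epsilon>) * real (card \<F>)"
      using deg cc(2) mult_right_mono[of c "1/2 - \<epsilon>" "real (card \<F>)"] by linarith
    show "isomorphic_families n \<F> (fano_family \<P> n k)"
    proof (cases "3 \<le> k")
      case True
      have Ck: "C * real k < \<epsilon> * real n" using n \<epsilon> by (simp add: field_simps)
      define p where "p = real k / real n"
      have pC: "C * p < \<epsilon>" using Ck \<open>0 < real n\<close> by (simp add: p_def field_simps)
      have p0: "0 < p" using True \<open>0 < real n\<close> by (simp add: p_def)
      have "3 * p \<le> C * p" using C p0 by (intro mult_right_mono) auto
      then have p3: "3 * p < \<epsilon>" using pC by linarith
      then have "p < 1" using cc by linarith
      then have kn: "k \<le> n" using \<open>0 < real n\<close> by (simp add: p_def)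
      define N where "N = real ((n - 3) choose (k - 3))"
      have "real (max_degree n (fano_family \<P> n k)) \<le> c * real (card (fano_family \<P> n k))"
      proof -
        have "real (max_degree n (fano_family \<P> n k)) \<le> (3 + 7 * p) * N"
          unfolding p_def N_def by (rule max_degree_fano_family_le[OF \<P> True kn])
        also have "\<dots> \<le> (3/7 + \<epsilon>) * (7 * (1 - 4 * p)) * N"
        proof (rule mult_right_mono)
          \<comment> \<open>The claim amounts to 19 p + 28 \<epsilon> p \<le> 7 \<epsilon>. The left
            side is at most 20 p, and 21 p < 7 \<epsilon> follows from
            \<open>3 \<le> C\<close>.\<close>
          have "\<epsilon> * p \<le> 1/28 * p" using cc p0 by (intro mult_right_mono) auto
          moreover have "(3/7 + \<epsilon>) * (7 * (1 - 4 * p)) = 3 + 7 * \<epsilon> - 12 * p - 28 * (\<epsilon> * p)"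
            by (simp add: algebra_simps)
          ultimately show "3 + 7 * p \<le> (3/7 + \<epsilon>) * (7 * (1 - 4 * p))"
            using p3 p0 by linarith
        qed (simp add: N_def)
        also have "\<dots> = (3/7 + \<epsilon>) * (7 * (1 - 4 * p) * N)" by simp
        also have "\<dots> \<le> (3/7 + \<epsilon>) * real (card (fano_family \<P> n k))"
          unfolding p_def N_def using \<epsilon> by (intro mult_left_mono card_fano_family_ge[OF \<P> True kn]) auto
        also have "\<dots> \<le> c * real (card (fano_family \<P> n k))"
          using cc by (intro mult_right_mono) auto
        finally show ?thesis .
      qed
      then have "card (fano_family \<P> n k) \<le> card \<F>"
        using opt intersecting_fano_family[OF \<P>(1)] by (auto simp: fano_family_def)
      moreover have "C1 / \<epsilon> * real k < real n"
      proof -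
        have "C1 / \<epsilon> * real k \<le> C / \<epsilon> * real k" using C \<epsilon> by (intro mult_right_mono divide_right_mono) auto
        then show ?thesis using n by linarith
      qed
      ultimately show ?thesis
        using main \<epsilon> cc(3) True \<P> \<F> deg' by blast
    next
      \<comment> \<open>A set of fewer than three points contains no line, so the Fano family is
        empty and the extremal family has to be empty as well.\<close>
      case False
      have "2 * max_degree n \<F> < card \<F> \<or> \<F> = {}"
      proof (cases "\<F> = {}")
        case False
        have "finite \<F>" by (rule finite_subset[OF \<F>(1) finite_imp_finite_nsets]) simp
        then have "0 < real (card \<F>)" using False by (simp add: card_gt_0_iff)
        then have "0 < \<epsilon> * real (card \<F>)" using \<epsilon> by simp
        then have "2 * real (max_degree n \<F>) < real (card \<F>)" using deg' by (simp add: algebra_simps)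
        then show ?thesis by linarith
      qed simp
      then have "\<F> = {}" using False n1 \<F> by (intro small_uniformity_empty) auto
      moreover have "fano_family \<P> n k = {}"
      proof (rule ccontr)
        assume "fano_family \<P> n k \<noteq> {}"
        then obtain A P where A: "A \<in> nsets {1..n} k" "P \<in> \<P>" "P \<subseteq> A" by (auto simp: fano_family_def)
        then have "card P \<le> card A" by (intro card_mono) (auto simp: nsets_def)
        then show False using A finite_fano_plane(5)[OF \<P>(1) A(2)] False by (simp add: nsets_def)
      qed
      ultimately show ?thesis
        unfolding isomorphic_families_def by (intro exI[of _ id]) (simp add: permutes_id)
    qed
  qed
qed

end
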